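(* Under assumptions (A1)-(A3) and (B1)-(B3) listed in the context, there exist $\alpha^*=\alpha^*(D,K)>0$ and constants $\underline{\delta}\in(0,1)$, $\bar{\delta}>0$ not depending on $\alpha$, such that for every $\alpha>\alpha^*$ $$\Phi\Big((1+\bar{\delta})\,\alpha\log(n)\ \ge\ K_n\ \ge\ (1-\underline{\delta})\,\alpha\log(n)\ \Big|\ X_{1:n}\Big)\to1$$ as $n\to\infty$ in $Q^{(\infty)}$-probability.
   Context: Let $D\ge 1$, let $\|\cdot\|$ be the Euclidean norm, and let $f$ be a probability density on $\mathbb{R}^D$ (w.r.t. Lebesgue measure). For a probability measure $P$ on $\mathbb{R}^D$ write $Pf(x)=\int f(x-\theta)\,P(d\theta)$. Prior: $\alpha>0$ is the concentration parameter, $P_0$ is a probability measure on $\Theta\subset\mathbb{R}^D$, and $\Pi$ is the law of the Dirichlet process $P\sim \mathrm{DP}(\alpha,P_0)$ in stick-breaking form, $P=\sum_{k\ge1}w_k\delta_{\theta_k}$, $w_k=v_k\prod_{j=1}^{k-1}(1-v_j)$, $v_k$ i.i.d. $\mathrm{Beta}(1,\alpha)$, $\theta_k$ i.i.d. $P_0$, the two sequences being independent. Allocation variables: consider the model $X_i\mid P,c_i\sim f(\cdot-\theta_{c_i})$ independently, $c_i\mid P$ i.i.d. categorical on $\mathbb{N}=\{1,2,\dots\}$ with probabilities $(w_k)_{k\ge1}$, $P\sim\mathrm{DP}(\alpha,P_0)$. $\Phi(\cdot\mid X_{1:n})$ is the induced posterior law of $c_{1:n}=(c_1,\dots,c_n)$: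 $\Phi(c_{1:n}=k_{1:n}\mid X_{1:n})=\int\prod_{i=1}^n w_{k_i}f(X_i-\theta_{k_i})\,d\Pi\big/\int\prod_{i=1}^nPf(X_i)\,\Pi(dP)$. $K_n$ is the number of distinct values in $c_{1:n}$. Assumptions: (A1) $X_1,X_2,\dots$ are i.i.d. from $Q(dx)=P^*f(x)\,dx$, where $P^*=\sum_{k=1}^K w_k^*\delta_{\theta_k^*}$, $K<\infty$, $(w_1^*,\dots,w_K^* )$ is a probability vector, and $P^*$ has exactly $K$ support points (the $\theta_k^*$ are distinct and $w_k^*>0$). (A2) $\Theta\subset\mathbb{R}^D$ is compact and $\theta_k^*\in\Theta$ for all $k=1,\dots,K$. (A3) $P_0$ has a continuous bounded density $p_0$ on $\Theta$ w.r.t. Lebesgue measure, with $p_0(\theta_k^* )>0$ for all $k=1,\dots,K$. (B1) $f\in C^3(\mathbb{R}^D)$ and there is a constant $F$ with $0<f(x)<F$ for all $x$. (B2) There are $R>0$, $\gamma\ge0$ with $\|\nabla\log f(x)\|\le R(1+\|x\|)^\gamma$ and $\|\nabla^2\log f(x)\|\le R(1+\|x\|)^\gamma$ for all $x$, and $\int e^{M\|x\|^\gamma}f(x)\,dx<\infty$ for every $M>0$. (B3) There are $C,r>0$ with $\|\nabla^g f(x)\|\le C(1+\|x\|)^{-(D+r)}$ for all $x$ and $g=1,2,3$. $Q^{(\infty)}$ is the law of the i.i.d. sequence $(X_i)_{i\ge1}$, and $X_{1:n}=(X_1,\dots,X_n)$.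
   Formalization: Adds to (A2)-(A3) that Θ has volume at least c·r^D in balls of radius r ≤ 1 around each θ_k^*; without it p_0(θ_k^* )>0 is meaningless at, e.g., an isolated point of Θ, and the claim fails there. *)

theory Defs
  imports "HOL-Probability.Probability"
begin

section \<open>Discrete mixing measures and mixture densities\<close>

text \<open>The discrete measure with mass \<open>w k\<close> at \<open>\<theta> k\<close>, summed over \<open>k \<in> I\<close>.\<close>

definition discrete_mixing ::
    "nat set \<Rightarrow> (nat \<Rightarrow> real) \<Rightarrow> (nat \<Rightarrow> 'a::euclidean_space) \<Rightarrow> 'a measure" where
  "discrete_mixing I w \<theta> = distr (density (count_space I) (\<lambda>k. ennreal (w k))) borel \<theta>"

definition mixture :: "'a::euclidean_space measure \<Rightarrow> ('a \<Rightarrow> real) \<Rightarrow> 'a \<Rightarrow> real" where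
  "mixture P f x = (\<integral>\<theta>. f (x - \<theta>) \<partial>P)"

section \<open>Dirichlet process in stick-breaking form\<close>

definition beta_density :: "real \<Rightarrow> real \<Rightarrow> real \<Rightarrow> real" where
  "beta_density a b x =
     (if 0 < x \<and> x < 1 then x powr (a - 1) * (1 - x) powr (b - 1) / Beta a b else 0)"

definition beta_measure :: "real \<Rightarrow> real \<Rightarrow> real measure" where
  "beta_measure a b = density lborel (\<lambda>x. ennreal (beta_density a b x))"

text \<open>Sticks and atoms are numbered from \<open>0\<close>, so \<open>stick_weight v k\<close> is the weight usually
  written with index \<open>k + 1\<close>.\<close>

definition stick_weight :: "(nat \<Rightarrow> real) \<Rightarrow> nat \<Rightarrow> real" where
  "stick_weight v k = v k * (\<Prod>j<k. 1 - v j)"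

text \<open>The joint law of the two independent i.i.d. sequences \<open>(v, \<theta>)\<close>.  The law of the Dirichlet
  process is its image under \<open>(v, \<theta>) \<mapsto> dp_draw (v, \<theta>)\<close>; integrals against the Dirichlet process
  are written as integrals against \<open>stick_breaking\<close>, because the allocation probabilities depend
  on the numbering of the atoms and not only on the random measure.\<close>

definition stick_breaking ::
    "real \<Rightarrow> 'a::euclidean_space measure \<Rightarrow> ((nat \<Rightarrow> real) \<times> (nat \<Rightarrow> 'a)) measure" where
  "stick_breaking \<alpha> P0 =
     (\<Pi>\<^sub>M k\<in>UNIV. beta_measure 1 \<alpha>) \<Otimes>\<^sub>M (\<Pi>\<^sub>M k\<in>UNIV. P0)"

definition dp_draw :: "(nat \<Rightarrow> real) \<times> (nat \<Rightarrow> 'a::euclidean_space) \<Rightarrow> 'a measure" where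
  "dp_draw = (\<lambda>(v, \<theta>). discrete_mixing UNIV (stick_weight v) \<theta>)"

section \<open>Posterior law of the allocation variables\<close>

text \<open>The observations are \<open>X 0, \<dots>, X (n - 1)\<close>, and an allocation vector is an extensional function
  on \<open>{..<n}\<close>.  There are countably many such vectors, so their law is given by its point masses.\<close>

definition allocation_mass ::
    "real \<Rightarrow> 'a::euclidean_space measure \<Rightarrow> ('a \<Rightarrow> real) \<Rightarrow> nat \<Rightarrow> (nat \<Rightarrow> 'a) \<Rightarrow> (nat \<Rightarrow> nat) \<Rightarrow> real"
where
  "allocation_mass \<alpha> P0 f n X c =
     (\<integral>(v, \<theta>). (\<Prod>i<n. stick_weight v (c i) * f (X i - \<theta> (c i))) \<partial>stick_breaking \<alpha> P0) /
     (\<integral>\<omega>. (\<Prod>i<n. mixture (dp_draw \<omega>) f (X i)) \<partial>stick_breaking \<alpha> P0)"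

definition allocation_posterior ::
    "real \<Rightarrow> 'a::euclidean_space measure \<Rightarrow> ('a \<Rightarrow> real) \<Rightarrow> nat \<Rightarrow> (nat \<Rightarrow> 'a) \<Rightarrow> (nat \<Rightarrow> nat) measure"
where
  "allocation_posterior \<alpha> P0 f n X =
     density (count_space ({..<n} \<rightarrow>\<^sub>E UNIV)) (\<lambda>c. ennreal (allocation_mass \<alpha> P0 f n X c))"

definition num_clusters :: "nat \<Rightarrow> (nat \<Rightarrow> nat) \<Rightarrow> nat" where
  "num_clusters n c = card (c ` {..<n})"

section \<open>Convergence in probability\<close>

definition tendsto_in_prob :: "'b measure \<Rightarrow> (nat \<Rightarrow> 'b \<Rightarrow> real) \<Rightarrow> real \<Rightarrow> bool" where
  "tendsto_in_prob M Z l \<longleftrightarrow>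
     (\<forall>\<epsilon>>0. (\<lambda>n. measure M {\<omega> \<in> space M. \<bar>Z n \<omega> - l\<bar> > \<epsilon>}) \<longlonglongrightarrow> 0)"

section \<open>Assumptions on the data-generating distribution and on the base measure\<close>

definition finite_mixing_params :: "nat \<Rightarrow> (nat \<Rightarrow> real) \<Rightarrow> (nat \<Rightarrow> 'a) \<Rightarrow> bool" where
  "finite_mixing_params K w \<theta> \<longleftrightarrow>
     (\<forall>k<K. 0 < w k) \<and> (\<Sum>k<K. w k) = 1 \<and> inj_on \<theta> {..<K}"

definition data_law ::
    "nat \<Rightarrow> (nat \<Rightarrow> real) \<Rightarrow> (nat \<Rightarrow> 'a::euclidean_space) \<Rightarrow> ('a \<Rightarrow> real) \<Rightarrow> 'a measure" where
  "data_law K w \<theta> f =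
     density lborel (\<lambda>x. ennreal (mixture (discrete_mixing {..<K} w \<theta>) f x))"

definition iid_sequence :: "'a measure \<Rightarrow> (nat \<Rightarrow> 'a) measure" where
  "iid_sequence Q = (\<Pi>\<^sub>M i\<in>UNIV. Q)"

definition base_measure_on ::
    "'a::euclidean_space set \<Rightarrow> 'a measure \<Rightarrow> ('a \<Rightarrow> real) \<Rightarrow> bool" where
  "base_measure_on \<Theta> P0 p0 \<longleftrightarrow>
     prob_space P0 \<and>
     P0 = density lborel (\<lambda>x. ennreal (indicator \<Theta> x * p0 x)) \<and>
     (\<forall>x\<in>\<Theta>. 0 \<le> p0 x) \<and> continuous_on \<Theta> p0 \<and> bounded (p0 ` \<Theta>)"

text \<open>A density on \<open>\<Theta>\<close> that is continuous on \<open>\<Theta>\<close> and positive at \<open>t \<in> \<Theta>\<close> controls the mass near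
  \<open>t\<close> only if \<open>\<Theta>\<close> itself has volume of order \<open>r ^ DIM('a)\<close> in balls around \<open>t\<close>; at an isolated
  point of \<open>\<Theta>\<close>, for instance, its value is arbitrary.  The following holds at every interior point
  of \<open>\<Theta>\<close>, and at every point of \<open>\<Theta>\<close> if \<open>\<Theta>\<close> is a convex body or a closed Lipschitz domain.\<close>

definition lebesgue_thick_at :: "'a::euclidean_space set \<Rightarrow> 'a \<Rightarrow> bool" where
  "lebesgue_thick_at \<Theta> t \<longleftrightarrow>
     (\<exists>c>0. \<forall>r. 0 < r \<and> r \<le> 1 \<longrightarrow> c * r ^ DIM('a) \<le> measure lborel (\<Theta> \<inter> cball t r))"

section \<open>Assumptions on the kernel\<close>

definition probability_density :: "('a::euclidean_space \<Rightarrow> real) \<Rightarrow> bool" where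
  "probability_density f \<longleftrightarrow>
     f \<in> borel_measurable borel \<and> (\<forall>x. 0 \<le> f x) \<and> (\<integral>\<^sup>+x. ennreal (f x) \<partial>lborel) = 1"

text \<open>The Frechet derivative as a bounded linear map.  Iterating it gives \<open>\<nabla>\<^sup>2 f\<close> and \<open>\<nabla>\<^sup>3 f\<close> as
  elements of nested spaces of bounded linear maps, normed by the operator norm; for real-valued
  \<open>f\<close>, the norm of \<open>nabla f x\<close> is the Euclidean norm of the gradient.\<close>

definition nabla ::
    "('a::real_normed_vector \<Rightarrow> 'b::real_normed_vector) \<Rightarrow> 'a \<Rightarrow> 'a \<Rightarrow>\<^sub>L 'b" where
  "nabla g x = Blinfun (frechet_derivative g (at x))"

definition C3 :: "('a::real_normed_vector \<Rightarrow> real) \<Rightarrow> bool" where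
  "C3 f \<longleftrightarrow>
     (\<forall>x. f differentiable (at x)) \<and>
     (\<forall>x. nabla f differentiable (at x)) \<and>
     (\<forall>x. nabla (nabla f) differentiable (at x)) \<and>
     continuous_on UNIV (nabla (nabla (nabla f)))"

definition smooth_bounded_kernel :: "('a::euclidean_space \<Rightarrow> real) \<Rightarrow> bool" where
  "smooth_bounded_kernel f \<longleftrightarrow> C3 f \<and> (\<exists>F. \<forall>x. 0 < f x \<and> f x < F)"

text \<open>In Isabelle \<open>0 powr 0 = 0\<close>; for \<open>\<gamma> = 0\<close> this changes the integrand below only at \<open>x = 0\<close>.\<close>

definition log_derivative_growth :: "('a::euclidean_space \<Rightarrow> real) \<Rightarrow> bool" where
  "log_derivative_growth f \<longleftrightarrow>
     (\<exists>R \<gamma>. R > 0 \<and> \<gamma> \<ge> 0 \<and>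
        (\<forall>x. norm (nabla (\<lambda>y. ln (f y)) x) \<le> R * (1 + norm x) powr \<gamma>) \<and>
        (\<forall>x. norm (nabla (nabla (\<lambda>y. ln (f y))) x) \<le> R * (1 + norm x) powr \<gamma>) \<and>
        (\<forall>M>0. integrable lborel (\<lambda>x. exp (M * norm x powr \<gamma>) * f x)))"

definition derivative_decay :: "('a::euclidean_space \<Rightarrow> real) \<Rightarrow> bool" where
  "derivative_decay f \<longleftrightarrow>
     (\<exists>C r. C > 0 \<and> r > 0 \<and>
        (\<forall>x. norm (nabla f x) \<le> C * (1 + norm x) powr (- (real DIM('a) + r)) \<and>
             norm (nabla (nabla f) x) \<le> C * (1 + norm x) powr (- (real DIM('a) + r)) \<and>
             norm (nabla (nabla (nabla f)) x) \<le> C * (1 + norm x) powr (- (real DIM('a) + r))))"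

end

theory Submission
  imports Defs "HOL-Real_Asymp.Real_Asymp"
begin

text \<open>
  Let \<open>p\<close> be the true density, \<open>D\<close> the dimension, and \<open>L = \<alpha> ln n\<close>.  Call an allocation atypical if its number of
  clusters lies outside \<open>[L / 200, 5 L]\<close>.  The posterior probability of the atypical allocations is a
  ratio.  Divide numerator and denominator by the likelihood \<open>p (X 0) \<cdots> p (X (n - 1))\<close> of the truth;
  both become averages over the prior of likelihood ratios, and these have mean one under the data.
  Three estimates then decide the matter.

  \<^item> By Tonelli, the mean of the numerator over the data is exactly the prior probability of an
  atypical allocation (\<open>nn_integral_alloc_evidence\<close>).  Both tails of the prior number of clusters are
  at most of order \<open>n powr (- 3/4 * \<alpha>)\<close> (\<open>prior_atypical_alloc\<close>): a deviation of the number of clusters by a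
  constant factor costs a power of \<open>n\<close> that is proportional to \<open>\<alpha>\<close>.

  \<^item> Restrict the denominator to draws whose first \<open>K\<close> weights and atoms are within a distance of
  order \<open>\<epsilon>\<close> from the true ones and whose remaining weight is at most \<open>\<epsilon>\<close>.  Such a mixture
  differs from \<open>p\<close> by at most a constant times \<open>\<epsilon> G\<close>, where the envelope \<open>G\<close> is square integrable
  against \<open>1 / p\<close> (\<open>kernel_envelope\<close>), so its chi-square distance from \<open>p\<close> is of order
  \<open>\<epsilon>\<^sup>2\<close> (\<open>dp_ratio_second_moment\<close>), and the likelihood ratio of \<open>n\<close> observations has variance of order
  \<open>n \<epsilon>\<^sup>2\<close>.  For \<open>\<epsilon> = n powr (-3/5)\<close> this tends to zero, so with high probability the
  denominator is at least half the prior mass of these draws (\<open>evidence_lower_bound\<close>).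

  \<^item> That prior mass is at least of order \<open>\<epsilon> powr (\<alpha> + K (D + 1))\<close> (\<open>prior_near_truth\<close>).  The
  \<open>\<alpha>\<close> in the exponent is the price of a remaining weight below \<open>\<epsilon>\<close>; the other parameters, fewer
  than \<open>K (D + 1)\<close> real numbers, contribute one power of \<open>\<epsilon>\<close> each.

  It is essential that \<open>\<epsilon>\<close> may be much larger than \<open>1 / n\<close>.  Demanding a remaining weight below
  \<open>1 / n\<close> would cost a factor of order \<open>n powr (- \<alpha>)\<close>, and no lower deviation of the number of
  clusters is rarer than that: a single cluster already has prior probability of this order.
  With \<open>\<epsilon> = n powr (-3/5)\<close> the quotient of the two rates is
  \<open>n powr (- 3/4 * \<alpha> + 3/5 * (\<alpha> + K (D + 1)))\<close>, which tends to zero as soon as \<open>\<alpha> > 4 K (D + 1)\<close>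
  (\<open>posterior_typical\<close>).
\<close>

section \<open>Products over sequences and over allocations\<close>

text \<open>Only finitely many coordinates occur, so the infinite product may be restricted to them; all
  moments of sticks and of observations below are instances.\<close>
lemma nn_integral_iid_prod:
  fixes g :: "'i \<Rightarrow> 'b \<Rightarrow> ennreal"
  assumes M: "prob_space M" and J: "finite J" and g: "\<And>j. j \<in> J \<Longrightarrow> g j \<in> borel_measurable M"
  shows "(\<integral>\<^sup>+X. (\<Prod>j\<in>J. g j (X j)) \<partial>(\<Pi>\<^sub>M i\<in>UNIV. M)) = (\<Prod>j\<in>J. \<integral>\<^sup>+x. g j x \<partial>M)"
proof -
  interpret P: product_prob_space "\<lambda>_. M" UNIV
    by (simp add: M product_prob_space_axioms.intro product_prob_space_def
        product_sigma_finite.intro prob_space_imp_sigma_finite)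
  have gm: "(\<lambda>Y. \<Prod>j\<in>J. g j (Y j)) \<in> borel_measurable (\<Pi>\<^sub>M i\<in>J. M)"
  proof (rule borel_measurable_prod_ennreal)
    fix j assume "j \<in> J"
    then show "(\<lambda>Y. g j (Y j)) \<in> borel_measurable (\<Pi>\<^sub>M i\<in>J. M)"
      using g[of j] by (intro measurable_compose[OF measurable_component_singleton]) auto
  qed
  have "(\<integral>\<^sup>+X. (\<Prod>j\<in>J. g j (X j)) \<partial>(\<Pi>\<^sub>M i\<in>UNIV. M))
      = (\<integral>\<^sup>+X. (\<Prod>j\<in>J. g j (restrict X J j)) \<partial>(\<Pi>\<^sub>M i\<in>UNIV. M))"
    by (intro nn_integral_cong prod.cong) auto
  also have "\<dots> = (\<integral>\<^sup>+Y. (\<Prod>j\<in>J. g j (Y j)) \<partial>distr (\<Pi>\<^sub>M i\<in>UNIV. M) (\<Pi>\<^sub>M i\<in>J. M) (\<lambda>X. restrict X J))"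
    by (rule nn_integral_distr[symmetric, OF measurable_restrict_subset]) (simp_all add: gm)
  also have "\<dots> = (\<integral>\<^sup>+Y. (\<Prod>j\<in>J. g j (Y j)) \<partial>(\<Pi>\<^sub>M i\<in>J. M))"
    by (subst P.distr_PiM_restrict_finite) (use J in auto)
  also have "\<dots> = (\<Prod>j\<in>J. \<integral>\<^sup>+x. g j x \<partial>M)"
    by (rule P.product_nn_integral_prod) (use J g in auto)
  finally show ?thesis .
qed

text \<open>The distributive law for a product of \<open>n\<close> series.  Summing over all allocations replaces \<open>c i\<close>
  by a free summation index in each factor, which is how the allocation variables are integrated out.\<close>
lemma nn_integral_allocations_prod:
  fixes g :: "nat \<Rightarrow> nat \<Rightarrow> ennreal"
  shows "(\<integral>\<^sup>+c. (\<Prod>i<n. g i (c i)) \<partial>count_space ({..<n} \<rightarrow>\<^sub>E UNIV)) = (\<Prod>i<n. \<Sum>k. g i k)"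
proof -
  interpret product_sigma_finite "\<lambda>_::nat. count_space (UNIV :: nat set)"
    by (intro product_sigma_finite.intro sigma_finite_measure_count_space_countable) auto
  have "count_space ({..<n} \<rightarrow>\<^sub>E UNIV) = (\<Pi>\<^sub>M i\<in>{..<n}. count_space (UNIV::nat set))"
    by (rule count_space_PiM_finite[symmetric]) auto
  then show ?thesis
    by (simp add: product_nn_integral_prod nn_integral_count_space_nat)
qed

section \<open>Stick breaking\<close>

definition stick_rest :: "(nat \<Rightarrow> real) \<Rightarrow> nat \<Rightarrow> real" where
  "stick_rest v k = (\<Prod>j<k. 1 - v j)"

lemma stick_weight_eq: "stick_weight v k = v k * stick_rest v k"
  by (simp add: stick_weight_def stick_rest_def)

lemma sum_stick_weight: "(\<Sum>j<k. stick_weight v j) = 1 - stick_rest v k"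
  by (induction k) (simp_all add: stick_weight_eq stick_rest_def algebra_simps)

text \<open>The sticks for which the weights form a probability vector with positive entries; almost all
  sequences of sticks have this property (\<open>AE_proper_sticks\<close>).\<close>
definition proper_sticks :: "(nat \<Rightarrow> real) set" where
  "proper_sticks = {v. (\<forall>k. 0 < v k \<and> v k < 1) \<and> stick_rest v \<longlonglongrightarrow> 0}"

lemma stick_rest_pos: "(\<And>k. v k < 1) \<Longrightarrow> 0 < stick_rest v k"
  by (auto simp: stick_rest_def intro!: prod_pos)

lemma stick_rest_le_1: "(\<And>k. 0 < v k \<and> v k < 1) \<Longrightarrow> stick_rest v k \<le> 1"
  unfolding stick_rest_def by (intro prod_le_1) (auto simp: less_imp_le)

lemma stick_rest_antimono:
  assumes "\<And>k. 0 < v k \<and> v k < 1" "j \<le> k"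
  shows "stick_rest v k \<le> stick_rest v j"
  using assms(2)
proof (induction k rule: dec_induct)
  case (step k)
  have "stick_rest v (Suc k) \<le> stick_rest v k * 1"
    unfolding stick_rest_def prod.lessThan_Suc
    by (intro mult_left_mono prod_nonneg) (use assms(1) in \<open>auto simp: less_imp_le\<close>)
  with step show ?case by simp
qed simp

lemma proper_sticksD:
  assumes "v \<in> proper_sticks"
  shows "0 < v k" "v k < 1" "0 < stick_rest v k" "0 < stick_weight v k" "stick_weight v sums 1"
    "stick_weight v k \<le> 1"
proof -
  have a: "0 < v k \<and> v k < 1" for k using assms by (auto simp: proper_sticks_def)
  show "0 < v k" "v k < 1" using a by auto
  show r: "0 < stick_rest v k" by (rule stick_rest_pos) (use a in auto)
  show "0 < stick_weight v k" using a r by (auto simp: stick_weight_eq)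
  have "stick_rest v \<longlonglongrightarrow> 0" using assms by (simp add: proper_sticks_def)
  then have "(\<lambda>k. 1 - stick_rest v k) \<longlonglongrightarrow> 1 - 0" by (intro tendsto_intros)
  then show "stick_weight v sums 1" by (simp add: sums_def sum_stick_weight)
  have "v k * stick_rest v k \<le> 1 * 1"
    by (rule mult_mono) (use a[of k] r stick_rest_le_1[OF a] in \<open>auto\<close>)
  then show "stick_weight v k \<le> 1" by (simp add: stick_weight_eq)
qed

lemma beta_density_1: "0 < \<alpha> \<Longrightarrow> beta_density 1 \<alpha> x = (if 0 < x \<and> x < 1 then \<alpha> * (1 - x) powr (\<alpha> - 1) else 0)"
proof -
  assume "0 < \<alpha>"
  have "Gamma (\<alpha> + 1) = \<alpha> * Gamma \<alpha>" using \<open>0 < \<alpha>\<close> by (intro Gamma_plus1) auto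
  moreover have "Gamma \<alpha> \<noteq> 0" using Gamma_real_pos[OF \<open>0 < \<alpha>\<close>] by simp
  ultimately have "Beta 1 \<alpha> = 1 / \<alpha>" using \<open>0 < \<alpha>\<close> by (simp add: Beta_def add.commute)
  then show ?thesis by (simp add: beta_density_def)
qed

lemma beta_density_measurable[measurable]: "beta_density a b \<in> borel_measurable borel"
  unfolding beta_density_def by measurable

lemma sets_beta_measure[measurable_cong, simp]: "sets (beta_measure a b) = sets borel"
  by (simp add: beta_measure_def)

lemma space_beta_measure[simp]: "space (beta_measure a b) = UNIV"
  by (simp add: beta_measure_def)

text \<open>For \<open>s > 0\<close> these moments control the probability that the remaining weight is large, and for
  \<open>- \<alpha> < s < 0\<close> the probability that it is small.\<close>
lemma nn_integral_beta_powr: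
  assumes "0 < \<alpha>" "0 < \<alpha> + s"
  shows "(\<integral>\<^sup>+x. ennreal ((1 - x) powr s) \<partial>beta_measure 1 \<alpha>) = ennreal (\<alpha> / (\<alpha> + s))"
proof -
  have B: "Beta 1 (\<alpha> + s) = 1 / (\<alpha> + s)"
  proof -
    have "Gamma (\<alpha> + s + 1) = (\<alpha> + s) * Gamma (\<alpha> + s)" using assms by (intro Gamma_plus1) auto
    moreover have "Gamma (\<alpha> + s) \<noteq> 0" by (rule order.strict_implies_not_eq[OF Gamma_real_pos[OF assms(2)], symmetric])
    ultimately show ?thesis using assms by (simp add: Beta_def add.commute)
  qed
  have "((\<lambda>t. t powr (1 - 1) * (1 - t) powr (\<alpha> + s - 1)) has_integral Beta 1 (\<alpha> + s)) {0..1}"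
    by (rule has_integral_Beta_real) (use assms in auto)
  then have "((\<lambda>t. \<alpha> * (t powr 0 * (1 - t) powr (\<alpha> + s - 1))) has_integral \<alpha> * (1 / (\<alpha> + s))) {0..1}"
    unfolding B diff_self by (rule has_integral_mult_right)
  then have "((\<lambda>t. \<alpha> * (t powr 0 * (1 - t) powr (\<alpha> + s - 1))) has_integral \<alpha> / (\<alpha> + s)) {0<..<1}"
    by (simp add: has_integral_Icc_iff_Ioo)
  then have I: "((\<lambda>t. if t \<in> {0<..<1} then \<alpha> * (t powr 0 * (1 - t) powr (\<alpha> + s - 1)) else 0)
     has_integral \<alpha> / (\<alpha> + s)) UNIV"
    by (subst has_integral_restrict_UNIV)
  have "(\<integral>\<^sup>+x. ennreal ((1 - x) powr s) \<partial>beta_measure 1 \<alpha>)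
     = (\<integral>\<^sup>+x. ennreal (beta_density 1 \<alpha> x) * ennreal ((1 - x) powr s) \<partial>lborel)"
    unfolding beta_measure_def by (rule nn_integral_density) measurable
  also have "\<dots> = (\<integral>\<^sup>+t. ennreal (if t \<in> {0<..<1} then \<alpha> * (t powr 0 * (1 - t) powr (\<alpha> + s - 1)) else 0) \<partial>lborel)"
    by (intro nn_integral_cong)
      (use assms in \<open>auto simp: beta_density_1 ennreal_mult[symmetric] powr_add[symmetric] algebra_simps\<close>)
  also have "\<dots> = ennreal (\<alpha> / (\<alpha> + s))"
    by (rule nn_integral_has_integral_lborel[OF _ _ I]) (use assms in auto)
  finally show ?thesis .
qed

lemma prob_space_beta: "0 < \<alpha> \<Longrightarrow> prob_space (beta_measure 1 \<alpha>)"
proof (rule prob_spaceI)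
  assume "0 < \<alpha>"
  have "AE x in beta_measure 1 \<alpha>. x < 1"
    unfolding beta_measure_def by (subst AE_density) (use \<open>0 < \<alpha>\<close> in \<open>auto simp: beta_density_1\<close>)
  then have "emeasure (beta_measure 1 \<alpha>) (space (beta_measure 1 \<alpha>))
     = (\<integral>\<^sup>+x. ennreal ((1 - x) powr 0) \<partial>beta_measure 1 \<alpha>)"
    by (subst nn_integral_cong_AE[of _ "\<lambda>_. 1"]) auto
  also have "\<dots> = 1" using nn_integral_beta_powr[of \<alpha> 0] \<open>0 < \<alpha>\<close> by simp
  finally show "emeasure (beta_measure 1 \<alpha>) (space (beta_measure 1 \<alpha>)) = 1" .
qed

lemma AE_beta: "0 < \<alpha> \<Longrightarrow> AE x in beta_measure 1 \<alpha>. 0 < x \<and> x < 1"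
  unfolding beta_measure_def by (subst AE_density) (auto simp: beta_density_1)

text \<open>The density of a stick is at most \<open>\<alpha>\<close>, so it is dominated by \<open>\<alpha> / l\<close> times an exponential density.\<close>
lemma nn_integral_beta_exp_le:
  assumes "1 \<le> \<alpha>" "0 < l"
  shows "(\<integral>\<^sup>+x. ennreal (exp (- l * x)) \<partial>beta_measure 1 \<alpha>) \<le> ennreal (\<alpha> / l)"
proof -
  have "(\<integral>\<^sup>+x. ennreal (exp (- l * x)) \<partial>beta_measure 1 \<alpha>)
     = (\<integral>\<^sup>+x. ennreal (beta_density 1 \<alpha> x) * ennreal (exp (- l * x)) \<partial>lborel)"
    unfolding beta_measure_def by (rule nn_integral_density) measurable
  also have "\<dots> \<le> (\<integral>\<^sup>+x. ennreal (\<alpha> / l) * ennreal (exponential_density l x) \<partial>lborel)"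
  proof (rule nn_integral_mono)
    fix x :: real
    have "beta_density 1 \<alpha> x * exp (- l * x) \<le> \<alpha> / l * exponential_density l x"
    proof (cases "0 < x \<and> x < 1")
      case True
      have "(1 - x) powr (\<alpha> - 1) \<le> 1" using True assms by (intro powr_le1) auto
      then show ?thesis using True assms
        by (simp add: beta_density_1 exponential_density_def mult_le_cancel_right2 mult.commute)
    qed (use assms in \<open>auto simp: beta_density_1 exponential_density_def\<close>)
    then show "ennreal (beta_density 1 \<alpha> x) * ennreal (exp (- l * x))
        \<le> ennreal (\<alpha> / l) * ennreal (exponential_density l x)"
      using assms by (simp add: ennreal_mult'[symmetric] ennreal_mult''[symmetric] exponential_density_nonneg ennreal_leI)
  qed
  also have "\<dots> = ennreal (\<alpha> / l) * (\<integral>\<^sup>+x. ennreal (exponential_density l x) \<partial>lborel)"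
    by (rule nn_integral_cmult) measurable
  also have "(\<integral>\<^sup>+x. ennreal (exponential_density l x) \<partial>lborel) = 1"
    using prob_space.emeasure_space_1[OF prob_space_exponential_density[OF assms(2)]]
    by (simp add: emeasure_density)
  finally show ?thesis by simp
qed

text \<open>The density decreases, so on the interval it is at least its value at the right end point.  Stopping
  at \<open>b - \<epsilon>/2\<close> instead of \<open>b\<close> keeps that value positive for \<open>b = 1\<close>.\<close>
lemma beta_interval_lower:
  assumes "1 \<le> \<alpha>" "0 < \<epsilon>" "\<epsilon> < b" "b \<le> 1"
  shows "emeasure (beta_measure 1 \<alpha>) {b - \<epsilon>..b - \<epsilon>/2} \<ge> ennreal (\<alpha> * (1 - b + \<epsilon>/2) powr (\<alpha> - 1) * (\<epsilon>/2))"
proof -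
  let ?c = "\<alpha> * (1 - b + \<epsilon>/2) powr (\<alpha> - 1)"
  have "ennreal (?c * (\<epsilon>/2)) = (\<integral>\<^sup>+x. ennreal ?c * indicator {b - \<epsilon>..b - \<epsilon>/2} x \<partial>lborel)"
    using assms by (subst nn_integral_cmult_indicator) (auto simp: ennreal_mult'[symmetric])
  also have "\<dots> \<le> (\<integral>\<^sup>+x. ennreal (beta_density 1 \<alpha> x) * indicator {b - \<epsilon>..b - \<epsilon>/2} x \<partial>lborel)"
    using assms
    by (intro nn_integral_mono)
      (auto simp: beta_density_1 indicator_def intro!: ennreal_leI powr_mono2)
  also have "\<dots> = emeasure (beta_measure 1 \<alpha>) {b - \<epsilon>..b - \<epsilon>/2}"
    by (simp add: beta_measure_def emeasure_density)
  finally show ?thesis .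
qed

abbreviation beta_sequence :: "real \<Rightarrow> (nat \<Rightarrow> real) measure" where
  "beta_sequence \<alpha> \<equiv> \<Pi>\<^sub>M k\<in>UNIV. beta_measure 1 \<alpha>"

lemma prob_space_beta_sequence: "0 < \<alpha> \<Longrightarrow> prob_space (beta_sequence \<alpha>)"
  by (intro prob_space_PiM prob_space_beta)

lemma measurable_stick_rest[measurable]: "(\<lambda>v. stick_rest v k) \<in> borel_measurable (beta_sequence \<alpha>)"
  unfolding stick_rest_def by measurable

lemma measurable_stick_weight[measurable]: "(\<lambda>v. stick_weight v k) \<in> borel_measurable (beta_sequence \<alpha>)"
  unfolding stick_weight_def by measurable

lemma AE_beta_sequence: "0 < \<alpha> \<Longrightarrow> AE v in beta_sequence \<alpha>. \<forall>k. 0 < v k \<and> v k < 1"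
  unfolding AE_all_countable by (intro allI AE_PiM_component prob_space_beta AE_beta) auto

lemma nn_integral_stick_rest_powr:
  assumes "0 < \<alpha>" "0 < \<alpha> + s"
  shows "(\<integral>\<^sup>+v. ennreal (stick_rest v k powr s) \<partial>beta_sequence \<alpha>) = ennreal ((\<alpha> / (\<alpha> + s)) ^ k)"
proof -
  have "(\<integral>\<^sup>+v. ennreal (stick_rest v k powr s) \<partial>beta_sequence \<alpha>)
     = (\<integral>\<^sup>+v. (\<Prod>j<k. ennreal ((1 - v j) powr s)) \<partial>beta_sequence \<alpha>)"
  proof (rule nn_integral_cong_AE, use AE_beta_sequence[OF assms(1)] in eventually_elim)
    fix v :: "nat \<Rightarrow> real" assume "\<forall>k. 0 < v k \<and> v k < 1"
    then show "ennreal (stick_rest v k powr s) = (\<Prod>j<k. ennreal ((1 - v j) powr s))"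
      by (simp add: stick_rest_def prod_ennreal prod_powr_distrib less_imp_le)
  qed
  also have "\<dots> = (\<Prod>j<k. \<integral>\<^sup>+x. ennreal ((1 - x) powr s) \<partial>beta_measure 1 \<alpha>)"
    by (rule nn_integral_iid_prod) (use assms in \<open>auto intro: prob_space_beta\<close>)
  also have "\<dots> = ennreal ((\<alpha> / (\<alpha> + s)) ^ k)"
    using assms by (simp add: nn_integral_beta_powr ennreal_power)
  finally show ?thesis .
qed

lemma nn_integral_exp_sticks_le:
  assumes "1 \<le> \<alpha>" "0 < l" "finite J"
  shows "(\<integral>\<^sup>+v. ennreal (exp (- l * sum v J)) \<partial>beta_sequence \<alpha>) \<le> ennreal ((\<alpha> / l) ^ card J)"
proof -
  have "(\<integral>\<^sup>+v. ennreal (exp (- l * sum v J)) \<partial>beta_sequence \<alpha>)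
     = (\<integral>\<^sup>+v. (\<Prod>j\<in>J. ennreal (exp (- l * v j))) \<partial>beta_sequence \<alpha>)"
    using assms(3) by (simp add: prod_ennreal exp_sum sum_distrib_left flip: sum_negf)
  also have "\<dots> = (\<Prod>j\<in>J. \<integral>\<^sup>+x. ennreal (exp (- l * x)) \<partial>beta_measure 1 \<alpha>)"
    by (rule nn_integral_iid_prod) (use assms in \<open>auto intro: prob_space_beta\<close>)
  also have "\<dots> \<le> (\<Prod>j\<in>J. ennreal (\<alpha> / l))"
    by (intro prod_mono_ennreal nn_integral_beta_exp_le) (use assms in auto)
  also have "\<dots> = ennreal ((\<alpha> / l) ^ card J)"
    using assms by (simp add: ennreal_power)
  finally show ?thesis .
qed

text \<open>The remaining weight decreases, and its mean after \<open>k\<close> sticks is \<open>(\<alpha> / (\<alpha> + 1)) ^ k\<close>; hence its limit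
  has mean zero.\<close>
lemma AE_proper_sticks:
  assumes "0 < \<alpha>"
  shows "AE v in beta_sequence \<alpha>. v \<in> proper_sticks"
proof -
  let ?L = "\<lambda>v. INF k. ennreal (stick_rest v k)"
  have le: "(\<integral>\<^sup>+v. ?L v \<partial>beta_sequence \<alpha>) \<le> ennreal ((\<alpha> / (\<alpha> + 1)) ^ k)" for k
  proof -
    have "(\<integral>\<^sup>+v. ?L v \<partial>beta_sequence \<alpha>) \<le> (\<integral>\<^sup>+v. ennreal (stick_rest v k powr 1) \<partial>beta_sequence \<alpha>)"
    proof (rule nn_integral_mono_AE, use AE_beta_sequence[OF assms] in eventually_elim)
      fix v :: "nat \<Rightarrow> real" assume "\<forall>k. 0 < v k \<and> v k < 1"
      then have "0 < stick_rest v k" by (intro stick_rest_pos) auto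
      then show "?L v \<le> ennreal (stick_rest v k powr 1)"
        by (auto intro: INF_lower2)
    qed
    also have "\<dots> = ennreal ((\<alpha> / (\<alpha> + 1)) ^ k)"
      by (rule nn_integral_stick_rest_powr) (use assms in auto)
    finally show ?thesis .
  qed
  have "(\<lambda>k. ennreal ((\<alpha> / (\<alpha> + 1)) ^ k)) \<longlonglongrightarrow> ennreal 0"
    by (intro tendsto_ennrealI LIMSEQ_power_zero) (use assms in auto)
  then have "(\<integral>\<^sup>+v. ?L v \<partial>beta_sequence \<alpha>) \<le> ennreal 0"
    by (rule LIMSEQ_le_const) (use le in auto)
  then have "AE v in beta_sequence \<alpha>. ?L v = 0"
    using nn_integral_0_iff_AE[of ?L "beta_sequence \<alpha>"] by simp
  with AE_beta_sequence[OF assms] show ?thesis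
  proof eventually_elim
    case (elim v)
    have "decseq (\<lambda>k. ennreal (stick_rest v k))"
      by (intro decseq_SucI ennreal_leI stick_rest_antimono) (use elim in auto)
    then have "(\<lambda>k. ennreal (stick_rest v k)) \<longlonglongrightarrow> ennreal 0"
      using LIMSEQ_INF elim by fastforce
    then have "stick_rest v \<longlonglongrightarrow> 0"
      by (subst (asm) tendsto_ennreal_iff) (use stick_rest_pos[of v] elim in \<open>auto simp: less_imp_le\<close>)
    then show ?case using elim by (simp add: proper_sticks_def)
  qed
qed

section \<open>The number of clusters under the prior\<close>

text \<open>The conditional prior probability of \<open>A\<close> given the sticks: the \<open>c i\<close> are then independent with law
  \<open>stick_weight v\<close>.\<close>
definition alloc_prior :: "nat \<Rightarrow> (nat \<Rightarrow> real) \<Rightarrow> (nat \<Rightarrow> nat) set \<Rightarrow> ennreal" where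
  "alloc_prior n v A =
     (\<integral>\<^sup>+c. (\<Prod>i<n. ennreal (stick_weight v (c i))) * indicator A c \<partial>count_space ({..<n} \<rightarrow>\<^sub>E UNIV))"

lemma countable_allocations: "countable ({..<n :: nat} \<rightarrow>\<^sub>E (UNIV :: nat set))"
  by (intro countable_PiE) auto

lemma measurable_nn_integral_count_space:
  fixes g :: "'i \<Rightarrow> 'b \<Rightarrow> ennreal"
  assumes "countable I" and [measurable]: "\<And>i. i \<in> I \<Longrightarrow> g i \<in> borel_measurable M"
  shows "(\<lambda>x. \<integral>\<^sup>+i. g i x \<partial>count_space I) \<in> borel_measurable M"
proof -
  interpret sigma_finite_measure "count_space I"
    by (rule sigma_finite_measure_count_space_countable[OF assms(1)])
  have "(\<lambda>(i, x). g i x) \<in> borel_measurable (count_space I \<Otimes>\<^sub>M M)"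
    by (rule measurable_pair_measure_countable1[OF assms(1)]) simp
  then have "(\<lambda>(x, i). g i x) \<in> borel_measurable (M \<Otimes>\<^sub>M count_space I)"
    by (subst measurable_pair_swap_iff) (simp add: case_prod_beta')
  then show ?thesis by (rule borel_measurable_nn_integral)
qed

lemma measurable_alloc_prior[measurable]:
  "(\<lambda>v. alloc_prior n v A) \<in> borel_measurable (beta_sequence \<alpha>)"
  unfolding alloc_prior_def
  by (rule measurable_nn_integral_count_space[OF countable_allocations]) measurable

lemma suminf_stick_weight_mult:
  assumes "\<And>k. 0 \<le> w k" "\<And>k. 0 \<le> h k" "(\<lambda>k. h k * w k) sums s"
  shows "(\<Sum>k. ennreal (h k) * ennreal (w k)) = ennreal s"
proof -
  have "(\<Sum>k. ennreal (h k) * ennreal (w k)) = (\<Sum>k. ennreal (h k * w k))"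
    using assms by (simp add: ennreal_mult)
  also have "\<dots> = ennreal (\<Sum>k. h k * w k)"
    by (rule suminf_ennreal2) (use assms in \<open>auto simp: sums_iff\<close>)
  finally show ?thesis using assms(3) by (simp add: sums_iff)
qed

text \<open>Markov's inequality for a test function that is a product over the observations: its mean
  factorizes into \<open>s ^ n\<close>.  Both tails of the number of clusters use it, with different \<open>h\<close>.\<close>
lemma alloc_prior_le:
  assumes v: "v \<in> proper_sticks" and h: "\<And>k. 0 \<le> h k" "(\<lambda>k. h k * stick_weight v k) sums s"
    and A: "\<And>c. c \<in> A \<Longrightarrow> 1 \<le> b * (\<Prod>i<n. h (c i))" and "0 \<le> b"
  shows "alloc_prior n v A \<le> ennreal (b * s ^ n)"
proof -
  have w: "0 \<le> stick_weight v k" for k using proper_sticksD(4)[OF v] by (simp add: less_imp_le)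
  have s: "0 \<le> s" by (rule sums_le[OF _ sums_zero h(2)]) (use h(1) w in auto)
  have "alloc_prior n v A \<le> (\<integral>\<^sup>+c. ennreal b * (\<Prod>i<n. ennreal (h (c i)) * ennreal (stick_weight v (c i)))
      \<partial>count_space ({..<n} \<rightarrow>\<^sub>E UNIV))"
    unfolding alloc_prior_def
  proof (intro nn_integral_mono)
    fix c
    show "(\<Prod>i<n. ennreal (stick_weight v (c i))) * indicator A c
       \<le> ennreal b * (\<Prod>i<n. ennreal (h (c i)) * ennreal (stick_weight v (c i)))"
    proof (cases "c \<in> A")
      case True
      have "(\<Prod>i<n. stick_weight v (c i)) * 1 \<le> (\<Prod>i<n. stick_weight v (c i)) * (b * (\<Prod>i<n. h (c i)))"
        by (intro mult_left_mono prod_nonneg) (use A True w in auto)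
      then have "(\<Prod>i<n. stick_weight v (c i)) \<le> b * (\<Prod>i<n. h (c i) * stick_weight v (c i))"
        by (simp add: prod.distrib algebra_simps)
      then show ?thesis using True h w \<open>0 \<le> b\<close>
        by (simp add: prod_ennreal ennreal_mult[symmetric] prod_nonneg ennreal_leI)
    qed simp
  qed
  also have "\<dots> = ennreal b * (\<integral>\<^sup>+c. (\<Prod>i<n. ennreal (h (c i)) * ennreal (stick_weight v (c i)))
      \<partial>count_space ({..<n} \<rightarrow>\<^sub>E UNIV))"
    by (rule nn_integral_cmult) simp
  also have "\<dots> = ennreal (b * s ^ n)"
    using nn_integral_allocations_prod[where g="\<lambda>_ k. ennreal (h k) * ennreal (stick_weight v k)" and n=n]
      suminf_stick_weight_mult[OF w h] s \<open>0 \<le> b\<close>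
    by (simp add: ennreal_power ennreal_mult)
  finally show ?thesis .
qed

lemma alloc_prior_le_1: "v \<in> proper_sticks \<Longrightarrow> alloc_prior n v A \<le> 1"
  using alloc_prior_le[of v "\<lambda>_. 1" 1 A 1 n] proper_sticksD(5)[of v] by simp

text \<open>At most \<open>k\<close> clusters are among the first \<open>k\<close> sticks, so at least \<open>y\<close> observations fall beyond
  them.  If the remaining weight is below \<open>1 / n\<close>, then the mean of 2 to the number of such observations
  is at most \<open>exp 1\<close>, which gives the second term; otherwise the first term is at least 1.\<close>
lemma alloc_prior_many_clusters:
  assumes v: "v \<in> proper_sticks" and "0 < \<alpha>"
    and A: "\<And>c. c \<in> A \<Longrightarrow> real k + y \<le> real (num_clusters n c)"
  shows "alloc_prior n v A \<le> ennreal ((real n * stick_rest v k) powr \<alpha>) + ennreal (exp 1 * 2 powr (- y))"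
proof (cases "1 \<le> real n * stick_rest v k")
  case True
  have "alloc_prior n v A \<le> ennreal 1" using alloc_prior_le_1[OF v] by simp
  also have "\<dots> \<le> ennreal ((real n * stick_rest v k) powr \<alpha>)"
    by (intro ennreal_leI ge_one_powr_ge_zero) (use True assms in auto)
  finally show ?thesis by (simp add: add_increasing2)
next
  case False
  have r: "0 < stick_rest v k" using proper_sticksD[OF v] by auto
  let ?h = "\<lambda>j. if k \<le> j then 2 else 1 :: real"
  have s1: "stick_weight v sums 1" by (rule proper_sticksD[OF v])
  have "(\<lambda>j. if j \<in> {..<k} then stick_weight v j else 0) sums (\<Sum>j<k. stick_weight v j)"
    by (rule sums_If_finite_set) simp
  then have "(\<lambda>j. 2 * stick_weight v j - (if j \<in> {..<k} then stick_weight v j else 0)) sums (2 * 1 - (1 - stick_rest v k))"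
    unfolding sum_stick_weight by (intro sums_diff sums_mult s1)
  also have "(\<lambda>j. 2 * stick_weight v j - (if j \<in> {..<k} then stick_weight v j else 0)) = (\<lambda>j. ?h j * stick_weight v j)"
    by auto
  finally have s: "(\<lambda>j. ?h j * stick_weight v j) sums (1 + stick_rest v k)" by simp
  have "alloc_prior n v A \<le> ennreal (2 powr (- y) * (1 + stick_rest v k) ^ n)"
  proof (rule alloc_prior_le[OF v _ s])
    fix c assume "c \<in> A"
    have "c ` {..<n} \<subseteq> {..<k} \<union> c ` {i\<in>{..<n}. k \<le> c i}" by force
    then have "card (c ` {..<n}) \<le> card ({..<k} \<union> c ` {i\<in>{..<n}. k \<le> c i})"
      by (intro card_mono) auto
    also have "\<dots> \<le> k + card (c ` {i\<in>{..<n}. k \<le> c i})"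
      using card_Un_le[of "{..<k}"] by simp
    also have "card (c ` {i\<in>{..<n}. k \<le> c i}) \<le> card {i\<in>{..<n}. k \<le> c i}"
      by (rule card_image_le) simp
    finally have "y \<le> real (card {i\<in>{..<n}. k \<le> c i})"
      using A[OF \<open>c \<in> A\<close>] by (simp add: num_clusters_def)
    then have "2 powr y \<le> 2 powr real (card {i\<in>{..<n}. k \<le> c i})" by simp
    also have "\<dots> = (\<Prod>i<n. ?h (c i))"
      by (simp add: powr_realpow prod.If_cases Int_def)
    finally show "1 \<le> 2 powr (- y) * (\<Prod>i<n. ?h (c i))"
      by (simp add: powr_minus field_simps)
  qed auto
  also have "\<dots> \<le> ennreal (exp 1 * 2 powr (- y))"
  proof (rule ennreal_leI)
    have "(1 + stick_rest v k) ^ n \<le> exp (stick_rest v k) ^ n"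
      by (intro power_mono) (use r in auto)
    also have "\<dots> = exp (real n * stick_rest v k)" by (simp add: exp_of_nat_mult)
    also have "\<dots> \<le> exp 1" using False by simp
    finally show "2 powr (- y) * (1 + stick_rest v k) ^ n \<le> exp 1 * 2 powr (- y)"
      by (simp add: mult.commute)
  qed
  finally show ?thesis by (simp add: add_increasing)
qed

text \<open>The sticks in \<open>J\<close> have total weight at least \<open>\<tau> * sum v J\<close>, because each of them is broken off
  a remainder of at least \<open>\<tau>\<close>; all \<open>n\<close> observations must miss this weight.\<close>
lemma alloc_prior_avoid:
  assumes v: "v \<in> proper_sticks" and J: "J \<subseteq> {..<M}" and \<tau>: "\<tau> \<le> stick_rest v M"
  shows "alloc_prior n v {c. c ` {..<n} \<inter> J = {}} \<le> ennreal (exp (- (real n * \<tau>) * sum v J))"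
proof -
  let ?h = "\<lambda>j. if j \<in> J then 0 else 1 :: real"
  have fin: "finite J" using J finite_subset by blast
  have s1: "stick_weight v sums 1" by (rule proper_sticksD[OF v])
  have "(\<lambda>j. if j \<in> J then stick_weight v j else 0) sums (\<Sum>j\<in>J. stick_weight v j)"
    using fin by (rule sums_If_finite_set)
  then have "(\<lambda>j. stick_weight v j - (if j \<in> J then stick_weight v j else 0)) sums (1 - (\<Sum>j\<in>J. stick_weight v j))"
    by (intro sums_diff s1)
  also have "(\<lambda>j. stick_weight v j - (if j \<in> J then stick_weight v j else 0)) = (\<lambda>j. ?h j * stick_weight v j)"
    by auto
  finally have s: "(\<lambda>j. ?h j * stick_weight v j) sums (1 - (\<Sum>j\<in>J. stick_weight v j))" .
  have nn: "0 \<le> 1 - (\<Sum>j\<in>J. stick_weight v j)"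
    by (rule sums_le[OF _ sums_zero s]) (use proper_sticksD(4)[OF v] in \<open>auto simp: less_imp_le\<close>)
  have "alloc_prior n v {c. c ` {..<n} \<inter> J = {}} \<le> ennreal (1 * (1 - (\<Sum>j\<in>J. stick_weight v j)) ^ n)"
  proof (rule alloc_prior_le[OF v _ s])
    fix c assume "c \<in> {c. c ` {..<n} \<inter> J = {}}"
    then have "(\<Prod>i<n. ?h (c i)) = 1" by (intro prod.neutral) auto
    then show "1 \<le> 1 * (\<Prod>i<n. ?h (c i))" by simp
  qed auto
  also have "\<dots> \<le> ennreal (exp (- (real n * \<tau>) * sum v J))"
  proof (rule ennreal_leI)
    have *: "\<tau> * sum v J \<le> (\<Sum>j\<in>J. stick_weight v j)"
      unfolding sum_distrib_left
    proof (rule sum_mono)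
      fix j assume "j \<in> J"
      then have "stick_rest v M \<le> stick_rest v j"
        by (intro stick_rest_antimono) (use J proper_sticksD[OF v] in \<open>auto simp: less_imp_le\<close>)
      then show "\<tau> * v j \<le> stick_weight v j"
        using \<tau> proper_sticksD(1)[OF v, of j] by (simp add: stick_weight_eq mult.commute)
    qed
    have "(1 - (\<Sum>j\<in>J. stick_weight v j)) \<le> exp (- (\<Sum>j\<in>J. stick_weight v j))"
      using exp_ge_add_one_self[of "- (\<Sum>j\<in>J. stick_weight v j)"] by simp
    also have "\<dots> \<le> exp (- (\<tau> * sum v J))" using * by simp
    finally have "(1 - (\<Sum>j\<in>J. stick_weight v j)) ^ n \<le> exp (- (\<tau> * sum v J)) ^ n"
      by (intro power_mono nn)
    also have "\<dots> = exp (- (real n * \<tau>) * sum v J)"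
      by (simp add: exp_of_nat_mult[symmetric] algebra_simps)
    finally show "1 * (1 - (\<Sum>j\<in>J. stick_weight v j)) ^ n \<le> exp (- (real n * \<tau>) * sum v J)" by simp
  qed
  finally show ?thesis .
qed

lemma alloc_prior_subadd:
  assumes "finite S" "\<And>c. c \<in> A \<Longrightarrow> \<exists>J\<in>S. c \<in> B J"
  shows "alloc_prior n v A \<le> (\<Sum>J\<in>S. alloc_prior n v (B J))"
proof -
  have "alloc_prior n v A \<le> (\<integral>\<^sup>+c. (\<Sum>J\<in>S. (\<Prod>i<n. ennreal (stick_weight v (c i))) * indicator (B J) c)
     \<partial>count_space ({..<n} \<rightarrow>\<^sub>E UNIV))"
    unfolding alloc_prior_def
  proof (intro nn_integral_mono)
    fix c
    have "indicator A c \<le> (\<Sum>J\<in>S. indicator (B J) c :: ennreal)"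
    proof (cases "c \<in> A")
      case True
      then obtain J where "J \<in> S" "c \<in> B J" using assms by blast
      then have "indicator A c \<le> (indicator (B J) c :: ennreal)" by (simp add: indicator_def)
      also have "\<dots> \<le> (\<Sum>J\<in>S. indicator (B J) c :: ennreal)"
        using \<open>J \<in> S\<close> assms(1) by (intro member_le_sum) auto
      finally show ?thesis .
    qed simp
    then show "(\<Prod>i<n. ennreal (stick_weight v (c i))) * indicator A c
        \<le> (\<Sum>J\<in>S. (\<Prod>i<n. ennreal (stick_weight v (c i))) * indicator (B J) c)"
      unfolding sum_distrib_left[symmetric] by (rule mult_left_mono) simp
  qed
  also have "\<dots> = (\<Sum>J\<in>S. alloc_prior n v (B J))"
    unfolding alloc_prior_def by (rule nn_integral_sum) simp
  finally show ?thesis .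
qed

text \<open>If at most \<open>m\<close> clusters occur, then at least \<open>m\<close> of the first \<open>2 m\<close> sticks are empty, and a
  union bound over the sets of empty sticks applies.  The bound on each of them presupposes that
  the remaining weight after \<open>2 m\<close> sticks is at least \<open>\<tau>\<close>; where it is not, the first term exceeds 1.\<close>
lemma alloc_prior_few_clusters:
  assumes v: "v \<in> proper_sticks" and "0 < s" "0 < \<tau>"
    and A: "\<And>c. c \<in> A \<Longrightarrow> num_clusters n c \<le> m"
  shows "alloc_prior n v A \<le> ennreal (\<tau> powr s * stick_rest v (2 * m) powr (- s))
     + (\<Sum>J | J \<subseteq> {..<2 * m} \<and> m \<le> card J. ennreal (exp (- (real n * \<tau>) * sum v J)))"
proof (cases "stick_rest v (2 * m) < \<tau>")
  case True
  have r: "0 < stick_rest v (2 * m)" using proper_sticksD[OF v] by auto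
  have "alloc_prior n v A \<le> ennreal 1" using alloc_prior_le_1[OF v] by simp
  also have "\<dots> \<le> ennreal (\<tau> powr s * stick_rest v (2 * m) powr (- s))"
  proof (rule ennreal_leI)
    have "stick_rest v (2 * m) powr s \<le> \<tau> powr s"
      using True r assms by (intro powr_mono2) auto
    then show "1 \<le> \<tau> powr s * stick_rest v (2 * m) powr (- s)"
      using r by (simp add: powr_minus field_simps)
  qed
  finally show ?thesis by (simp add: add_increasing2)
next
  case False
  have "alloc_prior n v A \<le> (\<Sum>J | J \<subseteq> {..<2 * m} \<and> m \<le> card J. alloc_prior n v {c. c ` {..<n} \<inter> J = {}})"
  proof (rule alloc_prior_subadd)
    show "finite {J. J \<subseteq> {..<2 * m} \<and> m \<le> card J}" by (rule finite_subset[of _ "Pow {..<2*m}"]) auto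
    fix c assume "c \<in> A"
    have "m \<le> card ({..<2 * m} - c ` {..<n})"
      using diff_card_le_card_Diff[of "c ` {..<n}" "{..<2 * m}"] A[OF \<open>c \<in> A\<close>]
      by (simp add: num_clusters_def)
    then show "\<exists>J\<in>{J. J \<subseteq> {..<2 * m} \<and> m \<le> card J}. c \<in> {c. c ` {..<n} \<inter> J = {}}"
      by (intro bexI[of _ "{..<2 * m} - c ` {..<n}"]) auto
  qed
  also have "\<dots> \<le> (\<Sum>J | J \<subseteq> {..<2 * m} \<and> m \<le> card J. ennreal (exp (- (real n * \<tau>) * sum v J)))"
    by (intro sum_mono alloc_prior_avoid[OF v, where M="2*m"]) (use False in auto)
  finally show ?thesis by (simp add: add_increasing)
qed

lemma nn_integral_alloc_prior_many:
  assumes "0 < \<alpha>" and A: "\<And>c. c \<in> A \<Longrightarrow> real k + y \<le> real (num_clusters n c)"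
  shows "(\<integral>\<^sup>+v. alloc_prior n v A \<partial>beta_sequence \<alpha>)
     \<le> ennreal (real n powr \<alpha> * (1/2) ^ k + exp 1 * 2 powr (- y))"
proof -
  interpret prob_space "beta_sequence \<alpha>" by (rule prob_space_beta_sequence) fact
  have "(\<integral>\<^sup>+v. alloc_prior n v A \<partial>beta_sequence \<alpha>)
     \<le> (\<integral>\<^sup>+v. ennreal (real n powr \<alpha>) * ennreal (stick_rest v k powr \<alpha>) + ennreal (exp 1 * 2 powr (- y)) \<partial>beta_sequence \<alpha>)"
  proof (rule nn_integral_mono_AE, use AE_proper_sticks[OF assms(1)] in eventually_elim)
    fix v assume v: "v \<in> proper_sticks"
    then have "(real n * stick_rest v k) powr \<alpha> = real n powr \<alpha> * stick_rest v k powr \<alpha>"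
      using proper_sticksD(3)[OF v] by (simp add: powr_mult less_imp_le)
    then show "alloc_prior n v A \<le> ennreal (real n powr \<alpha>) * ennreal (stick_rest v k powr \<alpha>) + ennreal (exp 1 * 2 powr (- y))"
      using alloc_prior_many_clusters[OF v assms] by (simp add: ennreal_mult)
  qed
  also have "\<dots> = ennreal (real n powr \<alpha>) * ennreal ((\<alpha> / (\<alpha> + \<alpha>)) ^ k) + ennreal (exp 1 * 2 powr (- y))"
    using assms by (simp add: nn_integral_add nn_integral_cmult nn_integral_stick_rest_powr emeasure_space_1)
  also have "\<dots> = ennreal (real n powr \<alpha> * (1/2) ^ k + exp 1 * 2 powr (- y))"
    using assms by (simp add: ennreal_mult'[symmetric])
  finally show ?thesis .
qed

lemma nn_integral_alloc_prior_few:
  assumes "1 \<le> \<alpha>" "0 < s" "s < \<alpha>" "0 < \<tau>" "\<alpha> \<le> real n * \<tau>"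
    and A: "\<And>c. c \<in> A \<Longrightarrow> num_clusters n c \<le> m"
  shows "(\<integral>\<^sup>+v. alloc_prior n v A \<partial>beta_sequence \<alpha>)
     \<le> ennreal (\<tau> powr s * (\<alpha> / (\<alpha> - s)) ^ (2 * m) + 4 ^ m * (\<alpha> / (real n * \<tau>)) ^ m)"
proof -
  let ?S = "{J. J \<subseteq> {..<2 * m} \<and> m \<le> card J}"
  have pos: "0 < real n * \<tau>" and \<alpha>: "0 < \<alpha>" using assms by linarith+
  have finS: "finite ?S" by (rule finite_subset[of _ "Pow {..<2*m}"]) auto
  have "(\<integral>\<^sup>+v. alloc_prior n v A \<partial>beta_sequence \<alpha>)
     \<le> (\<integral>\<^sup>+v. ennreal (\<tau> powr s) * ennreal (stick_rest v (2 * m) powr (- s))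
         + (\<Sum>J\<in>?S. ennreal (exp (- (real n * \<tau>) * sum v J))) \<partial>beta_sequence \<alpha>)"
  proof (rule nn_integral_mono_AE, use AE_proper_sticks[OF \<alpha>] in eventually_elim)
    fix v assume v: "v \<in> proper_sticks"
    show "alloc_prior n v A \<le> ennreal (\<tau> powr s) * ennreal (stick_rest v (2 * m) powr (- s))
         + (\<Sum>J\<in>?S. ennreal (exp (- (real n * \<tau>) * sum v J)))"
      using alloc_prior_few_clusters[OF v assms(2,4) A] by (simp add: ennreal_mult)
  qed
  also have "\<dots> = ennreal (\<tau> powr s) * ennreal ((\<alpha> / (\<alpha> + (- s))) ^ (2 * m))
         + (\<Sum>J\<in>?S. \<integral>\<^sup>+v. ennreal (exp (- (real n * \<tau>) * sum v J)) \<partial>beta_sequence \<alpha>)"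
    using assms by (subst nn_integral_add) 
      (auto simp: nn_integral_cmult nn_integral_stick_rest_powr nn_integral_sum simp del: mult_minus_left sum_ennreal)
  also have "(\<Sum>J\<in>?S. \<integral>\<^sup>+v. ennreal (exp (- (real n * \<tau>) * sum v J)) \<partial>beta_sequence \<alpha>)
     \<le> (\<Sum>J\<in>?S. ennreal ((\<alpha> / (real n * \<tau>)) ^ m))"
  proof (rule sum_mono)
    fix J assume J: "J \<in> ?S"
    then have "(\<integral>\<^sup>+v. ennreal (exp (- (real n * \<tau>) * sum v J)) \<partial>beta_sequence \<alpha>)
      \<le> ennreal ((\<alpha> / (real n * \<tau>)) ^ card J)"
      by (intro nn_integral_exp_sticks_le) (use assms pos finite_subset in auto)
    also have "\<dots> \<le> ennreal ((\<alpha> / (real n * \<tau>)) ^ m)"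
      by (intro ennreal_leI power_decreasing) (use J assms pos in auto)
    finally show "(\<integral>\<^sup>+v. ennreal (exp (- (real n * \<tau>) * sum v J)) \<partial>beta_sequence \<alpha>)
      \<le> ennreal ((\<alpha> / (real n * \<tau>)) ^ m)" .
  qed
  also have "\<dots> = of_nat (card ?S) * ennreal ((\<alpha> / (real n * \<tau>)) ^ m)" by simp
  also have "\<dots> \<le> 4 ^ m * ennreal ((\<alpha> / (real n * \<tau>)) ^ m)"
  proof (rule mult_right_mono)
    have "card ?S \<le> card (Pow {..<2*m})" by (rule card_mono) auto
    also have "\<dots> = 4 ^ m" by (simp add: card_Pow power_mult)
    finally have "of_nat (card ?S) \<le> (of_nat (4 ^ m) :: ennreal)" by (simp only: of_nat_le_iff)
    then show "of_nat (card ?S) \<le> (4 ^ m :: ennreal)" by simp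
  qed simp
  also have "ennreal (\<tau> powr s) * ennreal ((\<alpha> / (\<alpha> + (- s))) ^ (2 * m)) + 4 ^ m * ennreal ((\<alpha> / (real n * \<tau>)) ^ m)
    = ennreal (\<tau> powr s * (\<alpha> / (\<alpha> - s)) ^ (2 * m) + 4 ^ m * (\<alpha> / (real n * \<tau>)) ^ m)"
  proof -
    have "(4::ennreal) ^ m = ennreal (4 ^ m)"
      by (metis ennreal_numeral ennreal_power zero_le_numeral)
    then show ?thesis using assms pos
      by (simp add: ennreal_mult'[symmetric] ennreal_plus[symmetric] del: ennreal_plus)
  qed
  finally show ?thesis by (simp add: add_mono)
qed


text \<open>The prior probability of falling below a small multiple of \<open>\<alpha> ln n\<close> decays like a power of \<open>n\<close>
  whose exponent has an absolute value that approaches, but never exceeds, \<open>\<alpha>\<close> as the multiple tends to zero; 1/200 is small enough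
  for \<open>3/4 * \<alpha>\<close>.  The upper tail exponent has no such limit, and the factor 5 is more than enough for it.\<close>
definition atypical_alloc :: "real \<Rightarrow> nat \<Rightarrow> (nat \<Rightarrow> nat) set" where
  "atypical_alloc \<alpha> n = {c. \<not> (real (num_clusters n c) \<le> 5 * (\<alpha> * ln (real n)) \<and>
     \<alpha> * ln (real n) / 200 \<le> real (num_clusters n c))}"

text \<open>Upper tail: \<open>k = 3 L\<close> sticks leave a weight above \<open>1 / n\<close> with probability of order
  \<open>n powr \<alpha> * 2 powr (- 3 L)\<close>, and \<open>y = 2 L\<close> further clusters cost \<open>2 powr (- 2 L)\<close>.  Lower tail:
  with \<open>\<tau> = n powr (-9/10)\<close> and the moment \<open>s = 9/10 * \<alpha>\<close>, the remaining weight drops below \<open>\<tau>\<close> within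
  \<open>2 m\<close> sticks, about \<open>L / 100\<close>, with probability at most \<open>n powr (- 81/100 * \<alpha>)\<close> times the
  factor \<open>100 ^ m\<close>, which is at most \<open>n powr (3/50 * \<alpha>)\<close>; the other term decays faster than any power of \<open>n\<close>.\<close>
lemma prior_atypical_alloc:
  assumes "1 \<le> \<alpha>"
  shows "\<forall>\<^sub>F n in sequentially.
    (\<integral>\<^sup>+v. alloc_prior n v (atypical_alloc \<alpha> n) \<partial>beta_sequence \<alpha>) \<le> ennreal (7 * real n powr (- (3/4 * \<alpha>)))"
proof -
  have e1: "\<forall>\<^sub>F n in sequentially. \<alpha> \<le> real n powr (1/10)" using assms by real_asymp
  have e2: "\<forall>\<^sub>F n in sequentially. 4 * \<alpha> \<le> real n powr (1/20)" using assms by real_asymp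
  have e3: "\<forall>\<^sub>F n in sequentially. 15 * \<alpha> + 1 \<le> \<alpha> * ln (real n) / 200" using assms by real_asymp
  show ?thesis using e1 e2 e3 eventually_ge_at_top[of 1]
  proof eventually_elim
    case (elim n)
    define N where "N = real n"
    have N: "1 \<le> N" using elim by (simp add: N_def)
    define L where "L = \<alpha> * ln N"
    have L: "0 \<le> L" using N assms by (simp add: L_def)
    \<comment> \<open>Exponentials in \<open>L\<close> are powers of \<open>n\<close> with an exponent proportional to \<open>\<alpha>\<close>.\<close>
    have expL: "exp (a * L) = N powr (a * \<alpha>)" for a
      using N by (simp add: L_def powr_def)
    have ln2: "2/3 \<le> ln (2::real)" using ln2_ge_two_thirds by simp
    define k where "k = nat \<lfloor>3 * L\<rfloor>"
    define m where "m = nat \<lfloor>L / 200\<rfloor>"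
    have k: "real k \<le> 3 * L" "3 * L - 1 \<le> real k" using L unfolding k_def by linarith+
    have m: "real m \<le> L / 200" "L / 200 - 1 \<le> real m" using L unfolding m_def by linarith+
    have hi: "(\<integral>\<^sup>+v. alloc_prior n v {c. 5 * L < real (num_clusters n c)} \<partial>beta_sequence \<alpha>)
       \<le> ennreal (5 * N powr (- (3/4 * \<alpha>)))"
    proof -
      have "(\<integral>\<^sup>+v. alloc_prior n v {c. 5 * L < real (num_clusters n c)} \<partial>beta_sequence \<alpha>)
          \<le> ennreal (real n powr \<alpha> * (1/2) ^ k + exp 1 * 2 powr (- (2 * L)))"
        by (rule nn_integral_alloc_prior_many) (use assms k in auto)
      also have "\<dots> \<le> ennreal (5 * N powr (- (3/4 * \<alpha>)))"
      proof (rule ennreal_leI)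
        have "(1/2::real) ^ k = exp (- (ln 2 * real k))"
          by (simp add: exp_minus power_divide exp_of_nat2_mult inverse_eq_divide)
        also have "\<dots> \<le> exp (ln 2 - 3 * L * ln 2)"
          using k(2) ln2 mult_right_mono[of "3 * L - 1" "real k" "ln 2"] by (simp add: algebra_simps)
        also have "\<dots> \<le> exp (ln 2 + (-2) * L)"
          using L ln2 mult_left_mono[of "2/3" "ln 2" "3 * L"] by simp
        also have "\<dots> = 2 * N powr ((-2) * \<alpha>)" by (simp only: exp_add expL) simp
        finally have "N powr \<alpha> * (1/2) ^ k \<le> N powr \<alpha> * (2 * N powr ((-2) * \<alpha>))"
          by (rule mult_left_mono) simp
        also have "\<dots> = 2 * N powr (- \<alpha>)" by (simp add: powr_add[symmetric])
        also have "\<dots> \<le> 2 * N powr (- (3/4 * \<alpha>))" using N assms by (intro mult_left_mono powr_mono) auto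
        finally have 1: "N powr \<alpha> * (1/2) ^ k \<le> 2 * N powr (- (3/4 * \<alpha>))" .
        have "2 powr (- (2 * L)) = exp (- (2 * L * ln 2))" by (simp add: powr_def)
        also have "\<dots> \<le> exp ((-1) * L)" using L ln2 mult_left_mono[of "2/3" "ln 2" "2 * L"] by simp
        also have "\<dots> = N powr (- \<alpha>)" unfolding expL by simp
        also have "\<dots> \<le> N powr (- (3/4 * \<alpha>))" using N assms by (intro powr_mono) auto
        finally have "exp 1 * 2 powr (- (2 * L)) \<le> 3 * N powr (- (3/4 * \<alpha>))"
          by (intro mult_mono exp_le) auto
        with 1 show "real n powr \<alpha> * (1/2) ^ k + exp 1 * 2 powr (- (2 * L)) \<le> 5 * N powr (- (3/4 * \<alpha>))"
          by (simp add: N_def)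
      qed
      finally show ?thesis .
    qed
    have lo: "(\<integral>\<^sup>+v. alloc_prior n v {c. real (num_clusters n c) < L / 200} \<partial>beta_sequence \<alpha>)
       \<le> ennreal (2 * N powr (- (3/4 * \<alpha>)))"
    proof -
      have Nt: "real n * N powr (-9/10) = N powr (1/10)"
        using N powr_add[of N 1 "-9/10"] by (simp add: N_def)
      have "(\<integral>\<^sup>+v. alloc_prior n v {c. real (num_clusters n c) < L / 200} \<partial>beta_sequence \<alpha>)
          \<le> ennreal ((N powr (-9/10)) powr (9/10 * \<alpha>) * (\<alpha> / (\<alpha> - 9/10 * \<alpha>)) ^ (2 * m)
             + 4 ^ m * (\<alpha> / (real n * N powr (-9/10))) ^ m)"
      proof (rule nn_integral_alloc_prior_few)
        fix c assume "c \<in> {c. real (num_clusters n c) < L / 200}"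
        then show "num_clusters n c \<le> m" unfolding m_def by simp linarith
      next
        show "\<alpha> \<le> real n * N powr (-9/10)" unfolding Nt using elim by (simp add: N_def)
      qed (use assms N in auto)
      also have "\<dots> \<le> ennreal (2 * N powr (- (3/4 * \<alpha>)))"
      proof (rule ennreal_leI)
        have "(\<alpha> / (\<alpha> - 9/10 * \<alpha>)) = 10" using assms by (simp add: field_simps)
        then have "(\<alpha> / (\<alpha> - 9/10 * \<alpha>)) ^ (2 * m) = 100 ^ m" by (simp add: power_mult)
        also have "(100::real) ^ m \<le> exp 12 ^ m"
        proof (rule power_mono)
          have "(2::real) ^ 12 \<le> exp 1 ^ 12"
            using exp_ge_add_one_self[of 1] by (intro power_mono) auto
          then show "100 \<le> exp (12::real)" by (simp add: exp_of_nat_mult[symmetric])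
        qed simp
        also have "\<dots> = exp (12 * real m)" by (simp add: exp_of_nat_mult[symmetric] mult.commute)
        also have "\<dots> \<le> exp ((3/50) * L)" using m by simp
        also have "\<dots> = N powr (3/50 * \<alpha>)" by (rule expL)
        finally have "(N powr (-9/10)) powr (9/10 * \<alpha>) * (\<alpha> / (\<alpha> - 9/10 * \<alpha>)) ^ (2 * m)
           \<le> (N powr (-9/10)) powr (9/10 * \<alpha>) * N powr (3/50 * \<alpha>)" by (rule mult_left_mono) simp
        also have "\<dots> = N powr (- (3/4 * \<alpha>))" by (simp add: powr_powr powr_add[symmetric])
        finally have 1: "(N powr (-9/10)) powr (9/10 * \<alpha>) * (\<alpha> / (\<alpha> - 9/10 * \<alpha>)) ^ (2 * m) \<le> N powr (- (3/4 * \<alpha>))" .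
        have "4 ^ m * (\<alpha> / (real n * N powr (-9/10))) ^ m = (4 * \<alpha> / N powr (1/10)) ^ m"
          unfolding Nt by (simp add: power_mult_distrib power_divide)
        \<comment> \<open>For large \<open>n\<close> half of the power \<open>1/10\<close> absorbs \<open>4 * \<alpha>\<close>; the other half is left to be raised to \<open>m\<close>.\<close>
        also have "\<dots> \<le> (N powr (-1/20)) ^ m"
        proof (rule power_mono)
          have "4 * \<alpha> / N powr (1/10) \<le> N powr (1/20) / N powr (1/10)"
            using elim by (intro divide_right_mono) (auto simp: N_def)
          also have "\<dots> = N powr (-1/20)" using N by (simp add: powr_diff[symmetric])
          finally show "4 * \<alpha> / N powr (1/10) \<le> N powr (-1/20)" .
        qed (use assms in auto)
        also have "\<dots> = N powr (- (real m / 20))" using N by (simp add: powr_realpow[symmetric] powr_powr)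
        also have "\<dots> \<le> N powr (- (3/4 * \<alpha>))"
          using N elim m by (intro powr_mono) (auto simp: L_def N_def)
        finally show "(N powr (-9/10)) powr (9/10 * \<alpha>) * (\<alpha> / (\<alpha> - 9/10 * \<alpha>)) ^ (2 * m)
             + 4 ^ m * (\<alpha> / (real n * N powr (-9/10))) ^ m \<le> 2 * N powr (- (3/4 * \<alpha>))"
          using 1 by simp
      qed
      finally show ?thesis .
    qed
    let ?B = "\<lambda>b. if b then {c. 5 * L < real (num_clusters n c)} else {c. real (num_clusters n c) < L / 200}"
    have "(\<integral>\<^sup>+v. alloc_prior n v (atypical_alloc \<alpha> n) \<partial>beta_sequence \<alpha>)
      \<le> (\<integral>\<^sup>+v. (\<Sum>b\<in>UNIV. alloc_prior n v (?B b)) \<partial>beta_sequence \<alpha>)"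
      by (intro nn_integral_mono alloc_prior_subadd) (auto simp: atypical_alloc_def L_def N_def UNIV_bool)
    also have "\<dots> = (\<Sum>b\<in>UNIV. \<integral>\<^sup>+v. alloc_prior n v (?B b) \<partial>beta_sequence \<alpha>)"
      by (rule nn_integral_sum) (rule measurable_alloc_prior)
    also have "\<dots> \<le> ennreal (2 * N powr (- (3/4 * \<alpha>))) + ennreal (5 * N powr (- (3/4 * \<alpha>)))"
      using hi lo by (simp add: UNIV_bool add_mono)
    also have "\<dots> = ennreal (7 * N powr (- (3/4 * \<alpha>)))" by (simp flip: ennreal_plus)
    finally show ?case by (simp add: N_def)
  qed
qed

section \<open>An envelope for the translates of the kernel\<close>

text \<open>The gradient of \<open>ln f\<close> is at most \<open>R * (1 + \<rho>) powr \<gamma>\<close> on the ball of radius \<open>\<rho>\<close>, which is convex.\<close>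
lemma ln_kernel_lipschitz:
  fixes f :: "'a::euclidean_space \<Rightarrow> real"
  assumes "C3 f" "\<And>x. 0 < f x" "0 \<le> R" "0 \<le> \<gamma>"
    and grad: "\<And>x. norm (nabla (\<lambda>y. ln (f y)) x) \<le> R * (1 + norm x) powr \<gamma>"
    and "norm x \<le> \<rho>" "norm y \<le> \<rho>"
  shows "\<bar>ln (f x) - ln (f y)\<bar> \<le> R * (1 + \<rho>) powr \<gamma> * norm (x - y)"
proof -
  let ?g = "\<lambda>y. ln (f y)"
  have d: "(?g has_derivative frechet_derivative ?g (at z)) (at z)" for z
  proof -
    have "(f has_derivative frechet_derivative f (at z)) (at z)"
      using assms(1) by (simp add: C3_def frechet_derivative_works)
    then have "?g differentiable (at z)"
      using assms(2)[of z] by (auto intro!: differentiableI derivative_intros)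
    then show ?thesis by (simp add: frechet_derivative_works)
  qed
  have n: "onorm (frechet_derivative ?g (at z)) = norm (nabla ?g z)" for z
    unfolding nabla_def norm_blinfun.rep_eq
    by (subst bounded_linear_Blinfun_apply) (use d[of z] has_derivative_bounded_linear in auto)
  have "norm (?g x - ?g y) \<le> R * (1 + \<rho>) powr \<gamma> * norm (x - y)"
  proof (rule differentiable_bound[of "cball 0 \<rho>" ?g "\<lambda>z. frechet_derivative ?g (at z)"])
    fix z :: 'a assume "z \<in> cball 0 \<rho>"
    show "(?g has_derivative frechet_derivative ?g (at z)) (at z within cball 0 \<rho>)"
      using d[of z] by (rule has_derivative_at_withinI)
    have "onorm (frechet_derivative ?g (at z)) \<le> R * (1 + norm z) powr \<gamma>"
      using grad n by simp
    also have "\<dots> \<le> R * (1 + \<rho>) powr \<gamma>"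
      by (intro mult_left_mono powr_mono2) (use \<open>z \<in> cball 0 \<rho>\<close> assms in auto)
    finally show "onorm (frechet_derivative ?g (at z)) \<le> R * (1 + \<rho>) powr \<gamma>" .
  qed (use assms in auto)
  then show ?thesis by simp
qed

text \<open>This separates the additive constants from \<open>norm x\<close>: finite exponential moments are available for
  multiples of \<open>norm x powr \<gamma>\<close> only.\<close>
lemma powr_add_le:
  fixes a b :: real
  assumes "0 < a" "0 \<le> b" "0 \<le> \<gamma>"
  shows "(a + b) powr \<gamma> \<le> (2 * a) powr \<gamma> + 2 powr \<gamma> * b powr \<gamma>"
proof (cases "a < b")
  case True
  then have "(a + b) powr \<gamma> \<le> (2 * b) powr \<gamma>" using assms by (intro powr_mono2) auto
  also have "\<dots> = 2 powr \<gamma> * b powr \<gamma>" using assms by (simp add: powr_mult)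
  finally show ?thesis by (simp add: add_increasing)
next
  case False
  then have "(a + b) powr \<gamma> \<le> (2 * a) powr \<gamma>" using assms by (intro powr_mono2) auto
  then show ?thesis by (simp add: add_increasing2)
qed

lemma nn_integral_lborel_shift:
  fixes h :: "'a::euclidean_space \<Rightarrow> ennreal"
  assumes [measurable]: "h \<in> borel_measurable borel"
  shows "(\<integral>\<^sup>+x. h (x - t) \<partial>lborel) = (\<integral>\<^sup>+x. h x \<partial>lborel)"
proof -
  have "(\<integral>\<^sup>+x. h x \<partial>lborel) = (\<integral>\<^sup>+x. h x \<partial>distr lborel borel ((+) (- t)))"
    by (simp only: lborel_distr_plus)
  also have "\<dots> = (\<integral>\<^sup>+x. h (- t + x) \<partial>lborel)" by (rule nn_integral_distr) auto
  finally show ?thesis by simp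
qed

text \<open>By the growth condition, translates of \<open>f\<close> by vectors of bounded length differ by a factor
  \<open>exp (L x * c)\<close>, where \<open>L x\<close> grows like \<open>norm x powr \<gamma>\<close>.  Hence \<open>f (x - t0)\<close> times such an exponential
  dominates all translates and also their Lipschitz constants in the translation.  It remains square integrable
  against \<open>1 / f (x - t0)\<close>, because one factor \<open>f (x - t0)\<close> survives and every
  exponential moment of \<open>norm x powr \<gamma>\<close> is finite under \<open>f\<close>.\<close>
lemma kernel_envelope:
  fixes f :: "'a::euclidean_space \<Rightarrow> real"
  assumes pd: "probability_density f" and sb: "smooth_bounded_kernel f" and lg: "log_derivative_growth f"
    and t0: "norm t0 \<le> B"
  obtains G where "G \<in> borel_measurable borel" "\<And>x. 0 \<le> G x"
    "\<And>x t. norm t \<le> B \<Longrightarrow> f (x - t) \<le> G x"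
    "\<And>x t t'. norm t \<le> B \<Longrightarrow> norm t' \<le> B \<Longrightarrow> \<bar>f (x - t) - f (x - t')\<bar> \<le> norm (t - t') * G x"
    "(\<integral>\<^sup>+x. ennreal ((G x)\<^sup>2 / f (x - t0)) \<partial>lborel) < \<infinity>"
proof -
  obtain R \<gamma> where R: "0 < R" and \<gamma>: "0 \<le> \<gamma>"
    and grad: "\<And>x. norm (nabla (\<lambda>y. ln (f y)) x) \<le> R * (1 + norm x) powr \<gamma>"
    and int: "\<And>M. 0 < M \<Longrightarrow> integrable lborel (\<lambda>x. exp (M * norm x powr \<gamma>) * f x)"
    using lg unfolding log_derivative_growth_def by blast
  have C3: "C3 f" and fpos: "0 < f x" for x
    using sb by (auto simp: smooth_bounded_kernel_def)
  have [measurable]: "f \<in> borel_measurable borel" using pd by (simp add: probability_density_def)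
  have B: "0 \<le> B" using t0 norm_ge_zero[of t0] by linarith
  define L where "L x = R * (1 + (norm x + B)) powr \<gamma>" for x :: 'a
  have L0: "0 \<le> L x" for x using R by (simp add: L_def)
  have [measurable]: "L \<in> borel_measurable borel" unfolding L_def by measurable
  \<comment> \<open>The summand \<open>2 * B\<close> bounds \<open>norm (t - t0)\<close>; the summand \<open>1\<close> absorbs the factor \<open>L x \<le> exp (L x)\<close> of the Lipschitz bound.\<close>
  define G where "G x = f (x - t0) * exp ((2 * B + 1) * L x)" for x
  have lip: "\<bar>ln (f (x - t)) - ln (f (x - t'))\<bar> \<le> L x * norm (t - t')"
    if "norm t \<le> B" "norm t' \<le> B" for x t t'
  proof -
    have "\<bar>ln (f (x - t)) - ln (f (x - t'))\<bar> \<le> L x * norm ((x - t) - (x - t'))"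
      unfolding L_def
      by (rule ln_kernel_lipschitz[OF C3 fpos _ \<gamma> grad])
        (use R that norm_triangle_ineq4[of x t] norm_triangle_ineq4[of x t'] in auto)
    then show ?thesis by (simp add: norm_minus_commute)
  qed
  have up: "f (x - t) \<le> f (x - t0) * exp (2 * B * L x)" if "norm t \<le> B" for x t
  proof -
    have "ln (f (x - t)) - ln (f (x - t0)) \<le> L x * norm (t - t0)"
      using lip[OF that t0, of x] by linarith
    also have "\<dots> \<le> L x * (2 * B)"
      using norm_triangle_ineq4[of t t0] that t0 by (intro mult_left_mono L0) linarith
    finally have "exp (ln (f (x - t))) \<le> exp (ln (f (x - t0)) + 2 * B * L x)" by (simp add: mult.commute)
    then show ?thesis using fpos by (simp add: exp_add)
  qed
  show thesis
  proof (rule that[of G])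
    show "G \<in> borel_measurable borel" unfolding G_def by measurable
    show "0 \<le> G x" for x using fpos[of "x - t0"] by (simp add: G_def less_imp_le)
    show "f (x - t) \<le> G x" if "norm t \<le> B" for x t
    proof -
      have "f (x - t0) * exp (2 * B * L x) \<le> G x"
        unfolding G_def using L0[of x] fpos[of "x - t0"]
        by (intro mult_left_mono) (auto simp: algebra_simps)
      with up[OF that, of x] show ?thesis by linarith
    qed
    have one: "f (x - t) - f (x - t') \<le> norm (t - t') * G x" if t: "norm t \<le> B" "norm t' \<le> B" for x t t'
    proof -
      define d where "d = ln (f (x - t')) - ln (f (x - t))"
      have "f (x - t') = f (x - t) * exp d" using fpos less_imp_neq[OF fpos[of "x - t"]] by (simp add: d_def exp_diff)
      then have "f (x - t) - f (x - t') = f (x - t) * (1 - exp d)" by (simp add: algebra_simps)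
      also have "\<dots> \<le> f (x - t) * \<bar>d\<bar>"
        using exp_ge_add_one_self[of d] fpos[of "x - t"] by (intro mult_left_mono) linarith+
      also have "\<dots> \<le> (f (x - t0) * exp (2 * B * L x)) * (L x * norm (t - t'))"
        using up[OF t(1), of x] lip[OF t, of x] fpos[of "x - t0"]
        by (intro mult_mono) (auto simp: d_def abs_minus_commute less_imp_le)
      also have "\<dots> \<le> (f (x - t0) * exp (2 * B * L x)) * (exp (L x) * norm (t - t'))"
        using less_imp_le[OF fpos[of "x - t0"]] order_trans[OF _ exp_ge_add_one_self[of "L x"]]
        by (intro mult_left_mono mult_right_mono) auto
      also have "\<dots> = norm (t - t') * G x" by (simp add: G_def exp_add algebra_simps)
      finally show ?thesis .
    qed
    show "\<bar>f (x - t) - f (x - t')\<bar> \<le> norm (t - t') * G x" if "norm t \<le> B" "norm t' \<le> B" for x t t'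
      using one[OF that, of x] one[OF that(2,1), of x] by (auto simp: norm_minus_commute abs_le_iff)
    define c where "c = 2 * (2 * B + 1) * R"
    have c: "0 < c" using R B by (simp add: c_def)
    define M where "M = c * 2 powr \<gamma>"
    define D where "D = exp (c * (2 * (1 + 2 * B)) powr \<gamma>)"
    have "(\<integral>\<^sup>+x. ennreal ((G x)\<^sup>2 / f (x - t0)) \<partial>lborel)
        \<le> (\<integral>\<^sup>+x. ennreal (D * (exp (M * norm (x - t0) powr \<gamma>) * f (x - t0))) \<partial>lborel)"
    proof (intro nn_integral_mono ennreal_leI)
      fix x
      have "(1 + (norm x + B)) powr \<gamma> \<le> ((1 + 2 * B) + norm (x - t0)) powr \<gamma>"
        using norm_triangle_ineq2[of x t0] t0 B \<gamma> by (intro powr_mono2) auto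
      also have "\<dots> \<le> (2 * (1 + 2 * B)) powr \<gamma> + 2 powr \<gamma> * norm (x - t0) powr \<gamma>"
        by (rule powr_add_le) (use B \<gamma> in auto)
      finally have "c * (1 + (norm x + B)) powr \<gamma> \<le> c * ((2 * (1 + 2 * B)) powr \<gamma> + 2 powr \<gamma> * norm (x - t0) powr \<gamma>)"
        using c by simp
      also have "c * (1 + (norm x + B)) powr \<gamma> = 2 * ((2 * B + 1) * L x)"
        by (simp add: c_def L_def algebra_simps)
      finally have "exp (2 * ((2 * B + 1) * L x))
          \<le> exp (c * (2 * (1 + 2 * B)) powr \<gamma> + M * norm (x - t0) powr \<gamma>)"
        by (simp add: M_def algebra_simps)
      then have "f (x - t0) * exp (2 * ((2 * B + 1) * L x)) \<le> f (x - t0) * (D * exp (M * norm (x - t0) powr \<gamma>))"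
        using fpos[of "x - t0"] by (simp add: exp_add D_def)
      moreover have "(G x)\<^sup>2 / f (x - t0) = f (x - t0) * exp (2 * ((2 * B + 1) * L x))"
        using fpos[of "x - t0"] by (simp add: G_def power2_eq_square exp_double)
      ultimately show "(G x)\<^sup>2 / f (x - t0) \<le> D * (exp (M * norm (x - t0) powr \<gamma>) * f (x - t0))"
        by (simp add: mult_ac)
    qed
    also have "\<dots> = (\<integral>\<^sup>+x. ennreal (D * (exp (M * norm x powr \<gamma>) * f x)) \<partial>lborel)"
      by (rule nn_integral_lborel_shift[of "\<lambda>x. ennreal (D * (exp (M * norm x powr \<gamma>) * f x))"]) measurable
    also have "\<dots> < \<infinity>"
    proof -
      have "integrable lborel (\<lambda>x. D * (exp (M * norm x powr \<gamma>) * f x))"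
        by (intro integrable_mult_right int) (use c in \<open>auto simp: M_def\<close>)
      then show ?thesis
        by (subst nn_integral_eq_integral) (use fpos in \<open>auto simp: D_def less_imp_le\<close>)
    qed
    finally show "(\<integral>\<^sup>+x. ennreal ((G x)\<^sup>2 / f (x - t0)) \<partial>lborel) < \<infinity>" .
  qed
qed

section \<open>Mixture densities near the true one\<close>

text \<open>The mixture density of a Dirichlet process draw as an extended real, so that it needs no
  summability; it is finite for proper sticks (\<open>dp_mix_finite\<close>).\<close>
definition dp_mix :: "('a::euclidean_space \<Rightarrow> real) \<Rightarrow> (nat \<Rightarrow> real) \<Rightarrow> (nat \<Rightarrow> 'a) \<Rightarrow> 'a \<Rightarrow> ennreal" where
  "dp_mix f v \<theta> x = (\<Sum>k. ennreal (stick_weight v k) * ennreal (f (x - \<theta> k)))"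

lemma mixture_discrete_mixing:
  fixes f :: "'a::euclidean_space \<Rightarrow> real"
  assumes [measurable]: "f \<in> borel_measurable borel" and "\<And>x. 0 \<le> f x"
  shows "mixture (discrete_mixing I w \<theta>) f x = enn2real (\<integral>\<^sup>+k. ennreal (w k) * ennreal (f (x - \<theta> k)) \<partial>count_space I)"
proof -
  let ?D = "density (count_space I) (\<lambda>k. ennreal (w k))"
  have [measurable]: "\<theta> \<in> borel_measurable ?D" by simp
  have "mixture (discrete_mixing I w \<theta>) f x = enn2real (\<integral>\<^sup>+t. ennreal (f (x - t)) \<partial>distr ?D borel \<theta>)"
    unfolding mixture_def discrete_mixing_def by (rule integral_eq_nn_integral) (use assms in auto)
  also have "(\<integral>\<^sup>+t. ennreal (f (x - t)) \<partial>distr ?D borel \<theta>) = (\<integral>\<^sup>+k. ennreal (f (x - \<theta> k)) \<partial>?D)"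
    by (rule nn_integral_distr) auto
  also have "\<dots> = (\<integral>\<^sup>+k. ennreal (w k) * ennreal (f (x - \<theta> k)) \<partial>count_space I)"
    by (rule nn_integral_density) auto
  finally show ?thesis .
qed

lemma mixture_dp_draw:
  fixes f :: "'a::euclidean_space \<Rightarrow> real"
  assumes "f \<in> borel_measurable borel" and "\<And>x. 0 \<le> f x"
  shows "mixture (dp_draw (v, \<theta>)) f x = enn2real (dp_mix f v \<theta> x)"
  using assms by (simp add: dp_draw_def mixture_discrete_mixing dp_mix_def nn_integral_count_space_nat)

lemma mixture_finite:
  fixes f :: "'a::euclidean_space \<Rightarrow> real"
  assumes "f \<in> borel_measurable borel" and "\<And>x. 0 \<le> f x" and "\<And>k. k < K \<Longrightarrow> 0 \<le> w k"
  shows "mixture (discrete_mixing {..<K} w \<theta>) f x = (\<Sum>k<K. w k * f (x - \<theta> k))"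
proof -
  have "(\<integral>\<^sup>+k. ennreal (w k) * ennreal (f (x - \<theta> k)) \<partial>count_space {..<K}) = ennreal (\<Sum>k<K. w k * f (x - \<theta> k))"
    using assms by (subst nn_integral_count_space_finite) (auto simp: ennreal_mult'[symmetric] intro!: sum_ennreal)
  moreover have "0 \<le> (\<Sum>k<K. w k * f (x - \<theta> k))" using assms by (intro sum_nonneg) auto
  ultimately show ?thesis using assms by (simp add: mixture_discrete_mixing)
qed

text \<open>The data-generating mixture, with weights \<open>ws\<close> and atoms \<open>ts\<close>.\<close>
locale true_mixture =
  fixes f :: "'a::euclidean_space \<Rightarrow> real" and F :: real
    and K :: nat and ws :: "nat \<Rightarrow> real" and ts :: "nat \<Rightarrow> 'a"
  assumes density: "probability_density f"
    and kernel_pos: "0 < f x" and kernel_less: "f x < F"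
    and params: "finite_mixing_params K ws ts"
begin

lemma kernel_measurable[measurable]: "f \<in> borel_measurable borel"
  using density by (simp add: probability_density_def)

lemma kernel_nn_integral: "(\<integral>\<^sup>+x. ennreal (f (x - t)) \<partial>lborel) = 1"
  using density nn_integral_lborel_shift[of "\<lambda>x. ennreal (f x)" t] by (simp add: probability_density_def)

lemma true_weights: "k < K \<Longrightarrow> 0 < ws k" "(\<Sum>k<K. ws k) = 1" "0 < K"
  using params by (auto simp: finite_mixing_params_def intro!: Nat.gr0I)

definition true_density :: "'a \<Rightarrow> real" where
  "true_density x = (\<Sum>k<K. ws k * f (x - ts k))"

lemma true_density_pos: "0 < true_density x"
  unfolding true_density_def
  by (rule sum_pos) (use true_weights kernel_pos in auto)

lemma true_density_measurable[measurable]: "true_density \<in> borel_measurable borel"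
  unfolding true_density_def by measurable

abbreviation Q :: "'a measure" where "Q \<equiv> data_law K ws ts f"

lemma data_law_eq: "Q = density lborel (\<lambda>x. ennreal (true_density x))"
  unfolding data_law_def true_density_def
  by (subst mixture_finite) (use true_weights(1) kernel_pos in \<open>auto simp: less_imp_le\<close>)

lemma sets_Q[measurable_cong, simp]: "sets Q = sets borel" by (simp add: data_law_eq)

text \<open>Likelihood ratios with respect to the truth turn \<open>Q\<close>-means into Lebesgue integrals.\<close>
lemma nn_integral_Q_ratio:
  assumes [measurable]: "h \<in> borel_measurable borel" and "\<And>x. 0 \<le> h x"
  shows "(\<integral>\<^sup>+x. ennreal (h x / true_density x) \<partial>Q) = (\<integral>\<^sup>+x. ennreal (h x) \<partial>lborel)"
proof -
  have "(\<integral>\<^sup>+x. ennreal (h x / true_density x) \<partial>Q)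
     = (\<integral>\<^sup>+x. ennreal (true_density x) * ennreal (h x / true_density x) \<partial>lborel)"
    unfolding data_law_eq by (rule nn_integral_density) measurable
  also have "\<dots> = (\<integral>\<^sup>+x. ennreal (h x) \<partial>lborel)"
    using less_imp_neq[OF true_density_pos, symmetric]
    by (intro nn_integral_cong) (simp add: ennreal_mult'[symmetric] less_imp_le[OF true_density_pos])
  finally show ?thesis .
qed

lemma nn_integral_Q_kernel_ratio: "(\<integral>\<^sup>+x. ennreal (f (x - t) / true_density x) \<partial>Q) = 1"
  by (subst nn_integral_Q_ratio) (use kernel_pos kernel_nn_integral in \<open>auto simp: less_imp_le\<close>)

lemma prob_space_Q: "prob_space Q"
proof (rule prob_spaceI)
  have "(\<integral>\<^sup>+x. ennreal (true_density x) \<partial>lborel) = (\<Sum>k<K. ennreal (ws k) * (\<integral>\<^sup>+x. ennreal (f (x - ts k)) \<partial>lborel))"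
    unfolding true_density_def
    using true_weights(1) kernel_pos
    by (subst nn_integral_cmult[symmetric] nn_integral_sum[symmetric], simp)+
       (auto intro!: nn_integral_cong sum_ennreal[symmetric] simp: ennreal_mult'[symmetric] less_imp_le)
  also have "\<dots> = ennreal (\<Sum>k<K. ws k)"
    using true_weights(1) by (simp add: kernel_nn_integral) (intro sum_ennreal, simp add: less_imp_le)
  finally show "emeasure Q (space Q) = 1"
    by (simp add: data_law_eq emeasure_density true_weights(2))
qed

definition dp_ratio :: "(nat \<Rightarrow> real) \<Rightarrow> (nat \<Rightarrow> 'a) \<Rightarrow> 'a \<Rightarrow> real" where
  "dp_ratio v \<theta> x = enn2real (dp_mix f v \<theta> x) / true_density x"

lemma dp_ratio_nonneg: "0 \<le> dp_ratio v \<theta> x"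
  by (simp add: dp_ratio_def less_imp_le[OF true_density_pos])

lemma dp_mix_measurable[measurable]: "dp_mix f v \<theta> \<in> borel_measurable borel"
  unfolding dp_mix_def by measurable

lemma dp_ratio_measurable[measurable]: "dp_ratio v \<theta> \<in> borel_measurable borel"
  unfolding dp_ratio_def by measurable

lemma dp_mix_le:
  assumes "v \<in> proper_sticks"
  shows "dp_mix f v \<theta> x \<le> ennreal F"
proof -
  have F: "0 \<le> F" using kernel_pos kernel_less less_imp_le less_trans by blast
  have w: "0 \<le> stick_weight v k" for k using proper_sticksD(4)[OF assms] by (simp add: less_imp_le)
  have "dp_mix f v \<theta> x \<le> (\<Sum>k. ennreal F * ennreal (stick_weight v k))"
    unfolding dp_mix_def
    by (intro suminf_le summableI, subst mult.commute)
      (auto intro!: mult_right_mono ennreal_leI less_imp_le[OF kernel_less])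
  also have "\<dots> = ennreal (F * 1)"
    by (rule suminf_stick_weight_mult) (use F w sums_mult[OF proper_sticksD(5)[OF assms], of F] in auto)
  finally show ?thesis by simp
qed

lemma dp_mix_finite: "v \<in> proper_sticks \<Longrightarrow> dp_mix f v \<theta> x < \<top>"
  using dp_mix_le[of v \<theta> x] ennreal_less_top le_less_trans by blast

lemma nn_integral_dp_mix:
  assumes "v \<in> proper_sticks"
  shows "(\<integral>\<^sup>+x. dp_mix f v \<theta> x \<partial>lborel) = 1"
proof -
  have "(\<integral>\<^sup>+x. dp_mix f v \<theta> x \<partial>lborel) = (\<Sum>k. ennreal 1 * ennreal (stick_weight v k))"
    unfolding dp_mix_def by (subst nn_integral_suminf) (auto simp: nn_integral_cmult kernel_nn_integral)
  also have "\<dots> = ennreal 1"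
    by (rule suminf_stick_weight_mult) (use proper_sticksD(4,5)[OF assms] in \<open>auto simp: less_imp_le\<close>)
  finally show ?thesis by simp
qed

lemma dp_ratio_mean:
  assumes "v \<in> proper_sticks"
  shows "(\<integral>\<^sup>+x. ennreal (dp_ratio v \<theta> x) \<partial>Q) = 1"
  unfolding dp_ratio_def
  by (subst nn_integral_Q_ratio) (use dp_mix_finite[OF assms] nn_integral_dp_mix[OF assms] in auto)

text \<open>The tolerance \<open>K * \<epsilon>\<close> for the weights is what sticks within \<open>\<epsilon>\<close> of their targets guarantee.\<close>
definition near_truth :: "real \<Rightarrow> real \<Rightarrow> (nat \<Rightarrow> real) \<Rightarrow> (nat \<Rightarrow> 'a) \<Rightarrow> bool" where
  "near_truth B \<epsilon> v \<theta> \<longleftrightarrow> v \<in> proper_sticks \<and> (\<forall>k. norm (\<theta> k) \<le> B) \<and> stick_rest v K \<le> \<epsilon> \<and>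
     (\<forall>k<K. \<bar>stick_weight v k - ws k\<bar> \<le> real K * \<epsilon> \<and> norm (\<theta> k - ts k) \<le> \<epsilon>)"

text \<open>Split the difference into the change of the first \<open>K\<close> weights, the change of the first \<open>K\<close> atoms,
  and the contribution of the remaining weight; they contribute \<open>K\<^sup>2\<close>, 1 and 1 to the constant.\<close>
lemma dp_mix_near:
  assumes truth: "near_truth B \<epsilon> v \<theta>"
    and env: "\<And>x. 0 \<le> G x" "\<And>x t. norm t \<le> B \<Longrightarrow> f (x - t) \<le> G x"
    "\<And>x t t'. norm t \<le> B \<Longrightarrow> norm t' \<le> B \<Longrightarrow> \<bar>f (x - t) - f (x - t')\<bar> \<le> norm (t - t') * G x"
    and tsB: "\<And>k. k < K \<Longrightarrow> norm (ts k) \<le> B"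
  shows "\<bar>enn2real (dp_mix f v \<theta> x) - true_density x\<bar> \<le> (real K ^ 2 + 2) * \<epsilon> * G x"
proof -
  let ?w = "stick_weight v"
  have v: "v \<in> proper_sticks" and B: "norm (\<theta> k) \<le> B" for k
    using truth by (auto simp: near_truth_def)
  have near: "\<bar>stick_weight v k - ws k\<bar> \<le> real K * \<epsilon>" "norm (\<theta> k - ts k) \<le> \<epsilon>" if "k < K" for k
    using truth that by (auto simp: near_truth_def)
  have rest: "stick_rest v K \<le> \<epsilon>" using truth by (simp add: near_truth_def)
  then have "0 \<le> \<epsilon>" using proper_sticksD(3)[OF v, of K] by linarith
  have w: "0 \<le> ?w k" for k using proper_sticksD(4)[OF v] by (simp add: less_imp_le)
  have s1: "?w sums 1" by (rule proper_sticksD[OF v])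
  have fG: "f (x - \<theta> k) \<le> G x" for k by (rule env(2)) (rule B)
  have summ: "summable (\<lambda>k. ?w k * f (x - \<theta> k))"
  proof (rule summable_comparison_test')
    show "summable (\<lambda>k. ?w k * G x)" using s1 by (intro summable_mult2) (auto simp: sums_iff)
    show "norm (?w k * f (x - \<theta> k)) \<le> ?w k * G x" for k
      using w[of k] fG[of k] less_imp_le[OF kernel_pos[of "x - \<theta> k"]] by (simp add: abs_mult mult_left_mono)
  qed
  have "dp_mix f v \<theta> x = ennreal (\<Sum>k. ?w k * f (x - \<theta> k))"
  proof -
    have "dp_mix f v \<theta> x = (\<Sum>k. ennreal (?w k * f (x - \<theta> k)))"
      unfolding dp_mix_def using w less_imp_le[OF kernel_pos] by (simp add: ennreal_mult)
    also have "\<dots> = ennreal (\<Sum>k. ?w k * f (x - \<theta> k))"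
      by (rule suminf_ennreal2) (use w kernel_pos summ in \<open>auto simp: less_imp_le\<close>)
    finally show ?thesis .
  qed
  then have "enn2real (dp_mix f v \<theta> x) = (\<Sum>k. ?w k * f (x - \<theta> k))"
    using summ w kernel_pos by (simp add: suminf_nonneg less_imp_le)
  also have "\<dots> = (\<Sum>k. ?w (k + K) * f (x - \<theta> (k + K))) + (\<Sum>k<K. ?w k * f (x - \<theta> k))"
    by (rule suminf_split_initial_segment[OF summ])
  finally have eq: "enn2real (dp_mix f v \<theta> x) - true_density x
      = (\<Sum>k. ?w (k + K) * f (x - \<theta> (k + K))) + (\<Sum>k<K. ?w k * f (x - \<theta> k) - ws k * f (x - ts k))"
    by (simp add: true_density_def sum_subtractf)
  have tail_sums: "(\<lambda>k. ?w (k + K) * G x) sums (stick_rest v K * G x)"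
    using s1 sums_split_initial_segment[of ?w 1 K] by (intro sums_mult2) (simp add: sum_stick_weight)
  have sumt: "summable (\<lambda>k. ?w (k + K) * f (x - \<theta> (k + K)))"
    using summ by (rule summable_ignore_initial_segment)
  have tail: "\<bar>\<Sum>k. ?w (k + K) * f (x - \<theta> (k + K))\<bar> \<le> \<epsilon> * G x"
  proof -
    have "0 \<le> (\<Sum>k. ?w (k + K) * f (x - \<theta> (k + K)))"
      using w kernel_pos sumt by (intro suminf_nonneg) (auto simp: less_imp_le)
    moreover have "(\<Sum>k. ?w (k + K) * f (x - \<theta> (k + K))) \<le> stick_rest v K * G x"
      by (rule sums_le[OF _ summable_sums[OF sumt] tail_sums]) (use w fG in \<open>auto intro: mult_left_mono\<close>)
    moreover have "stick_rest v K * G x \<le> \<epsilon> * G x" by (rule mult_right_mono[OF rest env(1)])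
    ultimately show ?thesis by linarith
  qed
  have "\<bar>\<Sum>k<K. ?w k * f (x - \<theta> k) - ws k * f (x - ts k)\<bar> \<le> (\<Sum>k<K. \<bar>?w k * f (x - \<theta> k) - ws k * f (x - ts k)\<bar>)"
    by (rule sum_abs)
  also have "\<dots> \<le> (\<Sum>k<K. real K * \<epsilon> * G x + ws k * (\<epsilon> * G x))"
  proof (rule sum_mono)
    fix k assume "k \<in> {..<K}" then have k: "k < K" by simp
    have "?w k * f (x - \<theta> k) - ws k * f (x - ts k)
       = (?w k - ws k) * f (x - \<theta> k) + ws k * (f (x - \<theta> k) - f (x - ts k))" by (simp add: algebra_simps)
    also have "\<bar>\<dots>\<bar> \<le> \<bar>?w k - ws k\<bar> * f (x - \<theta> k) + ws k * \<bar>f (x - \<theta> k) - f (x - ts k)\<bar>"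
      using abs_triangle_ineq less_imp_le[OF kernel_pos] less_imp_le[OF true_weights(1)[OF k]]
      by (metis abs_mult abs_of_nonneg)
    also have "\<dots> \<le> real K * \<epsilon> * G x + ws k * (norm (\<theta> k - ts k) * G x)"
      using fG[of k] less_imp_le[OF kernel_pos[of "x - \<theta> k"]] near(1)[OF k] env(3)[OF B tsB[OF k]]
        less_imp_le[OF true_weights(1)[OF k]] env(1)[of x] \<open>0 \<le> \<epsilon>\<close>
      by (intro add_mono mult_mono mult_left_mono) auto
    also have "\<dots> \<le> real K * \<epsilon> * G x + ws k * (\<epsilon> * G x)"
      using near(2)[OF k] less_imp_le[OF true_weights(1)[OF k]] env(1)[of x]
      by (intro add_left_mono mult_left_mono mult_right_mono) auto
    finally show "\<bar>?w k * f (x - \<theta> k) - ws k * f (x - ts k)\<bar> \<le> real K * \<epsilon> * G x + ws k * (\<epsilon> * G x)" .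
  qed
  also have "\<dots> = real K ^ 2 * \<epsilon> * G x + \<epsilon> * G x"
    by (simp add: sum.distrib sum_distrib_right[symmetric] true_weights(2) power2_eq_square)
  finally show ?thesis unfolding eq using tail by (simp add: algebra_simps abs_le_iff)
qed

text \<open>The second moment of the ratio \<open>h / p\<close> exceeds 1 by the chi-square distance, the integral of
  \<open>(h - p)\<^sup>2 / p\<close>.  The numerator is at most \<open>(C * \<epsilon> * G)\<^sup>2\<close> for the envelope \<open>G\<close>, and \<open>p\<close> is at least its
  first component.\<close>
lemma dp_ratio_second_moment:
  assumes sb: "smooth_bounded_kernel f" and lg: "log_derivative_growth f"
    and B: "\<And>k. k < K \<Longrightarrow> norm (ts k) \<le> B"
  shows "\<exists>A\<ge>0. \<forall>v \<theta> \<epsilon>. near_truth B \<epsilon> v \<theta> \<longrightarrow>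
      (\<integral>\<^sup>+x. ennreal ((dp_ratio v \<theta> x)\<^sup>2) \<partial>Q) \<le> ennreal (1 + A * \<epsilon>\<^sup>2)"
proof -
  obtain G where [measurable]: "G \<in> borel_measurable borel" and env: "\<And>x. 0 \<le> G x" "\<And>x t. norm t \<le> B \<Longrightarrow> f (x - t) \<le> G x"
    "\<And>x t t'. norm t \<le> B \<Longrightarrow> norm t' \<le> B \<Longrightarrow> \<bar>f (x - t) - f (x - t')\<bar> \<le> norm (t - t') * G x"
    and Gfin: "(\<integral>\<^sup>+x. ennreal ((G x)\<^sup>2 / f (x - ts 0)) \<partial>lborel) < \<infinity>"
    using kernel_envelope[OF density sb lg B[OF true_weights(3)]] by blast
  define I where "I = enn2real (\<integral>\<^sup>+x. ennreal ((G x)\<^sup>2 / f (x - ts 0)) \<partial>lborel)"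
  have I: "(\<integral>\<^sup>+x. ennreal ((G x)\<^sup>2 / f (x - ts 0)) \<partial>lborel) = ennreal I" "0 \<le> I"
    using Gfin by (simp_all add: I_def)
  have w0: "0 < ws 0" by (rule true_weights(1)[OF true_weights(3)])
  define C where "C = real K ^ 2 + 2"
  define A where "A = C\<^sup>2 / ws 0 * I"
  show ?thesis
  proof (intro exI[of _ A] conjI allI impI)
    show "0 \<le> A" using I w0 by (simp add: A_def)
    fix v \<theta> \<epsilon> assume truth: "near_truth B \<epsilon> v \<theta>"
    then have v: "v \<in> proper_sticks" by (simp add: near_truth_def)
    then have \<epsilon>: "0 \<le> \<epsilon>" using truth proper_sticksD(3)[OF v, of K] by (simp add: near_truth_def)
    let ?h = "\<lambda>x. enn2real (dp_mix f v \<theta> x)" and ?p = true_density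
    have near: "\<bar>?h x - ?p x\<bar> \<le> C * \<epsilon> * G x" for x
      unfolding C_def by (rule dp_mix_near[OF truth env B])
    \<comment> \<open>The square \<open>(h / p - 1)\<^sup>2\<close> is expanded, with the mixed term on the right to avoid subtraction in \<open>ennreal\<close>.\<close>
    have pw: "ennreal ((dp_ratio v \<theta> x)\<^sup>2) + 1
        \<le> ennreal ((C\<^sup>2 * \<epsilon>\<^sup>2 / ws 0 * ((G x)\<^sup>2 / f (x - ts 0))) / ?p x) + 2 * ennreal (dp_ratio v \<theta> x)" for x
    proof -
      have p: "0 < ?p x" by (rule true_density_pos)
      have "ws 0 * f (x - ts 0) \<le> ?p x"
        unfolding true_density_def
        by (rule member_le_sum[of 0 "{..<K}" "\<lambda>k. ws k * f (x - ts k)"])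
          (use true_weights kernel_pos in \<open>auto simp: less_imp_le\<close>)
      then have "(?h x - ?p x)\<^sup>2 * (ws 0 * f (x - ts 0)) \<le> (C * \<epsilon> * G x)\<^sup>2 * ?p x"
        using near[of x] w0 kernel_pos[of "x - ts 0"]
        by (intro mult_mono power2_le_iff_abs_le[THEN iffD2]) (auto simp: less_imp_le \<epsilon> env C_def)
      then have "(?h x - ?p x)\<^sup>2 / ?p x \<le> (C * \<epsilon> * G x)\<^sup>2 / (ws 0 * f (x - ts 0))"
        using p w0 kernel_pos[of "x - ts 0"] by (simp add: field_simps)
      then have "(?h x - ?p x)\<^sup>2 / ?p x / ?p x \<le> (C * \<epsilon> * G x)\<^sup>2 / (ws 0 * f (x - ts 0)) / ?p x"
        using p by (intro divide_right_mono) auto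
      also have "(?h x - ?p x)\<^sup>2 / ?p x / ?p x = (dp_ratio v \<theta> x)\<^sup>2 + 1 - 2 * dp_ratio v \<theta> x"
        using p by (simp add: dp_ratio_def field_simps power2_eq_square)
      also have "(C * \<epsilon> * G x)\<^sup>2 / (ws 0 * f (x - ts 0)) = C\<^sup>2 * \<epsilon>\<^sup>2 / ws 0 * ((G x)\<^sup>2 / f (x - ts 0))"
        by (simp add: power_mult_distrib)
      finally have "ennreal ((dp_ratio v \<theta> x)\<^sup>2 + 1)
         \<le> ennreal ((C\<^sup>2 * \<epsilon>\<^sup>2 / ws 0 * ((G x)\<^sup>2 / f (x - ts 0))) / ?p x + 2 * dp_ratio v \<theta> x)"
        by (intro ennreal_leI) simp
      also have "\<dots> = ennreal ((C\<^sup>2 * \<epsilon>\<^sup>2 / ws 0 * ((G x)\<^sup>2 / f (x - ts 0))) / ?p x) + 2 * ennreal (dp_ratio v \<theta> x)"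
        using p w0 less_imp_le[OF kernel_pos[of "x - ts 0"]] dp_ratio_nonneg[of v \<theta> x]
        by (simp add: ennreal_mult')
      finally show ?thesis by simp
    qed
    have "(\<integral>\<^sup>+x. ennreal ((dp_ratio v \<theta> x)\<^sup>2) \<partial>Q) + 1 = (\<integral>\<^sup>+x. ennreal ((dp_ratio v \<theta> x)\<^sup>2) + 1 \<partial>Q)"
      by (simp add: nn_integral_add prob_space.emeasure_space_1[OF prob_space_Q])
    also have "\<dots> \<le> (\<integral>\<^sup>+x. ennreal ((C\<^sup>2 * \<epsilon>\<^sup>2 / ws 0 * ((G x)\<^sup>2 / f (x - ts 0))) / ?p x) + 2 * ennreal (dp_ratio v \<theta> x) \<partial>Q)"
      by (rule nn_integral_mono) (rule pw)
    also have "\<dots> = (\<integral>\<^sup>+x. ennreal ((C\<^sup>2 * \<epsilon>\<^sup>2 / ws 0 * ((G x)\<^sup>2 / f (x - ts 0))) / ?p x) \<partial>Q) + 2"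
      by (simp add: nn_integral_add nn_integral_cmult dp_ratio_mean[OF v])
    also have "(\<integral>\<^sup>+x. ennreal ((C\<^sup>2 * \<epsilon>\<^sup>2 / ws 0 * ((G x)\<^sup>2 / f (x - ts 0))) / ?p x) \<partial>Q)
        = (\<integral>\<^sup>+x. ennreal (C\<^sup>2 * \<epsilon>\<^sup>2 / ws 0 * ((G x)\<^sup>2 / f (x - ts 0))) \<partial>lborel)"
      by (rule nn_integral_Q_ratio) (use w0 kernel_pos in \<open>auto simp: less_imp_le\<close>)
    also have "\<dots> = (\<integral>\<^sup>+x. ennreal (C\<^sup>2 * \<epsilon>\<^sup>2 / ws 0) * ennreal ((G x)\<^sup>2 / f (x - ts 0)) \<partial>lborel)"
      using w0 kernel_pos by (intro nn_integral_cong) (simp add: ennreal_mult'[symmetric])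
    also have "\<dots> = ennreal (C\<^sup>2 * \<epsilon>\<^sup>2 / ws 0) * ennreal I"
      by (subst nn_integral_cmult) (simp_all add: I)
    also have "\<dots> = ennreal (A * \<epsilon>\<^sup>2)"
      using I w0 by (simp add: ennreal_mult''[symmetric] A_def mult_ac)
    also have "ennreal (A * \<epsilon>\<^sup>2) + 2 = ennreal (1 + A * \<epsilon>\<^sup>2) + 1"
      using \<open>0 \<le> A\<close> by (simp add: ennreal_plus[symmetric] add_ac del: ennreal_plus flip: ennreal_1 ennreal_numeral)
    finally show "(\<integral>\<^sup>+x. ennreal ((dp_ratio v \<theta> x)\<^sup>2) \<partial>Q) \<le> ennreal (1 + A * \<epsilon>\<^sup>2)"
      by (simp add: ennreal_add_left_cancel_le add.commute[of _ 1])
  qed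
qed

end

section \<open>Numerator and denominator of the posterior\<close>

lemma Markov_inequality_real:
  assumes [measurable]: "u \<in> borel_measurable M" and le: "(\<integral>\<^sup>+x. u x \<partial>M) \<le> ennreal b" and "0 < a" "0 \<le> b"
  shows "emeasure M {x \<in> space M. ennreal a \<le> u x} \<le> ennreal (b / a)"
proof -
  have "{x \<in> space M. ennreal a \<le> u x} = {x \<in> space M. 1 \<le> ennreal (1/a) * u x}"
  proof (intro Collect_cong conj_cong refl)
    fix x
    have i: "ennreal (1/a) * ennreal a = 1" "ennreal a * ennreal (1/a) = 1" using \<open>0 < a\<close> by (simp_all add: ennreal_mult'[symmetric])
    show "ennreal a \<le> u x \<longleftrightarrow> 1 \<le> ennreal (1/a) * u x"
    proof
      assume "ennreal a \<le> u x" then show "1 \<le> ennreal (1/a) * u x"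
        using mult_left_mono[of "ennreal a" "u x" "ennreal (1/a)"] i by simp
    next
      assume "1 \<le> ennreal (1/a) * u x" then show "ennreal a \<le> u x"
        using mult_left_mono[of 1 "ennreal (1/a) * u x" "ennreal a"] i by (simp add: mult.assoc[symmetric])
    qed
  qed
  also have "emeasure M \<dots> \<le> ennreal (1/a) * (\<integral>\<^sup>+x. u x * indicator (space M) x \<partial>M)"
    by (rule nn_integral_Markov_inequality) auto
  also have "(\<integral>\<^sup>+x. u x * indicator (space M) x \<partial>M) = (\<integral>\<^sup>+x. u x \<partial>M)"
    by (rule nn_integral_cong) simp
  also have "ennreal (1/a) * \<dots> \<le> ennreal (1/a) * ennreal b"
    by (rule mult_left_mono[OF le]) simp
  also have "\<dots> = ennreal (b / a)" using assms by (simp add: ennreal_mult'[symmetric])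
  finally show ?thesis .
qed

locale dp_model = true_mixture f F K ws ts
  for f :: "'a::euclidean_space \<Rightarrow> real" and F K ws ts +
  fixes \<alpha> :: real and P0 :: "'a measure"
  assumes alpha_pos: "0 < \<alpha>" and prob_space_P0: "prob_space P0" and sets_P0[measurable_cong]: "sets P0 = sets borel"
begin

abbreviation atoms :: "(nat \<Rightarrow> 'a) measure" where "atoms \<equiv> \<Pi>\<^sub>M k\<in>UNIV. P0"
abbreviation SB :: "((nat \<Rightarrow> real) \<times> (nat \<Rightarrow> 'a)) measure" where "SB \<equiv> stick_breaking \<alpha> P0"
abbreviation XS :: "(nat \<Rightarrow> 'a) measure" where "XS \<equiv> \<Pi>\<^sub>M i\<in>UNIV. Q"

lemma sets_SB[measurable_cong]: "sets SB = sets (beta_sequence \<alpha> \<Otimes>\<^sub>M atoms)"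
  by (simp add: stick_breaking_def)

lemma prob_space_atoms: "prob_space atoms"
  by (intro prob_space_PiM prob_space_P0)

lemma prob_space_SB: "prob_space SB"
  unfolding stick_breaking_def
  by (intro prob_space_pair prob_space_beta_sequence alpha_pos prob_space_atoms)

lemma prob_space_XS: "prob_space XS"
  by (intro prob_space_PiM prob_space_Q)

lemma AE_SB_proper: "AE \<omega> in SB. fst \<omega> \<in> proper_sticks"
proof -
  interpret A: prob_space atoms by (rule prob_space_atoms)
  interpret B: prob_space "beta_sequence \<alpha>" by (rule prob_space_beta_sequence[OF alpha_pos])
  interpret pair_sigma_finite "beta_sequence \<alpha>" atoms ..
  obtain N where N: "N \<in> sets (beta_sequence \<alpha>)" "emeasure (beta_sequence \<alpha>) N = 0"
     "{v \<in> space (beta_sequence \<alpha>). \<not> v \<in> proper_sticks} \<subseteq> N"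
    using AE_proper_sticks[OF alpha_pos] by (auto elim!: AE_E)
  have "emeasure (beta_sequence \<alpha> \<Otimes>\<^sub>M atoms) (N \<times> space atoms) = 0"
    by (subst A.emeasure_pair_measure_Times) (use N in auto)
  moreover have "N \<times> space atoms \<in> sets (beta_sequence \<alpha> \<Otimes>\<^sub>M atoms)" using N by auto
  ultimately show ?thesis unfolding stick_breaking_def
    by (intro AE_I[of _ _ "N \<times> space atoms"]) (use N in \<open>auto simp: space_pair_measure\<close>)
qed

lemma nn_integral_SB_fst:
  assumes [measurable]: "g \<in> borel_measurable (beta_sequence \<alpha>)"
  shows "(\<integral>\<^sup>+\<omega>. g (fst \<omega>) \<partial>SB) = (\<integral>\<^sup>+v. g v \<partial>beta_sequence \<alpha>)"
proof -
  interpret A: prob_space atoms by (rule prob_space_atoms)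
  have "(\<integral>\<^sup>+\<omega>. g (fst \<omega>) \<partial>SB) = (\<integral>\<^sup>+v. \<integral>\<^sup>+\<theta>. g (fst (v, \<theta>)) \<partial>atoms \<partial>beta_sequence \<alpha>)"
    unfolding stick_breaking_def by (rule A.nn_integral_fst[symmetric]) measurable
  then show ?thesis by (simp add: A.emeasure_space_1)
qed

text \<open>The likelihood ratio of the draw \<open>\<omega>\<close> against the truth; its average over the prior is
  the denominator of the posterior, up to the factor \<open>\<Prod>i<n. true_density (X i)\<close>.\<close>
definition evidence_ratio :: "nat \<Rightarrow> (nat \<Rightarrow> real) \<times> (nat \<Rightarrow> 'a) \<Rightarrow> (nat \<Rightarrow> 'a) \<Rightarrow> real" where
  "evidence_ratio n \<omega> X = (\<Prod>i<n. dp_ratio (fst \<omega>) (snd \<omega>) (X i))"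

lemma evidence_ratio_nonneg: "0 \<le> evidence_ratio n \<omega> X"
  unfolding evidence_ratio_def by (intro prod_nonneg) (simp add: dp_ratio_nonneg)

lemma evidence_ratio_measurable[measurable]:
  "(\<lambda>(X, \<omega>). evidence_ratio n \<omega> X) \<in> borel_measurable (XS \<Otimes>\<^sub>M SB)"
  unfolding evidence_ratio_def dp_ratio_def dp_mix_def stick_weight_def case_prod_beta'
  by measurable

lemma evidence_ratio_measurable'[measurable]:
  "X \<in> space XS \<Longrightarrow> (\<lambda>\<omega>. evidence_ratio n \<omega> X) \<in> borel_measurable SB"
  "\<omega> \<in> space SB \<Longrightarrow> (\<lambda>X. evidence_ratio n \<omega> X) \<in> borel_measurable XS"
  using measurable_Pair2[OF evidence_ratio_measurable, of X] measurable_Pair1[OF evidence_ratio_measurable, of \<omega>]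
  by simp_all

lemma space_XS[simp]: "space XS = UNIV"
  by (auto simp: space_PiM data_law_eq)

lemma nn_integral_evidence_ratio:
  assumes "fst \<omega> \<in> proper_sticks"
  shows "(\<integral>\<^sup>+X. ennreal (evidence_ratio n \<omega> X) \<partial>XS) = 1"
proof -
  have "(\<integral>\<^sup>+X. ennreal (evidence_ratio n \<omega> X) \<partial>XS) = (\<integral>\<^sup>+X. (\<Prod>i<n. ennreal (dp_ratio (fst \<omega>) (snd \<omega>) (X i))) \<partial>XS)"
    unfolding evidence_ratio_def by (simp add: prod_ennreal dp_ratio_nonneg)
  also have "\<dots> = (\<Prod>i<n. \<integral>\<^sup>+x. ennreal (dp_ratio (fst \<omega>) (snd \<omega>) x) \<partial>Q)"
    by (rule nn_integral_iid_prod) (auto intro: prob_space_Q)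
  finally show ?thesis by (simp add: dp_ratio_mean[OF assms])
qed

lemma nn_integral_evidence_ratio_dev:
  assumes \<omega>: "fst \<omega> \<in> proper_sticks" "\<omega> \<in> space SB" and "0 \<le> \<eta>"
    and m2: "(\<integral>\<^sup>+x. ennreal ((dp_ratio (fst \<omega>) (snd \<omega>) x)\<^sup>2) \<partial>Q) \<le> ennreal (1 + \<eta>)"
  shows "(\<integral>\<^sup>+X. ennreal ((evidence_ratio n \<omega> X - 1)\<^sup>2) \<partial>XS) \<le> ennreal ((1 + \<eta>) ^ n - 1)"
proof -
  note [measurable] = evidence_ratio_measurable'(2)[OF \<omega>(2)]
  have "(\<integral>\<^sup>+X. ennreal ((evidence_ratio n \<omega> X)\<^sup>2) \<partial>XS) = (\<integral>\<^sup>+X. (\<Prod>i<n. ennreal ((dp_ratio (fst \<omega>) (snd \<omega>) (X i))\<^sup>2)) \<partial>XS)"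
    unfolding evidence_ratio_def by (simp add: prod_ennreal prod_power_distrib)
  also have "\<dots> = (\<Prod>i<n. \<integral>\<^sup>+x. ennreal ((dp_ratio (fst \<omega>) (snd \<omega>) x)\<^sup>2) \<partial>Q)"
    by (rule nn_integral_iid_prod) (auto intro: prob_space_Q)
  also have "\<dots> \<le> (\<Prod>i<n. ennreal (1 + \<eta>))" by (intro prod_mono_ennreal m2)
  finally have sq: "(\<integral>\<^sup>+X. ennreal ((evidence_ratio n \<omega> X)\<^sup>2) \<partial>XS) \<le> ennreal ((1 + \<eta>) ^ n)"
    using \<open>0 \<le> \<eta>\<close> by (simp add: ennreal_power del: ennreal_plus)
  have "(\<integral>\<^sup>+X. ennreal ((evidence_ratio n \<omega> X - 1)\<^sup>2) \<partial>XS) + 2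
     = (\<integral>\<^sup>+X. ennreal ((evidence_ratio n \<omega> X - 1)\<^sup>2) \<partial>XS) + 2 * (\<integral>\<^sup>+X. ennreal (evidence_ratio n \<omega> X) \<partial>XS)"
    by (simp add: nn_integral_evidence_ratio[OF \<omega>(1)])
  also have "\<dots> = (\<integral>\<^sup>+X. ennreal ((evidence_ratio n \<omega> X - 1)\<^sup>2) + 2 * ennreal (evidence_ratio n \<omega> X) \<partial>XS)"
    by (simp add: nn_integral_add nn_integral_cmult)
  also have "\<dots> = (\<integral>\<^sup>+X. ennreal ((evidence_ratio n \<omega> X)\<^sup>2) + 1 \<partial>XS)"
  proof (rule nn_integral_cong)
    fix X
    let ?a = "evidence_ratio n \<omega> X"
    have "ennreal ((?a - 1)\<^sup>2) + 2 * ennreal ?a = ennreal ((?a - 1)\<^sup>2) + ennreal (2 * ?a)"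
      by (simp add: ennreal_mult')
    also have "\<dots> = ennreal ((?a - 1)\<^sup>2 + 2 * ?a)"
      by (rule ennreal_plus[symmetric]) (simp_all add: evidence_ratio_nonneg)
    also have "(?a - 1)\<^sup>2 + 2 * ?a = ?a\<^sup>2 + 1" by (simp add: power2_eq_square algebra_simps)
    finally show "ennreal ((?a - 1)\<^sup>2) + 2 * ennreal ?a = ennreal (?a\<^sup>2) + 1" by simp
  qed
  also have "\<dots> = (\<integral>\<^sup>+X. ennreal ((evidence_ratio n \<omega> X)\<^sup>2) \<partial>XS) + 1"
    by (simp add: nn_integral_add prob_space.emeasure_space_1[OF prob_space_XS, simplified])
  also have "\<dots> \<le> ennreal ((1 + \<eta>) ^ n) + 1" by (rule add_right_mono[OF sq])
  also have "\<dots> = ennreal ((1 + \<eta>) ^ n - 1) + 2"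
    using one_le_power[of "1 + \<eta>" n] \<open>0 \<le> \<eta>\<close>
    by (simp add: ennreal_plus[symmetric] del: ennreal_plus flip: ennreal_1 ennreal_numeral)
  finally show ?thesis by (simp add: ennreal_add_left_cancel_le add.commute[of _ 2])
qed

text \<open>On \<open>E\<close> the likelihood ratio \<open>a\<close> has mean 1 and small variance.  Since \<open>a + (a - 1)\<^sup>2 \<ge> 3/4\<close>,
  the integral of \<open>a\<close> over \<open>E\<close> is at least \<open>3/4 * q\<close> minus that of \<open>(a - 1)\<^sup>2\<close>, and Markov's
  inequality shows that the latter rarely exceeds \<open>q / 4\<close>.\<close>
lemma evidence_lower_bound:
  assumes E[measurable]: "E \<in> sets SB" and q: "emeasure SB E = ennreal q" "0 < q" and "0 \<le> \<eta>"
    and good: "\<And>\<omega>. \<omega> \<in> E \<Longrightarrow> fst \<omega> \<in> proper_sticks"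
      "\<And>\<omega>. \<omega> \<in> E \<Longrightarrow> (\<integral>\<^sup>+x. ennreal ((dp_ratio (fst \<omega>) (snd \<omega>) x)\<^sup>2) \<partial>Q) \<le> ennreal (1 + \<eta>)"
  shows "\<exists>N \<in> sets XS. emeasure XS N \<le> ennreal (4 * ((1 + \<eta>) ^ n - 1)) \<and>
    (\<forall>X. X \<notin> N \<longrightarrow> ennreal (q / 2) \<le> (\<integral>\<^sup>+\<omega>. ennreal (evidence_ratio n \<omega> X) \<partial>SB))"
proof -
  interpret SB: prob_space SB by (rule prob_space_SB)
  interpret XS: prob_space XS by (rule prob_space_XS)
  interpret P: pair_sigma_finite XS SB ..
  let ?r = "(1 + \<eta>) ^ n - 1"
  have r: "0 \<le> ?r" using \<open>0 \<le> \<eta>\<close> by simp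
  define V where "V X = (\<integral>\<^sup>+\<omega>. ennreal ((evidence_ratio n \<omega> X - 1)\<^sup>2) * indicator E \<omega> \<partial>SB)" for X
  have dm: "(\<lambda>(X, \<omega>). ennreal ((evidence_ratio n \<omega> X - 1)\<^sup>2) * indicator E \<omega>) \<in> borel_measurable (XS \<Otimes>\<^sub>M SB)"
    using evidence_ratio_measurable[of n] unfolding case_prod_beta' by measurable
  have [measurable]: "V \<in> borel_measurable XS"
    unfolding V_def by (rule SB.borel_measurable_nn_integral[OF dm])
  have "(\<integral>\<^sup>+X. V X \<partial>XS) = (\<integral>\<^sup>+\<omega>. \<integral>\<^sup>+X. ennreal ((evidence_ratio n \<omega> X - 1)\<^sup>2) * indicator E \<omega> \<partial>XS \<partial>SB)"
    unfolding V_def by (rule P.Fubini'[OF dm, symmetric])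
  also have "\<dots> \<le> (\<integral>\<^sup>+\<omega>. ennreal ?r * indicator E \<omega> \<partial>SB)"
  proof (rule nn_integral_mono)
    fix \<omega> assume "\<omega> \<in> space SB"
    then show "(\<integral>\<^sup>+X. ennreal ((evidence_ratio n \<omega> X - 1)\<^sup>2) * indicator E \<omega> \<partial>XS) \<le> ennreal ?r * indicator E \<omega>"
      using nn_integral_evidence_ratio_dev[OF good(1) _ \<open>0 \<le> \<eta>\<close> good(2), of \<omega> n]
      by (cases "\<omega> \<in> E") auto
  qed
  also have "\<dots> = ennreal (?r * q)" using q r by (simp add: nn_integral_cmult_indicator ennreal_mult)
  finally have EV: "(\<integral>\<^sup>+X. V X \<partial>XS) \<le> ennreal (?r * q)" .
  show ?thesis
  proof (intro bexI[of _ "{X \<in> space XS. ennreal (q / 4) \<le> V X}"] conjI allI impI)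
    have "emeasure XS {X \<in> space XS. ennreal (q / 4) \<le> V X} \<le> ennreal (?r * q / (q / 4))"
      by (rule Markov_inequality_real[OF _ EV]) (use q r in auto)
    then show "emeasure XS {X \<in> space XS. ennreal (q / 4) \<le> V X} \<le> ennreal (4 * ?r)"
      using q by (simp add: mult.commute)
    show "{X \<in> space XS. ennreal (q / 4) \<le> V X} \<in> sets XS" by measurable
    fix X assume "X \<notin> {X \<in> space XS. ennreal (q / 4) \<le> V X}"
    then have VX: "V X < ennreal (q / 4)" by simp
    have X: "X \<in> space XS" by simp
    note [measurable] = evidence_ratio_measurable'(1)[OF X]
    let ?S = "\<integral>\<^sup>+\<omega>. ennreal (evidence_ratio n \<omega> X) \<partial>SB"
    have "ennreal (3/4 * q) = (\<integral>\<^sup>+\<omega>. ennreal (3/4) * indicator E \<omega> \<partial>SB)"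
      by (subst nn_integral_cmult_indicator) (auto simp: q(1) ennreal_mult'[symmetric])
    also have "\<dots> \<le> (\<integral>\<^sup>+\<omega>. ennreal (evidence_ratio n \<omega> X) + ennreal ((evidence_ratio n \<omega> X - 1)\<^sup>2) * indicator E \<omega> \<partial>SB)"
    proof (rule nn_integral_mono)
      fix \<omega>
      let ?a = "evidence_ratio n \<omega> X"
      have "0 \<le> (?a - 1/2)\<^sup>2" by simp
      then have "3/4 \<le> ?a + (?a - 1)\<^sup>2" by (simp add: power2_eq_square algebra_simps)
      then have "ennreal (3/4) \<le> ennreal ?a + ennreal ((?a - 1)\<^sup>2)"
        using evidence_ratio_nonneg[of n \<omega> X] by (simp add: ennreal_plus[symmetric] ennreal_leI del: ennreal_plus)
      then show "ennreal (3/4) * indicator E \<omega> \<le> ennreal ?a + ennreal ((?a - 1)\<^sup>2) * indicator E \<omega>"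
        by (simp split: split_indicator)
    qed
    also have "\<dots> = ?S + V X" unfolding V_def by (rule nn_integral_add) measurable
    finally have le: "ennreal (3/4 * q) \<le> ?S + V X" .
    show "ennreal (q / 2) \<le> ?S"
    proof (rule ccontr)
      assume "\<not> ennreal (q / 2) \<le> ?S"
      then have "?S + V X < ennreal (q / 2) + ennreal (q / 4)"
        using VX by (intro add_strict_mono) auto
      also have "\<dots> = ennreal (3/4 * q)" using q by (simp add: ennreal_plus[symmetric] del: ennreal_plus)
      finally show False using le by simp
    qed
  qed
qed

text \<open>The joint density of allocation and observations given \<open>\<omega>\<close>, divided by the true likelihood.\<close>
definition alloc_ratio :: "nat \<Rightarrow> (nat \<Rightarrow> nat) \<Rightarrow> (nat \<Rightarrow> real) \<times> (nat \<Rightarrow> 'a) \<Rightarrow> (nat \<Rightarrow> 'a) \<Rightarrow> ennreal" where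
  "alloc_ratio n c \<omega> X =
     (\<Prod>i<n. ennreal (stick_weight (fst \<omega>) (c i)) * ennreal (f (X i - snd \<omega> (c i)) / true_density (X i)))"

lemma alloc_ratio_measurable[measurable]:
  "(\<lambda>(X, \<omega>). alloc_ratio n c \<omega> X) \<in> borel_measurable (XS \<Otimes>\<^sub>M SB)"
  unfolding alloc_ratio_def stick_weight_def case_prod_beta' by measurable

lemma alloc_ratio_measurable'[measurable]:
  "(\<lambda>\<omega>. alloc_ratio n c \<omega> X) \<in> borel_measurable SB"
  "\<omega> \<in> space SB \<Longrightarrow> (\<lambda>X. alloc_ratio n c \<omega> X) \<in> borel_measurable XS"
  using measurable_Pair2[OF alloc_ratio_measurable, of X] measurable_Pair1[OF alloc_ratio_measurable, of \<omega>]
  by simp_all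

text \<open>The numerator of the posterior probability of \<open>A\<close>, divided by the true likelihood.\<close>
definition alloc_evidence :: "nat \<Rightarrow> (nat \<Rightarrow> 'a) \<Rightarrow> (nat \<Rightarrow> nat) set \<Rightarrow> ennreal" where
  "alloc_evidence n X A = (\<integral>\<^sup>+\<omega>. \<integral>\<^sup>+c. alloc_ratio n c \<omega> X * indicator A c \<partial>count_space ({..<n} \<rightarrow>\<^sub>E UNIV) \<partial>SB)"

text \<open>Given sticks, atoms and allocation, the mean over the data of each factor
  \<open>f (X i - \<theta> (c i)) / true_density (X i)\<close> is 1, so only the prior weights of the allocation remain.\<close>
lemma alloc_evidence_measurable[measurable]: "(\<lambda>X. alloc_evidence n X A) \<in> borel_measurable XS"
  and nn_integral_alloc_evidence:
   "(\<integral>\<^sup>+X. alloc_evidence n X A \<partial>XS) = (\<integral>\<^sup>+v. alloc_prior n v A \<partial>beta_sequence \<alpha>)"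
proof -
  interpret SB: prob_space SB by (rule prob_space_SB)
  interpret XS: prob_space XS by (rule prob_space_XS)
  interpret P: pair_sigma_finite XS SB ..
  let ?C = "count_space ({..<n} \<rightarrow>\<^sub>E (UNIV::nat set))"
  have m: "(\<lambda>(X, \<omega>). \<integral>\<^sup>+c. alloc_ratio n c \<omega> X * indicator A c \<partial>?C) \<in> borel_measurable (XS \<Otimes>\<^sub>M SB)"
    unfolding case_prod_beta'
  proof (rule measurable_nn_integral_count_space[OF countable_allocations])
    fix c
    show "(\<lambda>z. alloc_ratio n c (snd z) (fst z) * indicator A c) \<in> borel_measurable (XS \<Otimes>\<^sub>M SB)"
      using alloc_ratio_measurable[of n c] unfolding case_prod_beta' by measurable
  qed
  show "(\<lambda>X. alloc_evidence n X A) \<in> borel_measurable XS"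
    unfolding alloc_evidence_def by (rule SB.borel_measurable_nn_integral[OF m])
  have "(\<integral>\<^sup>+X. alloc_evidence n X A \<partial>XS)
     = (\<integral>\<^sup>+\<omega>. \<integral>\<^sup>+X. \<integral>\<^sup>+c. alloc_ratio n c \<omega> X * indicator A c \<partial>?C \<partial>XS \<partial>SB)"
    unfolding alloc_evidence_def by (rule P.Fubini'[OF m, symmetric])
  also have "\<dots> = (\<integral>\<^sup>+\<omega>. alloc_prior n (fst \<omega>) A \<partial>SB)"
  proof (rule nn_integral_cong)
    fix \<omega> assume \<omega>: "\<omega> \<in> space SB"
    have "(\<integral>\<^sup>+X. \<integral>\<^sup>+c. alloc_ratio n c \<omega> X * indicator A c \<partial>?C \<partial>XS)
        = (\<integral>\<^sup>+c. \<integral>\<^sup>+X. alloc_ratio n c \<omega> X * indicator A c \<partial>XS \<partial>?C)"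
      by (rule nn_integral_count_space_nn_integral[OF countable_allocations])
        (use alloc_ratio_measurable'(2)[OF \<omega>] in measurable)
    also have "\<dots> = alloc_prior n (fst \<omega>) A"
      unfolding alloc_prior_def
    proof (rule nn_integral_cong)
      fix c
      have "(\<integral>\<^sup>+X. alloc_ratio n c \<omega> X \<partial>XS) = (\<Prod>i<n. \<integral>\<^sup>+x. ennreal (stick_weight (fst \<omega>) (c i)) * ennreal (f (x - snd \<omega> (c i)) / true_density x) \<partial>Q)"
        unfolding alloc_ratio_def by (rule nn_integral_iid_prod) (auto intro: prob_space_Q)
      also have "\<dots> = (\<Prod>i<n. ennreal (stick_weight (fst \<omega>) (c i)))"
        by (simp add: nn_integral_cmult nn_integral_Q_kernel_ratio)
      finally show "(\<integral>\<^sup>+X. alloc_ratio n c \<omega> X * indicator A c \<partial>XS) = (\<Prod>i<n. ennreal (stick_weight (fst \<omega>) (c i))) * indicator A c"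
        by (simp split: split_indicator)
    qed
    finally show "(\<integral>\<^sup>+X. \<integral>\<^sup>+c. alloc_ratio n c \<omega> X * indicator A c \<partial>?C \<partial>XS) = alloc_prior n (fst \<omega>) A" .
  qed
  also have "\<dots> = (\<integral>\<^sup>+v. alloc_prior n v A \<partial>beta_sequence \<alpha>)"
    by (rule nn_integral_SB_fst) (rule measurable_alloc_prior)
  finally show "(\<integral>\<^sup>+X. alloc_evidence n X A \<partial>XS) = (\<integral>\<^sup>+v. alloc_prior n v A \<partial>beta_sequence \<alpha>)" .
qed

text \<open>The numerators add up to the denominator, so the posterior is a probability measure.\<close>
lemma alloc_evidence_UNIV:
  "alloc_evidence n X UNIV = (\<integral>\<^sup>+\<omega>. ennreal (evidence_ratio n \<omega> X) \<partial>SB)"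
  unfolding alloc_evidence_def
proof (rule nn_integral_cong_AE, use AE_SB_proper in eventually_elim)
  fix \<omega> :: "(nat \<Rightarrow> real) \<times> (nat \<Rightarrow> 'a)" assume \<omega>: "fst \<omega> \<in> proper_sticks"
  let ?p = true_density
  have "(\<integral>\<^sup>+c. alloc_ratio n c \<omega> X * indicator UNIV c \<partial>count_space ({..<n} \<rightarrow>\<^sub>E UNIV))
     = (\<Prod>i<n. \<Sum>k. ennreal (stick_weight (fst \<omega>) k) * ennreal (f (X i - snd \<omega> k) / ?p (X i)))"
    unfolding alloc_ratio_def
    using nn_integral_allocations_prod[where n=n and
        g="\<lambda>i k. ennreal (stick_weight (fst \<omega>) k) * ennreal (f (X i - snd \<omega> k) / ?p (X i))"] by simp
  also have "\<dots> = (\<Prod>i<n. ennreal (dp_ratio (fst \<omega>) (snd \<omega>) (X i)))"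
  proof (intro prod.cong refl)
    fix i
    let ?x = "X i"
    have p: "0 < ?p ?x" by (rule true_density_pos)
    have "(\<Sum>k. ennreal (stick_weight (fst \<omega>) k) * ennreal (f (?x - snd \<omega> k) / ?p ?x))
       = (\<Sum>k. ennreal (1 / ?p ?x) * (ennreal (stick_weight (fst \<omega>) k) * ennreal (f (?x - snd \<omega> k))))"
    proof (rule suminf_cong)
      fix k
      have "ennreal (f (?x - snd \<omega> k) / ?p ?x) = ennreal (1 / ?p ?x) * ennreal (f (?x - snd \<omega> k))"
        using p by (simp add: ennreal_mult'[symmetric])
      then show "ennreal (stick_weight (fst \<omega>) k) * ennreal (f (?x - snd \<omega> k) / ?p ?x)
        = ennreal (1 / ?p ?x) * (ennreal (stick_weight (fst \<omega>) k) * ennreal (f (?x - snd \<omega> k)))"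
        by (simp add: mult_ac)
    qed
    also have "\<dots> = ennreal (1 / ?p ?x) * dp_mix f (fst \<omega>) (snd \<omega>) ?x"
      unfolding dp_mix_def by (rule ennreal_suminf_cmult)
    also have "dp_mix f (fst \<omega>) (snd \<omega>) ?x = ennreal (enn2real (dp_mix f (fst \<omega>) (snd \<omega>) ?x))"
      using dp_mix_finite[OF \<omega>] by simp
    also have "ennreal (1 / ?p ?x) * \<dots> = ennreal (dp_ratio (fst \<omega>) (snd \<omega>) ?x)"
      unfolding dp_ratio_def using p by (subst ennreal_mult'[symmetric]) auto
    finally show "(\<Sum>k. ennreal (stick_weight (fst \<omega>) k) * ennreal (f (?x - snd \<omega> k) / ?p ?x))
      = ennreal (dp_ratio (fst \<omega>) (snd \<omega>) ?x)" .
  qed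
  also have "\<dots> = ennreal (evidence_ratio n \<omega> X)"
    by (simp add: evidence_ratio_def prod_ennreal dp_ratio_nonneg)
  finally show "(\<integral>\<^sup>+c. alloc_ratio n c \<omega> X * indicator UNIV c \<partial>count_space ({..<n} \<rightarrow>\<^sub>E UNIV)) = ennreal (evidence_ratio n \<omega> X)" .
qed

lemma alloc_evidence_mono: "A \<subseteq> A' \<Longrightarrow> alloc_evidence n X A \<le> alloc_evidence n X A'"
  unfolding alloc_evidence_def by (intro nn_integral_mono mult_left_mono) (auto split: split_indicator)

lemma alloc_evidence_finite: "alloc_evidence n X A < \<top>"
proof -
  interpret SB: prob_space SB by (rule prob_space_SB)
  have F: "0 \<le> F" using kernel_pos kernel_less less_imp_le less_trans by blast
  have "alloc_evidence n X A \<le> alloc_evidence n X UNIV" by (rule alloc_evidence_mono) simp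
  also have "\<dots> \<le> (\<integral>\<^sup>+\<omega>. ennreal (\<Prod>i<n. F / true_density (X i)) \<partial>SB)"
    unfolding alloc_evidence_UNIV
  proof (rule nn_integral_mono_AE, use AE_SB_proper in eventually_elim)
    fix \<omega> :: "(nat \<Rightarrow> real) \<times> (nat \<Rightarrow> 'a)" assume \<omega>: "fst \<omega> \<in> proper_sticks"
    have "dp_ratio (fst \<omega>) (snd \<omega>) x \<le> F / true_density x" for x
      unfolding dp_ratio_def using dp_mix_le[OF \<omega>, of "snd \<omega>" x] F less_imp_le[OF true_density_pos]
      by (intro divide_right_mono enn2real_leI) auto
    then show "ennreal (evidence_ratio n \<omega> X) \<le> ennreal (\<Prod>i<n. F / true_density (X i))"
      unfolding evidence_ratio_def by (intro ennreal_leI prod_mono) (auto simp: dp_ratio_nonneg)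
  qed
  also have "\<dots> < \<top>" by (simp add: SB.emeasure_space_1)
  finally show ?thesis .
qed

text \<open>The point masses are quotients of Bochner integrals.  Their integrands are measurable and almost
  everywhere nonnegative, hence both integrals agree with the extended ones after the common factor
  \<open>p = (\<Prod>i<n. true_density (X i))\<close> has been taken out.\<close>
lemma emeasure_allocation_posterior:
  assumes pos: "0 < alloc_evidence n X UNIV" and A: "A \<subseteq> {..<n} \<rightarrow>\<^sub>E UNIV"
  shows "emeasure (allocation_posterior \<alpha> P0 f n X) A = alloc_evidence n X A / alloc_evidence n X UNIV"
proof -
  let ?C = "count_space ({..<n} \<rightarrow>\<^sub>E (UNIV::nat set))"
  let ?z = "alloc_evidence n X UNIV"
  define p where "p = (\<Prod>i<n. true_density (X i))"
  have p: "0 < p" unfolding p_def by (intro prod_pos ballI true_density_pos)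
  have pn0: "true_density x \<noteq> 0" for x using true_density_pos[of x] by simp
  have zfin: "?z < \<top>" by (rule alloc_evidence_finite)
  define N where "N c = (\<integral>\<^sup>+\<omega>. alloc_ratio n c \<omega> X \<partial>SB)" for c
  have fub: "alloc_evidence n X B = (\<integral>\<^sup>+c. N c * indicator B c \<partial>?C)" for B
  proof -
    have "alloc_evidence n X B = (\<integral>\<^sup>+c. \<integral>\<^sup>+\<omega>. alloc_ratio n c \<omega> X * indicator B c \<partial>SB \<partial>?C)"
      unfolding alloc_evidence_def
      by (rule nn_integral_count_space_nn_integral[OF countable_allocations]) measurable
    also have "\<dots> = (\<integral>\<^sup>+c. N c * indicator B c \<partial>?C)"
      unfolding N_def by (intro nn_integral_cong) (simp split: split_indicator)
    finally show ?thesis .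
  qed
  have Nle: "N c \<le> ?z" if "c \<in> {..<n} \<rightarrow>\<^sub>E UNIV" for c
  proof -
    have "N c = (\<integral>\<^sup>+c'. N c' * indicator {c} c' \<partial>?C)"
      using that by (subst nn_integral_indicator_singleton) auto
    also have "\<dots> \<le> ?z" unfolding fub by (intro nn_integral_mono) (auto split: split_indicator)
    finally show ?thesis .
  qed
  have num: "(\<integral>(v, \<theta>). (\<Prod>i<n. stick_weight v (c i) * f (X i - \<theta> (c i))) \<partial>SB) = p * enn2real (N c)" for c
  proof -
    have "(\<integral>(v, \<theta>). (\<Prod>i<n. stick_weight v (c i) * f (X i - \<theta> (c i))) \<partial>SB)
       = enn2real (\<integral>\<^sup>+\<omega>. ennreal (\<Prod>i<n. stick_weight (fst \<omega>) (c i) * f (X i - snd \<omega> (c i))) \<partial>SB)"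
      unfolding case_prod_beta'
    proof (rule integral_eq_nn_integral)
      show "(\<lambda>\<omega>. \<Prod>i<n. stick_weight (fst \<omega>) (c i) * f (X i - snd \<omega> (c i))) \<in> borel_measurable SB"
        unfolding stick_weight_def by measurable
      show "AE \<omega> in SB. 0 \<le> (\<Prod>i<n. stick_weight (fst \<omega>) (c i) * f (X i - snd \<omega> (c i)))"
        using AE_SB_proper
        by eventually_elim (auto intro!: prod_nonneg mult_nonneg_nonneg less_imp_le[OF kernel_pos] less_imp_le[OF proper_sticksD(4)])
    qed
    also have "(\<integral>\<^sup>+\<omega>. ennreal (\<Prod>i<n. stick_weight (fst \<omega>) (c i) * f (X i - snd \<omega> (c i))) \<partial>SB)
       = (\<integral>\<^sup>+\<omega>. ennreal p * alloc_ratio n c \<omega> X \<partial>SB)"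
    proof (rule nn_integral_cong_AE, use AE_SB_proper in eventually_elim)
      fix \<omega> :: "(nat \<Rightarrow> real) \<times> (nat \<Rightarrow> 'a)" assume \<omega>: "fst \<omega> \<in> proper_sticks"
      have nn: "0 \<le> stick_weight (fst \<omega>) k" "0 \<le> f x / true_density y" for k x y
        using less_imp_le[OF proper_sticksD(4)[OF \<omega>]] less_imp_le[OF kernel_pos] less_imp_le[OF true_density_pos] by auto
      have "(\<Prod>i<n. stick_weight (fst \<omega>) (c i) * f (X i - snd \<omega> (c i)))
         = p * (\<Prod>i<n. stick_weight (fst \<omega>) (c i) * (f (X i - snd \<omega> (c i)) / true_density (X i)))"
        unfolding p_def prod.distrib[symmetric] by (intro prod.cong refl) (simp add: pn0)
      also have "ennreal \<dots> = ennreal p * alloc_ratio n c \<omega> X"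
        unfolding alloc_ratio_def using p nn
        by (simp add: ennreal_mult' prod_ennreal[symmetric] prod_nonneg del: times_divide_eq_right)
      finally show "ennreal (\<Prod>i<n. stick_weight (fst \<omega>) (c i) * f (X i - snd \<omega> (c i))) = ennreal p * alloc_ratio n c \<omega> X" .
    qed
    also have "\<dots> = ennreal p * N c" unfolding N_def by (rule nn_integral_cmult) measurable
    also have "enn2real \<dots> = p * enn2real (N c)" using p by (simp add: enn2real_mult)
    finally show ?thesis .
  qed
  have den: "(\<integral>\<omega>. (\<Prod>i<n. mixture (dp_draw \<omega>) f (X i)) \<partial>SB) = p * enn2real ?z"
  proof -
    have eq: "(\<Prod>i<n. mixture (dp_draw \<omega>) f (X i)) = p * evidence_ratio n \<omega> X" for \<omega>
    proof -
      have "mixture (dp_draw \<omega>) f x = true_density x * dp_ratio (fst \<omega>) (snd \<omega>) x" for x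
        using mixture_dp_draw[of f "fst \<omega>" "snd \<omega>" x] kernel_pos
        by (simp add: dp_ratio_def less_imp_le pn0)
      then show ?thesis by (simp add: p_def evidence_ratio_def prod.distrib)
    qed
    have "(\<integral>\<omega>. evidence_ratio n \<omega> X \<partial>SB) = enn2real ?z"
      unfolding alloc_evidence_UNIV
      by (rule integral_eq_nn_integral) (simp_all add: evidence_ratio_nonneg)
    then show ?thesis unfolding eq by simp
  qed
  have mass: "ennreal (allocation_mass \<alpha> P0 f n X c) = N c / ?z" if c: "c \<in> {..<n} \<rightarrow>\<^sub>E UNIV" for c
  proof -
    have "allocation_mass \<alpha> P0 f n X c = enn2real (N c) / enn2real ?z"
      unfolding allocation_mass_def num den using p by simp
    moreover have "N c = ennreal (enn2real (N c))" "?z = ennreal (enn2real ?z)"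
      using Nle[OF c] zfin by (auto simp: le_less_trans)
    moreover have "0 < enn2real ?z" using pos zfin by (simp add: enn2real_positive_iff)
    ultimately show ?thesis by (metis divide_ennreal enn2real_nonneg)
  qed
  have "emeasure (allocation_posterior \<alpha> P0 f n X) A = (\<integral>\<^sup>+c. ennreal (allocation_mass \<alpha> P0 f n X c) * indicator A c \<partial>?C)"
    unfolding allocation_posterior_def using A by (intro emeasure_density) auto
  also have "\<dots> = (\<integral>\<^sup>+c. N c * indicator A c / ?z \<partial>?C)"
    by (intro nn_integral_cong) (auto simp: mass split: split_indicator)
  also have "\<dots> = alloc_evidence n X A / ?z"
    unfolding fub[of A] by (rule nn_integral_divide) simp
  finally show ?thesis .
qed

text \<open>Outside two exceptional sets of data the denominator is at least \<open>q / 2\<close> and the numerator of \<open>A\<close> is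
  below \<open>\<delta> * q / 2\<close>.\<close>
lemma posterior_concentration:
  assumes E: "E \<in> sets SB" and q: "emeasure SB E = ennreal q" "0 < q" and "0 \<le> \<eta>"
    and good: "\<And>\<omega>. \<omega> \<in> E \<Longrightarrow> fst \<omega> \<in> proper_sticks"
      "\<And>\<omega>. \<omega> \<in> E \<Longrightarrow> (\<integral>\<^sup>+x. ennreal ((dp_ratio (fst \<omega>) (snd \<omega>) x)\<^sup>2) \<partial>Q) \<le> ennreal (1 + \<eta>)"
    and bad: "(\<integral>\<^sup>+v. alloc_prior n v A \<partial>beta_sequence \<alpha>) \<le> ennreal b" "0 \<le> b"
    and "0 < \<delta>"
  shows "measure XS {X \<in> space XS. \<bar>measure (allocation_posterior \<alpha> P0 f n X) (({..<n} \<rightarrow>\<^sub>E UNIV) - A) - 1\<bar> > \<delta>}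
     \<le> 4 * ((1 + \<eta>) ^ n - 1) + 2 * b / (\<delta> * q)"
proof -
  interpret XS: prob_space XS by (rule prob_space_XS)
  obtain N where N: "N \<in> sets XS" "emeasure XS N \<le> ennreal (4 * ((1 + \<eta>) ^ n - 1))"
    "\<And>X. X \<notin> N \<Longrightarrow> ennreal (q / 2) \<le> (\<integral>\<^sup>+\<omega>. ennreal (evidence_ratio n \<omega> X) \<partial>SB)"
    using evidence_lower_bound[OF E q \<open>0 \<le> \<eta>\<close> good, of n] by blast
  define N' where "N' = {X \<in> space XS. ennreal (\<delta> * q / 2) \<le> alloc_evidence n X A}"
  have N'm: "N' \<in> sets XS" unfolding N'_def by measurable
  have "emeasure XS N' \<le> ennreal (b / (\<delta> * q / 2))"
    unfolding N'_def
    by (rule Markov_inequality_real) (use q bad \<open>0 < \<delta>\<close> in \<open>auto simp: nn_integral_alloc_evidence\<close>)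
  then have N'2: "measure XS N' \<le> b / (\<delta> * q / 2)"
    using q bad \<open>0 < \<delta>\<close> by (simp add: XS.emeasure_eq_measure)
  have N2: "measure XS N \<le> 4 * ((1 + \<eta>) ^ n - 1)"
    using N(2) \<open>0 \<le> \<eta>\<close> one_le_power[of "1 + \<eta>" n] by (simp add: XS.emeasure_eq_measure)
  let ?S = "{X \<in> space XS. \<bar>measure (allocation_posterior \<alpha> P0 f n X) (({..<n} \<rightarrow>\<^sub>E UNIV) - A) - 1\<bar> > \<delta>}"
  have "?S \<subseteq> N \<union> N'"
  proof
    fix X assume X: "X \<in> ?S"
    show "X \<in> N \<union> N'"
    proof (rule ccontr)
      assume nX: "X \<notin> N \<union> N'"
      let ?P = "allocation_posterior \<alpha> P0 f n X" and ?U = "{..<n} \<rightarrow>\<^sub>E (UNIV :: nat set)"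
      let ?z = "alloc_evidence n X UNIV"
      have z: "ennreal (q / 2) \<le> ?z" using N(3)[of X] nX by (simp add: alloc_evidence_UNIV)
      then have zpos: "0 < ?z" using q by (metis ennreal_less_zero_iff half_gt_zero less_le_trans)
      have zfin: "?z < \<top>" by (rule alloc_evidence_finite)
      have spP: "space ?P = ?U" "sets ?P = Pow ?U" by (simp_all add: allocation_posterior_def)
      have evU: "alloc_evidence n X ?U = ?z"
        unfolding alloc_evidence_def by (intro nn_integral_cong) simp
      have "emeasure ?P (space ?P) = 1"
        unfolding spP using emeasure_allocation_posterior[OF zpos, of ?U] zpos zfin
        by (simp add: evU ennreal_divide_self)
      then interpret P: prob_space ?P by (rule prob_spaceI)
      have "alloc_evidence n X (?U \<inter> A) \<le> alloc_evidence n X A" by (rule alloc_evidence_mono) simp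
      also have "\<dots> \<le> ennreal (\<delta> * q / 2)" using nX by (auto simp: N'_def)
      also have "\<dots> = ennreal \<delta> * ennreal (q / 2)" using \<open>0 < \<delta>\<close> q by (simp add: ennreal_mult'[symmetric])
      also have "\<dots> \<le> ennreal \<delta> * ?z" by (intro mult_left_mono z) simp
      finally have "alloc_evidence n X (?U \<inter> A) / ?z \<le> ennreal \<delta> * ?z / ?z"
        by (rule divide_right_mono_ennreal)
      also have "\<dots> = ennreal \<delta>"
        by (rule mult_divide_eq_ennreal) (use zpos zfin in auto)
      finally have "alloc_evidence n X (?U \<inter> A) / ?z \<le> ennreal \<delta>" .
      then have "emeasure ?P (?U \<inter> A) \<le> ennreal \<delta>"
        by (subst emeasure_allocation_posterior[OF zpos]) auto
      then have "measure ?P (?U \<inter> A) \<le> \<delta>" using \<open>0 < \<delta>\<close> by (simp add: P.emeasure_eq_measure)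
      moreover have "measure ?P (?U - A) = 1 - measure ?P (?U \<inter> A)"
        using P.prob_compl[of "?U \<inter> A"] by (simp add: spP Diff_Int_distrib Diff_Int)
      ultimately show False using X measure_nonneg[of ?P "?U \<inter> A"] by simp
    qed
  qed
  then have "measure XS ?S \<le> measure XS (N \<union> N')"
    using N(1) N'm by (intro XS.finite_measure_mono) auto
  also have "\<dots> \<le> measure XS N + measure XS N'"
    by (rule measure_Un_le) (use N N'm in auto)
  also have "\<dots> \<le> 4 * ((1 + \<eta>) ^ n - 1) + 2 * b / (\<delta> * q)" using N2 N'2 by (simp add: mult.commute)
  finally show ?thesis .
qed

end

section \<open>Prior mass near the truth\<close>

text \<open>The sticks that produce given weights: \<open>w k\<close> as a fraction of what the earlier weights leave.\<close>
definition break_fraction :: "(nat \<Rightarrow> real) \<Rightarrow> nat \<Rightarrow> real" where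
  "break_fraction w k = w k / (1 - (\<Sum>j<k. w j))"

context
  fixes K :: nat and w :: "nat \<Rightarrow> real"
  assumes w: "\<And>k. k < K \<Longrightarrow> 0 < w k" "(\<Sum>k<K. w k) = 1"
begin

lemma partial_weights_less: "k < K \<Longrightarrow> (\<Sum>j<k. w j) < 1"
  using sum_strict_mono2[of "{..<K}" "{..<k}" k w] w by (auto simp: less_imp_le)

lemma partial_weights_le: "k \<le> K \<Longrightarrow> (\<Sum>j<k. w j) \<le> 1"
  using partial_weights_less[of k] w by (cases "k = K") auto

lemma break_fraction_bounds:
  assumes "k < K"
  shows "0 < break_fraction w k" "break_fraction w k \<le> 1" "Suc k < K \<Longrightarrow> break_fraction w k < 1"
    "Suc k = K \<Longrightarrow> break_fraction w k = 1"
proof -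
  note p = partial_weights_less[OF assms] w(1)[OF assms]
  show "0 < break_fraction w k" using p by (simp add: break_fraction_def)
  show "break_fraction w k \<le> 1"
    using p partial_weights_le[of "Suc k"] assms by (simp add: break_fraction_def)
  show "break_fraction w k < 1" if "Suc k < K"
    using p partial_weights_less[OF that] by (simp add: break_fraction_def)
  show "break_fraction w k = 1" if "Suc k = K"
    using p w(2) by (simp add: break_fraction_def that[symmetric])
qed

lemma stick_rest_break_fraction: "k \<le> K \<Longrightarrow> stick_rest (break_fraction w) k = 1 - (\<Sum>j<k. w j)"
proof (induction k)
  case (Suc k)
  have "stick_rest (break_fraction w) (Suc k) = (1 - (\<Sum>j<k. w j)) * (1 - break_fraction w k)"
    using Suc by (simp add: stick_rest_def)
  also have "\<dots> = 1 - (\<Sum>j<Suc k. w j)"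
    using partial_weights_less[of k] Suc.prems by (simp add: break_fraction_def right_diff_distrib)
  finally show ?case .
qed (simp add: stick_rest_def)

lemma stick_weight_break_fraction: "k < K \<Longrightarrow> stick_weight (break_fraction w) k = w k"
  using partial_weights_less[of k] stick_rest_break_fraction[of k]
  by (simp add: stick_weight_eq) (simp add: break_fraction_def)

text \<open>Weights are products of numbers in the unit interval, so changing each factor by at most \<open>\<epsilon>\<close>
  changes the product by at most \<open>\<epsilon>\<close> times the number of factors.  The last of the \<open>K\<close> sticks is
  within \<open>\<epsilon>\<close> of 1 and takes all but a fraction \<open>\<epsilon>\<close> of the remainder.\<close>
lemma sticks_near_break_fraction:
  assumes v: "\<And>k. 0 < v k \<and> v k < 1"
    and near: "\<And>k. k < K \<Longrightarrow> break_fraction w k - \<epsilon> \<le> v k \<and> v k \<le> break_fraction w k"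
  shows "k < K \<Longrightarrow> \<bar>stick_weight v k - w k\<bar> \<le> real K * \<epsilon>" "stick_rest v K \<le> \<epsilon>"
proof -
  have "0 < K" using w(2) by (intro Nat.gr0I) auto
  then obtain L where L: "K = Suc L" by (cases K) auto
  have LK: "L < K" "Suc L = K" using L by simp_all
  have "stick_rest v K = stick_rest v L * (1 - v L)" by (simp add: L stick_rest_def)
  also have "\<dots> \<le> 1 * \<epsilon>"
  proof (rule mult_mono)
    show "stick_rest v L \<le> 1" by (rule stick_rest_le_1) (rule v)
    have "1 - \<epsilon> \<le> v L" using near[OF LK(1)] break_fraction_bounds(4)[OF LK] by linarith
    then show "1 - v L \<le> \<epsilon>" by simp
    show "0 \<le> 1 - v L" using v[of L] by linarith
  qed simp
  finally show "stick_rest v K \<le> \<epsilon>" by simp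
  have "0 \<le> \<epsilon>" using near[OF LK(1)] by linarith
  assume k: "k < K"
  define z where "z u j = (if j = k then u j else 1 - u j)" for u :: "nat \<Rightarrow> real" and j
  have sw: "stick_weight u k = (\<Prod>j\<in>{..k}. z u j)" for u
  proof -
    have "(\<Prod>j\<in>{..k}. z u j) = z u k * (\<Prod>j<k. z u j)"
      by (simp add: lessThan_Suc_atMost[symmetric] mult.commute)
    also have "(\<Prod>j<k. z u j) = (\<Prod>j<k. 1 - u j)" by (intro prod.cong) (auto simp: z_def)
    finally show ?thesis by (simp add: stick_weight_def z_def)
  qed
  have "norm ((\<Prod>j\<in>{..k}. z v j) - (\<Prod>j\<in>{..k}. z (break_fraction w) j))
     \<le> (\<Sum>j\<in>{..k}. norm (z v j - z (break_fraction w) j))"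
  proof (rule norm_prod_diff)
    fix j assume "j \<in> {..k}"
    then show "norm (z v j) \<le> 1" "norm (z (break_fraction w) j) \<le> 1"
      using v[of j] break_fraction_bounds(1,2)[of j] k by (auto simp: z_def)
  qed
  also have "\<dots> \<le> (\<Sum>j\<in>{..k}. \<epsilon>)"
  proof (rule sum_mono)
    fix j assume "j \<in> {..k}"
    then have "j < K" using k by simp
    from near[OF this] show "norm (z v j - z (break_fraction w) j) \<le> \<epsilon>"
      using \<open>0 \<le> \<epsilon>\<close> by (cases "j = k") (simp_all add: z_def abs_le_iff)
  qed
  also have "\<dots> \<le> real K * \<epsilon>"
    using k \<open>0 \<le> \<epsilon>\<close> by (auto intro: mult_right_mono)
  finally show "\<bar>stick_weight v k - w k\<bar> \<le> real K * \<epsilon>"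
    by (simp add: sw[symmetric] stick_weight_break_fraction[OF k])
qed

text \<open>Inside the unit interval the density of a stick is bounded below, but near 1 it behaves like
  \<open>\<alpha> * (1 - x) powr (\<alpha> - 1)\<close>.  Only the last stick has to be near 1.\<close>
lemma beta_near_break_fraction:
  assumes "1 \<le> \<alpha>" "k < K"
  shows "\<exists>c>0. \<forall>\<^sub>F \<epsilon> in at_right 0.
    ennreal (c * \<epsilon> powr (if Suc k = K then \<alpha> else 1))
      \<le> emeasure (beta_measure 1 \<alpha>) {break_fraction w k - \<epsilon>..break_fraction w k - \<epsilon>/2}"
proof -
  let ?b = "break_fraction w k"
  note b = break_fraction_bounds[OF assms(2)]
  have small: "\<forall>\<^sub>F \<epsilon> in at_right 0. 0 < \<epsilon> \<and> \<epsilon> < ?b"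
    using b(1) unfolding eventually_at_right_field by blast
  define c where "c = (if Suc k = K then \<alpha> * (1/2) powr \<alpha> else \<alpha> * (1 - ?b) powr (\<alpha> - 1) / 2)"
  have "0 < c" using b assms by (auto simp: c_def)
  moreover have "\<forall>\<^sub>F \<epsilon> in at_right 0. ennreal (c * \<epsilon> powr (if Suc k = K then \<alpha> else 1))
      \<le> emeasure (beta_measure 1 \<alpha>) {?b - \<epsilon>..?b - \<epsilon>/2}"
    using small
  proof eventually_elim
    case (elim \<epsilon>)
    have "c * \<epsilon> powr (if Suc k = K then \<alpha> else 1) \<le> \<alpha> * (1 - ?b + \<epsilon>/2) powr (\<alpha> - 1) * (\<epsilon>/2)"
    proof (cases "Suc k = K")
      case True
      have "(\<epsilon>/2) powr \<alpha> = (\<epsilon>/2) powr (\<alpha> - 1) * (\<epsilon>/2)"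
        using elim powr_add[of "\<epsilon>/2" "\<alpha> - 1" 1] by simp
      moreover have "(\<epsilon>/2) powr \<alpha> = (1/2) powr \<alpha> * \<epsilon> powr \<alpha>"
        using elim powr_mult[of "1/2" \<epsilon> \<alpha>] by simp
      ultimately have "(1/2) powr \<alpha> * \<epsilon> powr \<alpha> = (\<epsilon>/2) powr (\<alpha> - 1) * (\<epsilon>/2)" by simp
      then show ?thesis using True b(4) assms by (simp only: c_def) (simp add: mult.assoc)
    next
      case False
      then have "?b < 1" using assms b(3) by auto
      then have "(1 - ?b) powr (\<alpha> - 1) \<le> (1 - ?b + \<epsilon>/2) powr (\<alpha> - 1)"
        using elim assms by (intro powr_mono2) auto
      then show ?thesis using False elim assms by (simp add: c_def mult_left_mono mult_right_mono)
    qed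
    also have "ennreal \<dots> \<le> emeasure (beta_measure 1 \<alpha>) {?b - \<epsilon>..?b - \<epsilon>/2}"
      by (rule beta_interval_lower) (use elim assms b in auto)
    finally show ?case by (simp add: ennreal_leI)
  qed
  ultimately show ?thesis by blast
qed

end

context
  fixes \<Theta> :: "'a::euclidean_space set" and P0 :: "'a measure" and p0 :: "'a \<Rightarrow> real"
  assumes base: "base_measure_on \<Theta> P0 p0" and cpt: "compact \<Theta>"
begin

lemma base_density_measurable: "(\<lambda>x. ennreal (indicator \<Theta> x * p0 x)) \<in> borel_measurable borel"
  using borel_measurable_continuous_on_indicator[of \<Theta> p0] base cpt
  by (auto simp: base_measure_on_def borel_closed compact_imp_closed intro!: measurable_compose[OF _ measurable_ennreal])

lemma base_measure_eq: "P0 = density lborel (\<lambda>x. ennreal (indicator \<Theta> x * p0 x))"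
  using base unfolding base_measure_on_def by blast

lemma sets_base_measure: "sets P0 = sets borel"
  by (subst base_measure_eq) simp

lemma AE_base_measure: "AE x in P0. x \<in> \<Theta>"
  by (subst base_measure_eq, subst AE_density) (use base_density_measurable in \<open>auto simp: indicator_def\<close>)

text \<open>Near \<open>t\<close> the density is at least \<open>p0 t / 2\<close> on \<open>\<Theta>\<close>, and \<open>\<Theta>\<close> has volume of order
  \<open>\<epsilon> ^ DIM('a)\<close> in the ball.\<close>
lemma base_measure_ball:
  assumes t: "t \<in> \<Theta>" "0 < p0 t" "lebesgue_thick_at \<Theta> t"
  shows "\<exists>c>0. \<forall>\<^sub>F \<epsilon> in at_right 0. ennreal (c * \<epsilon> ^ DIM('a)) \<le> emeasure P0 (cball t \<epsilon>)"
proof -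
  obtain c where c: "0 < c" "\<And>r. 0 < r \<Longrightarrow> r \<le> 1 \<Longrightarrow> c * r ^ DIM('a) \<le> measure lborel (\<Theta> \<inter> cball t r)"
    using t(3) unfolding lebesgue_thick_at_def by blast
  have "continuous_on \<Theta> p0" using base by (simp add: base_measure_on_def)
  then obtain d where d: "0 < d" "\<And>x. x \<in> \<Theta> \<Longrightarrow> dist x t < d \<Longrightarrow> dist (p0 x) (p0 t) < p0 t / 2"
    using t(1,2) unfolding continuous_on_iff by (metis half_gt_zero)
  have "\<forall>\<^sub>F \<epsilon> in at_right 0. 0 < \<epsilon> \<and> \<epsilon> < min d 1"
    using d(1) unfolding eventually_at_right_field by (intro exI[of _ "min d 1"]) auto
  then have "\<forall>\<^sub>F \<epsilon> in at_right 0. ennreal (p0 t / 2 * c * \<epsilon> ^ DIM('a)) \<le> emeasure P0 (cball t \<epsilon>)"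
  proof eventually_elim
    case (elim \<epsilon>)
    have fin: "emeasure lborel (\<Theta> \<inter> cball t \<epsilon>) < \<infinity>"
      by (rule emeasure_bounded_finite) (simp add: bounded_Int)
    have meas: "\<Theta> \<inter> cball t \<epsilon> \<in> sets borel" using cpt by (auto intro: borel_closed compact_imp_closed)
    have "ennreal (p0 t / 2 * c * \<epsilon> ^ DIM('a)) \<le> ennreal (p0 t / 2 * measure lborel (\<Theta> \<inter> cball t \<epsilon>))"
      using c(2)[of \<epsilon>] elim t by (intro ennreal_leI) (simp add: mult.assoc)
    also have "\<dots> = ennreal (p0 t / 2) * emeasure lborel (\<Theta> \<inter> cball t \<epsilon>)"
      using t fin by (subst emeasure_eq_ennreal_measure) (simp_all add: ennreal_mult'[symmetric])
    also have "\<dots> = (\<integral>\<^sup>+x. ennreal (p0 t / 2) * indicator (\<Theta> \<inter> cball t \<epsilon>) x \<partial>lborel)"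
      using meas by (simp add: nn_integral_cmult_indicator)
    also have "\<dots> \<le> (\<integral>\<^sup>+x. ennreal (indicator \<Theta> x * p0 x) * indicator (cball t \<epsilon>) x \<partial>lborel)"
    proof (rule nn_integral_mono)
      fix x
      show "ennreal (p0 t / 2) * indicator (\<Theta> \<inter> cball t \<epsilon>) x \<le> ennreal (indicator \<Theta> x * p0 x) * indicator (cball t \<epsilon>) x"
      proof (cases "x \<in> \<Theta> \<inter> cball t \<epsilon>")
        case True
        then have "dist (p0 x) (p0 t) < p0 t / 2" using elim by (intro d(2)) (auto simp: dist_commute)
        then have "p0 t / 2 \<le> p0 x" unfolding dist_real_def by linarith
        then show ?thesis using True by (simp add: ennreal_leI)
      qed simp
    qed
    also have "\<dots> = emeasure P0 (cball t \<epsilon>)"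
      by (subst base_measure_eq, subst emeasure_density) (use base_density_measurable in auto)
    finally show ?case .
  qed
  then show ?thesis using c(1) t(2) by (intro exI[of _ "p0 t / 2 * c"]) auto
qed

end

lemma finite_family_constants:
  fixes g :: "'i \<Rightarrow> real \<Rightarrow> ennreal" and e :: "'i \<Rightarrow> real"
  assumes "finite I" "\<And>i. i \<in> I \<Longrightarrow> \<exists>c>0. \<forall>\<^sub>F \<epsilon> in at_right (0::real). ennreal (c * \<epsilon> powr e i) \<le> g i \<epsilon>"
  shows "\<exists>c>0. \<forall>\<^sub>F \<epsilon> in at_right 0. ennreal (c * \<epsilon> powr (\<Sum>i\<in>I. e i)) \<le> (\<Prod>i\<in>I. g i \<epsilon>)"
proof -
  obtain c where c: "\<And>i. i \<in> I \<Longrightarrow> 0 < c i" "\<And>i. i \<in> I \<Longrightarrow> \<forall>\<^sub>F \<epsilon> in at_right 0. ennreal (c i * \<epsilon> powr e i) \<le> g i \<epsilon>"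
    using assms(2) by metis
  have "\<forall>\<^sub>F \<epsilon> in at_right 0. \<forall>i\<in>I. ennreal (c i * \<epsilon> powr e i) \<le> g i \<epsilon>"
    using c(2) assms(1) by (intro eventually_ball_finite) auto
  moreover have "\<forall>\<^sub>F \<epsilon> in at_right (0::real). 0 < \<epsilon>" by (rule eventually_at_right_less)
  ultimately have "\<forall>\<^sub>F \<epsilon> in at_right 0. ennreal ((\<Prod>i\<in>I. c i) * \<epsilon> powr (\<Sum>i\<in>I. e i)) \<le> (\<Prod>i\<in>I. g i \<epsilon>)"
  proof eventually_elim
    case (elim \<epsilon>)
    have "ennreal ((\<Prod>i\<in>I. c i) * \<epsilon> powr (\<Sum>i\<in>I. e i)) = ennreal (\<Prod>i\<in>I. c i * \<epsilon> powr e i)"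
      using elim assms(1) by (simp add: powr_sum prod.distrib)
    also have "\<dots> = (\<Prod>i\<in>I. ennreal (c i * \<epsilon> powr e i))"
      using c(1) by (simp add: prod_ennreal less_imp_le)
    also have "\<dots> \<le> (\<Prod>i\<in>I. g i \<epsilon>)" using elim by (intro prod_mono_ennreal) auto
    finally show ?case .
  qed
  then show ?thesis using c(1) by (intro exI[of _ "\<Prod>i\<in>I. c i"]) (auto intro: prod_pos)
qed

context dp_model
begin

text \<open>Sticks and atoms are independent, so a box around the first \<open>K\<close> of them has the product of the
  probabilities of its sides.  Removing a null set leaves only proper sticks and atoms in \<open>\<Theta>\<close>.\<close>
lemma prior_near_truth:
  assumes alpha: "1 \<le> \<alpha>" and base: "base_measure_on \<Theta> P0 p0" "compact \<Theta>"
    and B: "\<And>x. x \<in> \<Theta> \<Longrightarrow> norm x \<le> B"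
    and ts: "\<And>k. k < K \<Longrightarrow> ts k \<in> \<Theta> \<and> lebesgue_thick_at \<Theta> (ts k) \<and> 0 < p0 (ts k)"
  shows "\<exists>c>0. \<forall>\<^sub>F \<epsilon> in at_right 0. \<exists>E\<in>sets SB. \<exists>q.
     emeasure SB E = ennreal q \<and> c * \<epsilon> powr (\<alpha> + real K * (real DIM('a) + 1)) \<le> q \<and>
     (\<forall>\<omega>\<in>E. near_truth B \<epsilon> (fst \<omega>) (snd \<omega>))"
proof -
  interpret SB: prob_space SB by (rule prob_space_SB)
  interpret A: prob_space atoms by (rule prob_space_atoms)
  interpret PV: product_prob_space "\<lambda>_. beta_measure 1 \<alpha>" UNIV
    by (simp add: prob_space_beta[OF alpha_pos] product_prob_space_axioms.intro product_prob_space_def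
        product_sigma_finite.intro prob_space_imp_sigma_finite)
  interpret PT: product_prob_space "\<lambda>_. P0" UNIV
    by (simp add: prob_space_P0 product_prob_space_axioms.intro product_prob_space_def
        product_sigma_finite.intro prob_space_imp_sigma_finite)
  let ?b = "break_fraction ws" and ?d = "real DIM('a)"
  let ?I = "\<lambda>\<epsilon> k. {?b k - \<epsilon>..?b k - \<epsilon>/2}"
  obtain cv where cv: "0 < cv" "\<forall>\<^sub>F \<epsilon> in at_right 0. ennreal (cv * \<epsilon> powr (\<Sum>k<K. if Suc k = K then \<alpha> else 1))
      \<le> (\<Prod>k<K. emeasure (beta_measure 1 \<alpha>) (?I \<epsilon> k))"
    using finite_family_constants[of "{..<K}" "\<lambda>k. if Suc k = K then \<alpha> else 1" "\<lambda>k \<epsilon>. emeasure (beta_measure 1 \<alpha>) (?I \<epsilon> k)"]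
      beta_near_break_fraction[OF true_weights(1,2) alpha] by auto
  have ball: "\<exists>c>0. \<forall>\<^sub>F \<epsilon> in at_right 0. ennreal (c * \<epsilon> powr ?d) \<le> emeasure P0 (cball (ts k) \<epsilon>)" if k: "k < K" for k
  proof -
    obtain c where c: "0 < c" "\<forall>\<^sub>F \<epsilon> in at_right 0. ennreal (c * \<epsilon> ^ DIM('a)) \<le> emeasure P0 (cball (ts k) \<epsilon>)"
      using base_measure_ball[OF base, of "ts k"] ts[OF k] by blast
    have "\<forall>\<^sub>F \<epsilon> in at_right 0. ennreal (c * \<epsilon> powr ?d) \<le> emeasure P0 (cball (ts k) \<epsilon>)"
      using c(2) eventually_at_right_less[of 0] by eventually_elim (simp add: powr_realpow)
    with c(1) show ?thesis by blast
  qed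
  obtain ct where ct: "0 < ct" "\<forall>\<^sub>F \<epsilon> in at_right 0. ennreal (ct * \<epsilon> powr (\<Sum>k<K. ?d)) \<le> (\<Prod>k<K. emeasure P0 (cball (ts k) \<epsilon>))"
    using finite_family_constants[of "{..<K}" "\<lambda>_. ?d" "\<lambda>k \<epsilon>. emeasure P0 (cball (ts k) \<epsilon>)"] ball by auto
  \<comment> \<open>The last stick contributes \<open>\<alpha>\<close>, the others 1 each; the true sum is \<open>\<alpha> + K - 1\<close>.\<close>
  have expo: "(\<Sum>k<K. if Suc k = K then \<alpha> else 1) \<le> \<alpha> + real K"
  proof -
    have "(\<Sum>k<K. if Suc k = K then \<alpha> else 1) \<le> (\<Sum>k<K. (if K - 1 = k then \<alpha> else 0) + 1)"
      by (rule sum_mono) auto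
    also have "\<dots> = \<alpha> + real K" using true_weights(3) by (simp add: sum.distrib)
    finally show ?thesis .
  qed
  have AE: "AE \<omega> in SB. fst \<omega> \<in> proper_sticks \<and> (\<forall>k. snd \<omega> k \<in> \<Theta>)"
  proof -
    have "AE \<theta> in atoms. \<forall>k. \<theta> k \<in> \<Theta>"
      unfolding AE_all_countable
      by (intro allI AE_PiM_component prob_space_P0 AE_base_measure[OF base]) auto
    then have "AE \<theta> in distr SB atoms snd. \<forall>k. \<theta> k \<in> \<Theta>"
    proof -
      have "distr SB atoms snd = atoms"
      proof (rule measure_eqI)
        fix S assume "S \<in> sets (distr SB atoms snd)"
        then have S: "S \<in> sets atoms" by simp
        have "emeasure (distr SB atoms snd) S = emeasure SB (snd -` S \<inter> space SB)"
          by (rule emeasure_distr[OF _ S]) (simp add: stick_breaking_def)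
        also have "snd -` S \<inter> space SB = space (beta_sequence \<alpha>) \<times> S"
          using sets.sets_into_space[OF S] by (auto simp: stick_breaking_def space_pair_measure)
        also have "emeasure SB \<dots> = emeasure atoms S"
          unfolding stick_breaking_def using S by (subst A.emeasure_pair_measure_Times) (auto simp: prob_space.emeasure_space_1[OF prob_space_beta_sequence[OF alpha_pos]])
        finally show "emeasure (distr SB atoms snd) S = emeasure atoms S" .
      qed simp
      then show ?thesis using \<open>AE \<theta> in atoms. \<forall>k. \<theta> k \<in> \<Theta>\<close> by (simp only:)
    qed
    then have "AE \<omega> in SB. \<forall>k. snd \<omega> k \<in> \<Theta>"
      by (rule AE_distrD[rotated]) measurable
    with AE_SB_proper show ?thesis by eventually_elim auto
  qed
  obtain N where N: "N \<in> null_sets SB" "{\<omega> \<in> space SB. \<not> (fst \<omega> \<in> proper_sticks \<and> (\<forall>k. snd \<omega> k \<in> \<Theta>))} \<subseteq> N"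
    using AE unfolding eventually_ae_filter by blast
  have "\<forall>\<^sub>F \<epsilon> in at_right 0. 0 < \<epsilon> \<and> \<epsilon> < (1::real)"
    unfolding eventually_at_right_field by (intro exI[of _ 1]) auto
  with cv(2) ct(2) have "\<forall>\<^sub>F \<epsilon> in at_right 0. \<exists>E\<in>sets SB. \<exists>q.
     emeasure SB E = ennreal q \<and> (cv * ct) * \<epsilon> powr (\<alpha> + real K * (?d + 1)) \<le> q \<and>
     (\<forall>\<omega>\<in>E. near_truth B \<epsilon> (fst \<omega>) (snd \<omega>))"
  proof eventually_elim
    case (elim \<epsilon>)
    define V where "V = {v \<in> space (beta_sequence \<alpha>). \<forall>k\<in>{..<K}. v k \<in> ?I \<epsilon> k}"
    define T where "T = {\<theta> \<in> space atoms. \<forall>k\<in>{..<K}. \<theta> k \<in> cball (ts k) \<epsilon>}"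
    have cb: "cball (ts k) \<epsilon> \<in> sets P0" for k by (simp add: sets_P0)
    have eV: "emeasure (beta_sequence \<alpha>) V = (\<Prod>k<K. emeasure (beta_measure 1 \<alpha>) (?I \<epsilon> k))"
      unfolding V_def by (rule PV.emeasure_PiM_Collect) auto
    have eT: "emeasure atoms T = (\<Prod>k<K. emeasure P0 (cball (ts k) \<epsilon>))"
      unfolding T_def by (rule PT.emeasure_PiM_Collect) (use cb in auto)
    have V: "V \<in> sets (beta_sequence \<alpha>)" unfolding V_def by measurable
    have T: "T \<in> sets atoms" unfolding T_def
    proof (rule sets.sets_Collect_finite_All)
      fix k
      have "(\<lambda>\<theta>. \<theta> k) -` cball (ts k) \<epsilon> \<inter> space atoms \<in> sets atoms"
        by (rule measurable_sets[OF _ cb]) (rule measurable_component_singleton, simp)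
      also have "(\<lambda>\<theta>. \<theta> k) -` cball (ts k) \<epsilon> \<inter> space atoms = {\<theta> \<in> space atoms. \<theta> k \<in> cball (ts k) \<epsilon>}"
        by blast
      finally show "{\<theta> \<in> space atoms. \<theta> k \<in> cball (ts k) \<epsilon>} \<in> sets atoms" .
    qed simp
    define E where "E = V \<times> T - N"
    have VT: "V \<times> T \<in> sets SB" using V T by (simp add: stick_breaking_def)
    have "emeasure SB E = emeasure SB (V \<times> T)"
      unfolding E_def by (rule emeasure_Diff_null_set[OF N(1) VT])
    also have "\<dots> = emeasure (beta_sequence \<alpha>) V * emeasure atoms T"
      unfolding stick_breaking_def by (rule A.emeasure_pair_measure_Times[OF V T])
    finally have eE: "emeasure SB E = emeasure (beta_sequence \<alpha>) V * emeasure atoms T" .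
    show ?case
    proof (intro bexI[of _ E] exI[of _ "measure SB E"] conjI ballI)
      show "E \<in> sets SB" unfolding E_def using VT N(1) by auto
      show "emeasure SB E = ennreal (measure SB E)" by (rule SB.emeasure_eq_measure)
      have "cv * ct * \<epsilon> powr (\<alpha> + real K * (?d + 1)) \<le> cv * ct * \<epsilon> powr ((\<Sum>k<K. if Suc k = K then \<alpha> else 1) + (\<Sum>k<K. ?d))"
        using expo elim(3) cv(1) ct(1) by (intro mult_left_mono powr_mono') (simp_all add: distrib_left)
      also have "\<dots> = (cv * \<epsilon> powr (\<Sum>k<K. if Suc k = K then \<alpha> else 1)) * (ct * \<epsilon> powr (\<Sum>k<K. ?d))"
        by (simp only: powr_add mult_ac)
      finally have "ennreal (cv * ct * \<epsilon> powr (\<alpha> + real K * (?d + 1)))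
         \<le> ennreal ((cv * \<epsilon> powr (\<Sum>k<K. if Suc k = K then \<alpha> else 1)) * (ct * \<epsilon> powr (\<Sum>k<K. ?d)))"
        by (rule ennreal_leI)
      also have "\<dots> = ennreal (cv * \<epsilon> powr (\<Sum>k<K. if Suc k = K then \<alpha> else 1)) * ennreal (ct * \<epsilon> powr (\<Sum>k<K. ?d))"
        using cv(1) by (intro ennreal_mult') auto
      also have "\<dots> \<le> emeasure SB E"
        unfolding eE eV eT by (intro mult_mono elim(1,2)) simp_all
      finally show "cv * ct * \<epsilon> powr (\<alpha> + real K * (?d + 1)) \<le> measure SB E"
        by (simp add: SB.emeasure_eq_measure)
      fix \<omega> assume \<omega>: "\<omega> \<in> E"
      then have sp: "\<omega> \<in> space SB" using sets.sets_into_space[OF VT] by (auto simp: E_def)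
      have psticks: "fst \<omega> \<in> proper_sticks" and th: "\<forall>k. snd \<omega> k \<in> \<Theta>"
        using \<omega> sp N(2) unfolding E_def by blast+
      have v: "0 < fst \<omega> k \<and> fst \<omega> k < 1" for k using proper_sticksD[OF psticks] by auto
      have near: "?b k - \<epsilon> \<le> fst \<omega> k \<and> fst \<omega> k \<le> ?b k" if "k < K" for k
      proof -
        have "fst \<omega> k \<in> ?I \<epsilon> k" using \<omega> that unfolding E_def V_def by (simp add: mem_Times_iff)
        then show ?thesis using elim(3) by simp
      qed
      have "stick_rest (fst \<omega>) K \<le> \<epsilon>"
        by (rule sticks_near_break_fraction(2)[where w=ws]) (fact true_weights(1) true_weights(2) v near)+
      moreover have "\<forall>k<K. \<bar>stick_weight (fst \<omega>) k - ws k\<bar> \<le> real K * \<epsilon> \<and> norm (snd \<omega> k - ts k) \<le> \<epsilon>"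
      proof (intro allI impI conjI)
        fix k assume k: "k < K"
        show "\<bar>stick_weight (fst \<omega>) k - ws k\<bar> \<le> real K * \<epsilon>" 
          by (rule sticks_near_break_fraction(1)[where w=ws]) (fact true_weights(1) true_weights(2) v near k)+
        show "norm (snd \<omega> k - ts k) \<le> \<epsilon>"
          using \<omega> k unfolding E_def T_def by (simp add: mem_Times_iff dist_norm norm_minus_commute)
      qed
      ultimately show "near_truth B \<epsilon> (fst \<omega>) (snd \<omega>)"
        using psticks th B unfolding near_truth_def by blast
    qed
  qed
  then show ?thesis using cv(1) ct(1) by (intro exI[of _ "cv * ct"]) auto
qed

section \<open>Concentration of the number of clusters\<close>

text \<open>With \<open>\<epsilon> = n powr (-3/5)\<close> the variance term \<open>(1 + A * \<epsilon>\<^sup>2) ^ n - 1\<close> vanishes, since \<open>n * \<epsilon>\<^sup>2\<close> does.  The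
  other term is the quotient of the prior tail and the prior mass near the truth; the condition on \<open>\<alpha>\<close>
  says that its exponent is negative.\<close>
lemma posterior_typical:
  assumes sb: "smooth_bounded_kernel f" and lg: "log_derivative_growth f"
    and base: "base_measure_on \<Theta> P0 p0" "compact \<Theta>"
    and ts: "\<And>k. k < K \<Longrightarrow> ts k \<in> \<Theta> \<and> lebesgue_thick_at \<Theta> (ts k) \<and> 0 < p0 (ts k)"
    and alpha: "1 \<le> \<alpha>" "4 * (real K * (real DIM('a) + 1)) < \<alpha>" and "0 < \<delta>"
  shows "(\<lambda>n. measure XS {X \<in> space XS.
     \<bar>measure (allocation_posterior \<alpha> P0 f n X) (({..<n} \<rightarrow>\<^sub>E UNIV) - atypical_alloc \<alpha> n) - 1\<bar> > \<delta>}) \<longlonglongrightarrow> 0"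
    (is "?m \<longlonglongrightarrow> 0")
proof -
  obtain B where B: "\<And>x. x \<in> \<Theta> \<Longrightarrow> norm x \<le> B"
    using compact_imp_bounded[OF base(2)] by (auto simp: bounded_iff)
  have tsB: "norm (ts k) \<le> B" if "k < K" for k using B ts that by blast
  obtain A where A: "0 \<le> A" "\<And>v \<theta> \<epsilon>. near_truth B \<epsilon> v \<theta> \<Longrightarrow>
      (\<integral>\<^sup>+x. ennreal ((dp_ratio v \<theta> x)\<^sup>2) \<partial>Q) \<le> ennreal (1 + A * \<epsilon>\<^sup>2)"
    using dp_ratio_second_moment[OF sb lg tsB] by auto
  define s where "s = \<alpha> + real K * (real DIM('a) + 1)"
  obtain c where c: "0 < c" "\<forall>\<^sub>F \<epsilon> in at_right 0. \<exists>E\<in>sets SB. \<exists>q.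
     emeasure SB E = ennreal q \<and> c * \<epsilon> powr s \<le> q \<and>
     (\<forall>\<omega>\<in>E. near_truth B \<epsilon> (fst \<omega>) (snd \<omega>))"
    using prior_near_truth[OF alpha(1) base B ts] unfolding s_def by blast
  let ?\<epsilon> = "\<lambda>n. real n powr (-3/5)"
  have "filterlim ?\<epsilon> (at_right 0) sequentially" by real_asymp
  from eventually_compose_filterlim[OF c(2) this] prior_atypical_alloc[OF alpha(1)] eventually_gt_at_top[of 0]
  have upper: "\<forall>\<^sub>F n in sequentially. ?m n \<le> 4 * (exp (A * real n powr (-1/5)) - 1)
      + 14 / (\<delta> * c) * real n powr (- (3/4 * \<alpha> - 3/5 * s))"
  proof eventually_elim
    case (elim n)
    then obtain E q where E: "E \<in> sets SB" and q: "emeasure SB E = ennreal q" "c * ?\<epsilon> n powr s \<le> q"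
      and near: "\<And>\<omega>. \<omega> \<in> E \<Longrightarrow> near_truth B (?\<epsilon> n) (fst \<omega>) (snd \<omega>)"
      by blast
    have n: "0 < real n" using elim by simp
    have qpos: "0 < q" using q(2) c(1) n less_le_trans[of 0 "c * ?\<epsilon> n powr s" q] by simp
    have "?m n \<le> 4 * ((1 + A * (?\<epsilon> n)\<^sup>2) ^ n - 1) + 2 * (7 * real n powr (- (3/4 * \<alpha>))) / (\<delta> * q)"
    proof (rule posterior_concentration[OF E q(1) qpos])
      fix \<omega> assume "\<omega> \<in> E"
      note near_\<omega> = near[OF this]
      then show "fst \<omega> \<in> proper_sticks" by (simp add: near_truth_def)
      show "(\<integral>\<^sup>+x. ennreal ((dp_ratio (fst \<omega>) (snd \<omega>) x)\<^sup>2) \<partial>Q) \<le> ennreal (1 + A * (?\<epsilon> n)\<^sup>2)"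
        by (rule A(2)[OF near_\<omega>])
    qed (use elim A(1) \<open>0 < \<delta>\<close> in auto)
    also have "\<dots> \<le> 4 * (exp (A * real n powr (-1/5)) - 1) + 14 / (\<delta> * c) * real n powr (- (3/4 * \<alpha> - 3/5 * s))"
    proof (rule add_mono)
      have "(1 + A * (?\<epsilon> n)\<^sup>2) ^ n \<le> exp (A * (?\<epsilon> n)\<^sup>2) ^ n"
        using A(1) by (intro power_mono exp_ge_add_one_self) auto
      also have "\<dots> = exp (A * (real n * (?\<epsilon> n)\<^sup>2))" by (simp add: exp_of_nat_mult[symmetric] mult_ac)
      also have "real n * (?\<epsilon> n)\<^sup>2 = real n powr (-1/5)"
        using n powr_add[of "real n" 1 "-6/5"] by (simp add: powr_realpow[symmetric] powr_powr)
      finally show "4 * ((1 + A * (?\<epsilon> n)\<^sup>2) ^ n - 1) \<le> 4 * (exp (A * real n powr (-1/5)) - 1)" by simp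
      have "2 * (7 * real n powr (- (3/4 * \<alpha>))) / (\<delta> * q) \<le> 2 * (7 * real n powr (- (3/4 * \<alpha>))) / (\<delta> * (c * ?\<epsilon> n powr s))"
        using q(2) qpos c(1) n \<open>0 < \<delta>\<close> by (intro divide_left_mono mult_left_mono mult_pos_pos) auto
      also have "\<dots> = 14 / (\<delta> * c) * (real n powr (- (3/4 * \<alpha>)) / real n powr (-3/5 * s))"
        by (simp add: powr_powr)
      also have "real n powr (- (3/4 * \<alpha>)) / real n powr (-3/5 * s) = real n powr (- (3/4 * \<alpha> - 3/5 * s))"
        using n by (simp add: powr_diff[symmetric])
      finally show "2 * (7 * real n powr (- (3/4 * \<alpha>))) / (\<delta> * q) \<le> 14 / (\<delta> * c) * real n powr (- (3/4 * \<alpha> - 3/5 * s))" .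
    qed
    finally show ?case .
  qed
  have e: "0 < 3/4 * \<alpha> - 3/5 * s" using alpha(2) by (simp add: s_def field_simps)
  define e where "e = 3/4 * \<alpha> - 3/5 * s"
  have "(\<lambda>n. real n powr (- e)) \<longlonglongrightarrow> 0"
    using e unfolding e_def[symmetric] by real_asymp
  moreover have "(\<lambda>n. real n powr (-1/5)) \<longlonglongrightarrow> 0" by real_asymp
  ultimately have "(\<lambda>n. 4 * (exp (A * real n powr (-1/5)) - 1) + 14 / (\<delta> * c) * real n powr (- e))
      \<longlonglongrightarrow> 4 * (exp (A * 0) - 1) + 14 / (\<delta> * c) * 0"
    by (intro tendsto_intros)
  then show ?thesis
    by (intro tendsto_sandwich[OF _ upper tendsto_const]) (simp_all add: e_def)
qed

end

lemma num_clusters_in_prob: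
  fixes f :: "'a::euclidean_space \<Rightarrow> real" and \<theta> :: "nat \<Rightarrow> 'a"
  assumes dens: "probability_density f" and params: "finite_mixing_params K w \<theta>"
    and base: "base_measure_on \<Theta> P0 p0" and cpt: "compact \<Theta>"
    and atoms: "\<And>k. k < K \<Longrightarrow> \<theta> k \<in> \<Theta> \<and> lebesgue_thick_at \<Theta> (\<theta> k) \<and> 0 < p0 (\<theta> k)"
    and sb: "smooth_bounded_kernel f" and lg: "log_derivative_growth f"
    and \<alpha>: "4 * (real K * (real DIM('a) + 1)) + 1 < \<alpha>"
  shows "tendsto_in_prob (iid_sequence (data_law K w \<theta> f))
          (\<lambda>n X. measure (allocation_posterior \<alpha> P0 f n X)
             {c \<in> {..<n} \<rightarrow>\<^sub>E UNIV.
                (1 + 4) * \<alpha> * ln (real n) \<ge> real (num_clusters n c) \<and>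
                real (num_clusters n c) \<ge> (1 - 199/200) * \<alpha> * ln (real n)})
          1"
proof -
  obtain F where F: "\<And>x. 0 < f x" "\<And>x. f x < F"
    using sb by (auto simp: smooth_bounded_kernel_def)
  have "0 \<le> 4 * (real K * (real DIM('a) + 1))" by simp
  then have \<alpha>1: "1 \<le> \<alpha>" using \<alpha> by linarith
  interpret dp_model f F K w \<theta> \<alpha> P0
  proof (intro dp_model.intro true_mixture.intro dp_model_axioms.intro)
    show "prob_space P0" using base unfolding base_measure_on_def by blast
    show "sets P0 = sets borel" by (rule sets_base_measure[OF base cpt])
    show "0 < \<alpha>" using \<alpha>1 by simp
    show "0 < f x" "f x < F" for x by (rule F)+
  qed (fact dens params)+
  have set_eq: "{c \<in> {..<n} \<rightarrow>\<^sub>E UNIV. (1 + 4) * \<alpha> * ln (real n) \<ge> real (num_clusters n c) \<and>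
       real (num_clusters n c) \<ge> (1 - 199/200) * \<alpha> * ln (real n)} = ({..<n} \<rightarrow>\<^sub>E UNIV) - atypical_alloc \<alpha> n" for n
  proof -
    have eqs: "(1 + 4) * \<alpha> * ln (real n) = 5 * (\<alpha> * ln (real n))"
      "(1 - 199/200) * \<alpha> * ln (real n) = \<alpha> * ln (real n) / 200" by simp_all
    show ?thesis unfolding atypical_alloc_def eqs by blast
  qed
  show ?thesis
    unfolding tendsto_in_prob_def iid_sequence_def set_eq
  proof (intro allI impI)
    fix \<delta> :: real assume "0 < \<delta>"
    show "(\<lambda>n. measure XS {X \<in> space XS.
       \<delta> < \<bar>measure (allocation_posterior \<alpha> P0 f n X) (({..<n} \<rightarrow>\<^sub>E UNIV) - atypical_alloc \<alpha> n) - 1\<bar>}) \<longlonglongrightarrow> 0"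
      by (rule posterior_typical[OF sb lg base cpt atoms \<alpha>1 _ \<open>0 < \<delta>\<close>]) (use \<alpha> in simp_all)
  qed
qed

text \<open>The summand 1 in the threshold keeps it positive and \<open>\<alpha> \<ge> 1\<close> for every \<open>K\<close>; for \<open>\<alpha> \<ge> 1\<close> the density
  of a stick is bounded and decreasing.\<close>
lemma num_clusters_in_prob_ex:
  fixes f :: "'a::euclidean_space \<Rightarrow> real" and \<theta> :: "nat \<Rightarrow> 'a"
  assumes "probability_density f" "finite_mixing_params K w \<theta>"
    "base_measure_on \<Theta> P0 p0" "compact \<Theta>"
    "\<forall>k<K. \<theta> k \<in> \<Theta> \<and> lebesgue_thick_at \<Theta> (\<theta> k)" "\<forall>k<K. 0 < p0 (\<theta> k)"
    "smooth_bounded_kernel f" "log_derivative_growth f"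
  shows "\<exists>\<delta>l \<delta>u. 0 < \<delta>l \<and> \<delta>l < 1 \<and> 0 < \<delta>u \<and>
      (\<forall>\<alpha>>4 * (real K * (real DIM('a) + 1)) + 1.
        tendsto_in_prob (iid_sequence (data_law K w \<theta> f))
          (\<lambda>n X. measure (allocation_posterior \<alpha> P0 f n X)
             {c \<in> {..<n} \<rightarrow>\<^sub>E UNIV.
                (1 + \<delta>u) * \<alpha> * ln (real n) \<ge> real (num_clusters n c) \<and>
                real (num_clusters n c) \<ge> (1 - \<delta>l) * \<alpha> * ln (real n)})
          1)"
proof (rule exI[of _ "199/200"], rule exI[of _ 4], intro conjI allI impI)
  fix \<alpha> assume "4 * (real K * (real DIM('a) + 1)) + 1 < \<alpha>"
  then show "tendsto_in_prob (iid_sequence (data_law K w \<theta> f))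
          (\<lambda>n X. measure (allocation_posterior \<alpha> P0 f n X)
             {c \<in> {..<n} \<rightarrow>\<^sub>E UNIV.
                (1 + 4) * \<alpha> * ln (real n) \<ge> real (num_clusters n c) \<and>
                real (num_clusters n c) \<ge> (1 - 199/200) * \<alpha> * ln (real n)})
          1"
    using assms by (intro num_clusters_in_prob[where \<Theta>=\<Theta> and ?p0.0=p0]) simp_all
qed simp_all

theorem theorem4:
  fixes K :: nat
  shows "\<exists>\<alpha>s>0. \<forall>(f :: 'a::euclidean_space \<Rightarrow> real) \<Theta> P0 p0 w \<theta>.
    probability_density f \<and>
    finite_mixing_params K w \<theta> \<and>
    compact \<Theta> \<and> (\<forall>k<K. \<theta> k \<in> \<Theta> \<and> lebesgue_thick_at \<Theta> (\<theta> k)) \<and>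
    base_measure_on \<Theta> P0 p0 \<and> (\<forall>k<K. 0 < p0 (\<theta> k)) \<and>
    smooth_bounded_kernel f \<and>
    log_derivative_growth f \<and>
    derivative_decay f \<longrightarrow>
    (\<exists>\<delta>l \<delta>u. 0 < \<delta>l \<and> \<delta>l < 1 \<and> 0 < \<delta>u \<and>
      (\<forall>\<alpha>>\<alpha>s.
        tendsto_in_prob (iid_sequence (data_law K w \<theta> f))
          (\<lambda>n X. measure (allocation_posterior \<alpha> P0 f n X)
             {c \<in> {..<n} \<rightarrow>\<^sub>E UNIV.
                (1 + \<delta>u) * \<alpha> * ln (real n) \<ge> real (num_clusters n c) \<and>
                real (num_clusters n c) \<ge> (1 - \<delta>l) * \<alpha> * ln (real n)})
          1))"
proof (rule exI[of _ "4 * (real K * (real DIM('a) + 1)) + 1"], rule conjI)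
  show "0 < 4 * (real K * (real DIM('a) + 1)) + 1" by (simp add: add_nonneg_pos)
qed (intro allI impI, elim conjE, rule num_clusters_in_prob_ex, assumption+)

end
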